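(* Let $m\ge1$ be an integer and consider the first-kind Volterra integral equation $\int_0^t k(t,s)y(s)\,ds=g(t)$, $t\in I=[0,T]$, where $g(0)=0$ and $|k(t,t)|\ge k_0>0$ for all $t\in I$. Assume that $g\in C^{m+3}(I)$ and $k\in C^{m+3}(D)$. Let $y$ be the exact solution and let $y_h\in S_{m-1}^{(-1)}(I_h)$ be the perturbed discontinuous Galerkin solution defined by $$\int_{t_n}^{t_{n+1}}\Bigl(\int_0^sk(s,\tau)y_h(\tau)\,d\tau\Bigr)\phi(s)\,ds=\int_{t_n}^{t_{n+1}}g(s)\phi(s)\,ds+\int_{t_n}^{t_{n+1}}\delta(s)\phi(s)\,ds$$ for all $\phi\in S_{m-1}^{(-1)}(I_h)$ and $0\le n\le N-1$, with perturbation $\delta=O(h^{m_1})$. Then, for all uniform meshes $I_h$ with sufficiently small $h$, $y_h$ converges uniformly to $y$, with attainable global order of convergence given by $$\|y-y_h\|_\infty=\sup_{t\in I}|y(t)-y_h(t)|\le\begin{cases}C h^{\min\{m,\,m_1-2\}}&\text{if } m\text{ is odd},\\ C h^{\min\{m-1,\,m_1-2\}}&\text{if } m\text{ is even},\end{cases}$$ where $C$ is a constant independent of $h$.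
   Context: $I=[0,T]$, $D=\{(t,s):0\le s\le t\le T\}$; all functions are real-valued. For an integer $N\ge2$, the uniform mesh is $I_h=\{t_n=nh:0\le n\le N\}$ with $h=T/N$, and $\sigma_n=(t_n,t_{n+1}]$. $S_{m-1}^{(-1)}(I_h)$ is the space of functions $v$ such that $v|_{\sigma_n}$ is a real polynomial of degree at most $m-1$ for each $0\le n\le N-1$ (no continuity at mesh points); the value at $t=0$ is understood as the limit from the right. The perturbation $\delta$ is a function on $I$ that may depend on $h$; $\delta=O(h^{m_1})$ means that $\sup_{t\in I}|\delta(t)|\le C' h^{m_1}$ with $C'$ independent of $h$, where $m_1$ is fixed.
   Formalization: Uniform convergence of y_h to y is asserted only for m_1 > 2, since for m_1 ≤ 2 it can fail (m = 1, k = 1, δ = (-1)^n h^2 on σ_n); the error bound is asserted for every real m_1. *)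

theory Defs
  imports "HOL-Analysis.Analysis" "HOL-Computational_Algebra.Polynomial"
begin

text \<open>
  Functions of class \<open>C^n\<close> on a set \<open>S\<close> that need not be open: derivatives are taken within \<open>S\<close>
  (hence one-sided at the end points of a compact interval), and all iterated directional
  derivatives up to order \<open>n\<close> are required to be continuous on the whole of \<open>S\<close>. On sets such as a
  nondegenerate interval or triangle the derivative within \<open>S\<close> is unique.
\<close>

primrec C_diff_on :: "nat \<Rightarrow> 'a::real_normed_vector set \<Rightarrow> ('a \<Rightarrow> real) \<Rightarrow> bool" where
  "C_diff_on 0 S f \<longleftrightarrow> continuous_on S f"
| "C_diff_on (Suc n) S f \<longleftrightarrow>
     (\<exists>f'. (\<forall>x\<in>S. (f has_derivative f' x) (at x within S)) \<and> (\<forall>v. C_diff_on n S (\<lambda>x. f' x v)))"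

definition triangle :: "real \<Rightarrow> (real \<times> real) set" where
  "triangle T = {(t, s). 0 \<le> s \<and> s \<le> t \<and> t \<le> T}"

definition mesh_size :: "real \<Rightarrow> nat \<Rightarrow> real" where
  "mesh_size T N = T / real N"

definition node :: "real \<Rightarrow> nat \<Rightarrow> nat \<Rightarrow> real" where
  "node T N n = real n * mesh_size T N"

text \<open>
  The space \<open>S\<^sub>d\<^sup>(\<^sup>-\<^sup>1\<^sup>)\<close> of discontinuous piecewise polynomials of degree at most \<open>d\<close> on the uniform
  mesh with \<open>N\<close> subintervals. The half-open subintervals leave out \<open>0\<close>, where the value is the limit
  from the right. Values outside \<open>[0, T]\<close> are irrelevant and unconstrained.
\<close>

definition dg_space :: "real \<Rightarrow> nat \<Rightarrow> nat \<Rightarrow> (real \<Rightarrow> real) set" where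
  "dg_space T N d =
     {v. (\<forall>n<N. \<exists>p::real poly. degree p \<le> d \<and>
            (\<forall>t\<in>{node T N n<..node T N (Suc n)}. v t = poly p t)) \<and>
         (v \<longlongrightarrow> v 0) (at_right 0)}"

definition volterra_solution ::
    "real \<Rightarrow> (real \<Rightarrow> real \<Rightarrow> real) \<Rightarrow> (real \<Rightarrow> real) \<Rightarrow> (real \<Rightarrow> real) \<Rightarrow> bool" where
  "volterra_solution T k g y \<longleftrightarrow>
     continuous_on {0..T} y \<and>
     (\<forall>t\<in>{0..T}. integral {0..t} (\<lambda>s. k t s * y s) = g t)"

definition perturbed_dg_solution ::
    "real \<Rightarrow> nat \<Rightarrow> nat \<Rightarrow> (real \<Rightarrow> real \<Rightarrow> real) \<Rightarrow> (real \<Rightarrow> real) \<Rightarrow> (real \<Rightarrow> real) \<Rightarrow>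
     (real \<Rightarrow> real) \<Rightarrow> bool" where
  "perturbed_dg_solution T N m k g \<delta> yh \<longleftrightarrow>
     yh \<in> dg_space T N (m - 1) \<and>
     (\<forall>\<phi>\<in>dg_space T N (m - 1). \<forall>n<N.
        integral {node T N n..node T N (Suc n)}
          (\<lambda>s. integral {0..s} (\<lambda>\<tau>. k s \<tau> * yh \<tau>) * \<phi> s) =
        integral {node T N n..node T N (Suc n)} (\<lambda>s. g s * \<phi> s) +
        integral {node T N n..node T N (Suc n)} (\<lambda>s. \<delta> s * \<phi> s))"

end

theory Submission
  imports Defs
begin

text \<open>
  Write \<open>P\<close> for the primitive of a piecewise polynomial \<open>p\<close>. Integration by parts turns the Volterra
  operator into \<open>W t = k t t * P t - mem P t\<close>, where the memory term \<open>mem P\<close> is Lipschitz with a constant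
  controlled by the maximum of \<open>P\<close>. On one cell \<open>W\<close> is therefore a polynomial of degree \<open>m\<close> up to \<open>O(h)\<close>, and being
  orthogonal to the test polynomials it is a multiple of the Legendre polynomial: its modulus is
  carried from one node to the next with amplification factor \<open>1 + O(h)\<close>. This gives stability with a
  loss of \<open>h\<^sup>-\<^sup>2\<close> for rough residuals, but only \<open>h\<^sup>-\<^sup>1\<close> for Lipschitz residuals, which can be subtracted from \<open>W\<close>.

  For consistency, \<open>y\<close> is compared with a piecewise polynomial whose defect has mean zero on every cell.
  Its residual is \<open>O(h\<^sup>m\<^sup>+\<^sup>1)\<close>. When \<open>m\<close> is odd, the defect can be shaped so that the leading part of the
  residual is Lipschitz, and the remainder is \<open>O(h\<^sup>m\<^sup>+\<^sup>2)\<close>; this is what gains one order.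
\<close>

section \<open>Polynomials on an interval\<close>

text \<open>A first-kind equation gives no direct hold on \<open>y - yh\<close>. Its primitive,
  however, satisfies a second-kind relation, because \<open>k t t\<close> stays away from zero, and
  is therefore bounded by the residual \<open>W\<close>. Passing from node to node has no damping
  (the factor is exactly \<open>1\<close> before the \<open>O(h)\<close> corrections), so rough
  residuals add up over the \<open>T / h\<close> cells: this is the first factor
  \<open>1 / h\<close>. The second one comes from the inverse estimate that recovers a piecewise
  polynomial from its primitive. A Lipschitz residual varies only by \<open>O(h)\<close> inside a
  cell, so its contributions sum to \<open>O(1)\<close> and the first factor is saved. The
  perturbation is merely bounded and pays both factors, whence \<open>m1 - 2\<close>. The inverse
  estimate requires polynomials, which is why a comparison function is inserted between
  \<open>y\<close> and \<open>yh\<close>. Parity enters through the Legendre polynomial of degree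
  \<open>m + 1\<close>: only for odd \<open>m\<close> are its two end values equal, so that
  subtracting one constant makes it vanish at both nodes.\<close>

lemma poly_antiderivative:
  fixes q :: "real poly"
  shows "\<exists>Q. pderiv Q = q \<and> degree Q \<le> Suc (degree q) \<and> poly Q 0 = 0"
proof -
  define Q where "Q = (\<Sum>i\<le>degree q. monom (coeff q i / real (Suc i)) (Suc i))"
  have "pderiv Q = (\<Sum>i\<le>degree q. monom (coeff q i) i)"
    unfolding Q_def by (simp add: higher_pderiv_sum[of 1, simplified] pderiv_monom del: of_nat_Suc)
  also have "\<dots> = q" by (rule poly_as_sum_of_monoms)
  finally have "pderiv Q = q" .
  moreover have "degree Q \<le> Suc (degree q)"
    unfolding Q_def by (intro degree_sum_le) (auto intro: order_trans[OF degree_monom_le])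
  moreover have "poly Q 0 = 0"
    unfolding Q_def by (simp add: poly_sum poly_monom)
  ultimately show ?thesis by blast
qed

lemma has_integral_pderiv:
  fixes Q :: "real poly"
  assumes "a \<le> b"
  shows "(poly (pderiv Q) has_integral (poly Q b - poly Q a)) {a..b}"
  using assms
  by (intro fundamental_theorem_of_calculus)
     (auto intro!: has_field_derivative_at_within poly_DERIV simp flip: has_real_derivative_iff_has_vector_derivative)

text \<open>Norm equivalence on a finite-dimensional space, proved by splitting off the value at the
  left end: \<open>p = p(a) + (x - a) * q\<close>. The quotient \<open>q\<close> has lower degree,
  but \<open>x - a\<close> can be divided out only away from \<open>a\<close>. So the induction
  passes to the right half \<open>{c..b}\<close> and must run over all \<open>a < b\<close>, while
  the target \<open>{0..1}\<close> stays fixed.\<close>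

lemma poly_inverse_estimate:
  fixes a b :: real
  assumes "a < b"
  shows "\<exists>C>0. \<forall>p M. degree p \<le> d \<longrightarrow> (\<forall>x\<in>{a..b}. \<bar>poly p x\<bar> \<le> M) \<longrightarrow>
     (\<forall>x\<in>{0..1}. \<bar>poly p x\<bar> \<le> C * M \<and> \<bar>poly (pderiv p) x\<bar> \<le> C * M)"
  using assms
proof (induction d arbitrary: a b)
  case 0
  have "\<bar>poly p x\<bar> \<le> 1 * M \<and> \<bar>poly (pderiv p) x\<bar> \<le> 1 * M"
    if "degree p \<le> 0" "\<forall>x\<in>{a..b}. \<bar>poly p x\<bar> \<le> M" for p M x
  proof -
    have "degree p = 0" using that(1) by simp
    then obtain c where "p = [:c:]" by (rule degree_eq_zeroE)
    then show ?thesis using that(2) 0 by (auto simp: Ball_def dest!: spec[of _ a])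
  qed
  then show ?case by (meson zero_less_one)
next
  case (Suc d)
  define c where "c = (a + b) / 2"
  have c: "a < c" "c < b" using Suc.prems by (auto simp: c_def)
  obtain C where C: "C > 0" "\<And>(p::real poly) M x. degree p \<le> d \<Longrightarrow> (\<forall>x\<in>{c..b}. \<bar>poly p x\<bar> \<le> M) \<Longrightarrow> x \<in> {0..1} \<Longrightarrow>
     \<bar>poly p x\<bar> \<le> C * M \<and> \<bar>poly (pderiv p) x\<bar> \<le> C * M"
    using Suc.IH[OF c(2)] by blast
  define E where "E = C * (2 / (c - a))"
  have E: "E > 0" using C c by (simp add: E_def)
  have "\<bar>poly p x\<bar> \<le> (1 + E * (2 + \<bar>a\<bar>)) * M \<and> \<bar>poly (pderiv p) x\<bar> \<le> (1 + E * (2 + \<bar>a\<bar>)) * M"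
    if p: "degree p \<le> Suc d" "\<forall>x\<in>{a..b}. \<bar>poly p x\<bar> \<le> M" and x: "x \<in> {0..1}" for p M x
  proof -
    have "poly (p - [:poly p a:]) a = 0" by simp
    then obtain q where q: "p - [:poly p a:] = [:-a, 1:] * q"
      by (metis poly_eq_0_iff_dvd dvdE)
    have p_eq: "p = [:poly p a:] + [:-a, 1:] * q"
      using q by (metis diff_add_cancel add.commute)
    have dq: "degree q \<le> d"
    proof (cases "q = 0")
      case False
      have "degree ([:-a, 1:] * q) = Suc (degree q)"
        using False by (subst degree_mult_eq) auto
      moreover have "degree (p - [:poly p a:]) \<le> Suc d"
        using p by (intro degree_diff_le) auto
      ultimately show ?thesis using q by simp
    qed simp
    have M: "\<bar>poly p a\<bar> \<le> M" "M \<ge> 0" using p Suc.prems abs_ge_zero[of "poly p a"] by force+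
    have "\<bar>poly q z\<bar> \<le> 2 / (c - a) * M" if z: "z \<in> {c..b}" for z
    proof -
      have "poly p z - poly p a = (z - a) * poly q z"
        by (subst (1) p_eq) (simp add: algebra_simps)
      moreover have "\<bar>poly p z\<bar> \<le> M" using p z c by auto
      ultimately have "\<bar>z - a\<bar> * \<bar>poly q z\<bar> \<le> 2 * M" using M by (simp flip: abs_mult)
      moreover have "(c - a) * \<bar>poly q z\<bar> \<le> \<bar>z - a\<bar> * \<bar>poly q z\<bar>"
        using z c by (intro mult_right_mono) auto
      ultimately show ?thesis using c by (simp add: field_simps)
    qed
    then have B: "\<bar>poly q x\<bar> \<le> E * M" "\<bar>poly (pderiv q) x\<bar> \<le> E * M"
      using C(2)[OF dq _ x, of "2 / (c - a) * M"] by (auto simp: E_def mult.assoc)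
    have xa: "\<bar>x - a\<bar> \<le> 1 + \<bar>a\<bar>" using x by auto
    have e1: "poly p x = poly p a + (x - a) * poly q x"
      by (subst (1) p_eq) (simp add: algebra_simps)
    have e2: "poly (pderiv p) x = poly q x + (x - a) * poly (pderiv q) x"
      by (subst (1) p_eq) (simp only: pderiv_add pderiv_mult, simp add: pderiv_pCons algebra_simps)
    have EM: "0 \<le> E * M" using E M by simp
    have "\<bar>(x - a) * poly q x\<bar> \<le> (1 + \<bar>a\<bar>) * (E * M)" "\<bar>(x - a) * poly (pderiv q) x\<bar> \<le> (1 + \<bar>a\<bar>) * (E * M)"
      unfolding abs_mult using xa B by (auto intro!: mult_mono)
    then show ?thesis using B M EM unfolding e1 e2 by (auto simp: algebra_simps)
  qed
  moreover have "1 + E * (2 + \<bar>a\<bar>) > 0" using E by (simp add: add_pos_nonneg)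
  ultimately show ?case by blast
qed

text \<open>The hypothesis is quadratic in \<open>S\<close> on the left and linear on the right, so
  one factor of the size of \<open>S\<close> cancels. The primitive \<open>F\<close> of
  \<open>x * S^2\<close> is monotone with maximum \<open>poly F 1\<close>, and the inverse estimate
  turns this into a pointwise bound of \<open>x * S^2\<close>. The weight is removed on
  \<open>{1/2..1}\<close>, away from its zero, and a second inverse estimate carries the bound back
  to \<open>{0..1}\<close>.\<close>

lemma poly_bound_of_weighted_square:
  "\<exists>C>0. \<forall>(S::real poly) \<theta>. degree S \<le> d \<longrightarrow> 0 \<le> \<theta> \<longrightarrow>
     integral {0..1} (\<lambda>x. x * (poly S x)\<^sup>2) \<le> \<theta> * integral {0..1} (\<lambda>x. \<bar>poly S x\<bar>) \<longrightarrow>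
     (\<forall>x\<in>{0..1}. \<bar>poly S x\<bar> \<le> C * \<theta>)"
proof -
  obtain C where C: "C > 0" "\<And>(p::real poly) M x. degree p \<le> 2 * d + 2 \<Longrightarrow> (\<forall>x\<in>{0..1}. \<bar>poly p x\<bar> \<le> M) \<Longrightarrow> x \<in> {0..1} \<Longrightarrow>
     \<bar>poly p x\<bar> \<le> C * M \<and> \<bar>poly (pderiv p) x\<bar> \<le> C * M"
    using poly_inverse_estimate[of 0 1 "2 * d + 2", OF zero_less_one] by blast
  obtain C' where C': "C' > 0" "\<And>(p::real poly) M x. degree p \<le> d \<Longrightarrow> (\<forall>x\<in>{1/2..1}. \<bar>poly p x\<bar> \<le> M) \<Longrightarrow> x \<in> {0..1} \<Longrightarrow>
     \<bar>poly p x\<bar> \<le> C' * M \<and> \<bar>poly (pderiv p) x\<bar> \<le> C' * M"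
    using poly_inverse_estimate[of "1/2" 1 d, simplified] by blast
  have "\<bar>poly S x\<bar> \<le> (C'\<^sup>2 * 2 * C) * \<theta>"
    if S: "degree S \<le> d" "0 \<le> \<theta>" and
      int: "integral {0..1} (\<lambda>x. x * (poly S x)\<^sup>2) \<le> \<theta> * integral {0..1} (\<lambda>x. \<bar>poly S x\<bar>)"
      and x: "x \<in> {0..1}" for S \<theta> x
  proof -
    obtain F where F: "pderiv F = [:0, 1:] * S ^ 2" "degree F \<le> Suc (degree ([:0, 1:] * S ^ 2))" "poly F 0 = 0"
      using poly_antiderivative by blast
    have "degree ([:0, 1:] * S ^ 2) \<le> degree [:0, 1:: real:] + degree (S ^ 2)" by (rule degree_mult_le)
    also have "\<dots> \<le> 1 + 2 * d" using S degree_power_le[of S 2] by simp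
    finally have degF: "degree F \<le> 2 * d + 2" using F by simp
    have pF: "poly (pderiv F) x = x * (poly S x)\<^sup>2" for x unfolding F by simp
    have F_int: "((\<lambda>x. x * (poly S x)\<^sup>2) has_integral (poly F b - poly F a)) {a..b}" if "a \<le> b" for a b
      using has_integral_pderiv[OF that, of F] by (simp add: pF cong: has_integral_cong)
    have mono: "poly F a \<le> poly F b" if "0 \<le> a" "a \<le> b" for a b
      using has_integral_nonneg[OF F_int[OF that(2)]] that by auto
    have "\<bar>poly F z\<bar> \<le> poly F 1" if "z \<in> {0..1}" for z
      using mono[of 0 z] mono[of z 1] that F(3) by auto
    then have dF: "\<bar>z * (poly S z)\<^sup>2\<bar> \<le> C * poly F 1" if "z \<in> {0..1}" for z
      using C(2)[OF degF _ that, of "poly F 1"] by (simp add: pF)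
    have "\<bar>poly S z\<bar> \<le> sqrt (2 * C * poly F 1)" if z: "z \<in> {1/2..1}" for z
    proof (rule real_le_rsqrt)
      have "1/2 * (poly S z)\<^sup>2 \<le> z * (poly S z)\<^sup>2" using z by (intro mult_right_mono) auto
      then show "\<bar>poly S z\<bar>\<^sup>2 \<le> 2 * C * poly F 1" using dF[of z] z by auto
    qed
    then have M: "\<bar>poly S z\<bar> \<le> C' * sqrt (2 * C * poly F 1)" if "z \<in> {0..1}" for z
      using C'(2)[OF S(1) _ that] by blast
    define M where "M = C' * sqrt (2 * C * poly F 1)"
    have F1: "poly F 1 \<ge> 0" using mono[of 0 1] F(3) by simp
    have "integral {0..1} (\<lambda>x. \<bar>poly S x\<bar>) \<le> integral {0..1} (\<lambda>x::real. M)"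
      by (intro integral_le integrable_continuous_real continuous_intros) (use M in \<open>auto simp: M_def\<close>)
    then have "poly F 1 \<le> \<theta> * M"
      using int integral_unique[OF F_int[of 0 1]] F(3) mult_left_mono[OF _ S(2)] by fastforce
    then have "M\<^sup>2 \<le> (C'\<^sup>2 * 2 * C) * \<theta> * M"
      using C C' F1 by (simp add: M_def power_mult_distrib mult.assoc mult_left_mono)
    moreover have "M \<ge> 0" using C' C F1 by (simp add: M_def)
    moreover have "(C'\<^sup>2 * 2 * C) * \<theta> \<ge> 0" using C S by simp
    ultimately have "M \<le> (C'\<^sup>2 * 2 * C) * \<theta>"
      by (cases "M = 0") (auto simp: power2_eq_square)
    then show ?thesis using M[OF x] by (simp add: M_def)
  qed
  moreover have "C'\<^sup>2 * 2 * C > 0" using C C' by simp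
  ultimately show ?thesis by blast
qed

section \<open>Shifted Legendre polynomials\<close>

lemma power_dvd_higher_pderiv:
  fixes c :: "real poly"
  assumes "c ^ (i + j) dvd p"
  shows "c ^ j dvd (pderiv ^^ i) p"
  using assms
proof (induction i arbitrary: j)
  case (Suc i)
  then obtain H where H: "(pderiv ^^ i) p = c ^ Suc j * H"
    using Suc.IH[of "Suc j"] by (auto elim: dvdE)
  have "pderiv (c ^ Suc j * H) = c ^ j * (c * pderiv H + smult (of_nat (Suc j)) (pderiv c * H))"
    by (simp only: pderiv_mult pderiv_power_Suc) (simp add: algebra_simps del: of_nat_Suc)
  then show ?case using H by simp
qed simp

text \<open>Repeated integration by parts: the boundary terms vanish by hypothesis, and
  \<open>j\<close> derivatives leave nothing of \<open>\<phi>\<close>.\<close>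

lemma higher_pderiv_orthogonal:
  fixes G \<phi> :: "real poly"
  assumes "\<And>i. i < j \<Longrightarrow> poly ((pderiv ^^ i) G) 0 = 0 \<and> poly ((pderiv ^^ i) G) 1 = 0"
    and "degree \<phi> < j"
  shows "((\<lambda>x. poly ((pderiv ^^ j) G) x * poly \<phi> x) has_integral 0) {0..1}"
  using assms
proof (induction j arbitrary: \<phi>)
  case (Suc j)
  define A where "A = (pderiv ^^ j) G"
  have A: "poly A 0 = 0" "poly A 1 = 0" using Suc.prems(1)[of j] by (auto simp: A_def)
  have "((\<lambda>x. poly A x * poly (pderiv \<phi>) x) has_integral 0) {0..1}"
  proof (cases "degree \<phi> = 0")
    case True
    then have "pderiv \<phi> = 0" by (simp add: pderiv_eq_0_iff)
    then show ?thesis by simp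
  next
    case False
    then show ?thesis unfolding A_def
      using Suc.prems by (intro Suc.IH) (auto simp: degree_pderiv)
  qed
  from has_integral_diff[OF has_integral_pderiv[of 0 1 "A * \<phi>"] this] A
  show ?case by (simp add: pderiv_mult A_def algebra_simps)
qed simp

text \<open>Rodrigues formula on \<open>{0..1}\<close>: \<open>L\<close> is the \<open>m\<close>-th
  derivative of \<open>(x^2 - x) ^ m\<close>, normalised at \<open>1\<close>. Derivatives of order
  below \<open>m\<close> keep a factor \<open>c\<close> and so vanish at both ends, which yields the
  orthogonality.\<close>

lemma legendre_exists:
  "\<exists>L::real poly. degree L = m \<and> poly L 1 = 1 \<and> poly L 0 = (-1) ^ m \<and>
     (\<forall>\<phi>. degree \<phi> < m \<longrightarrow> ((\<lambda>x. poly L x * poly \<phi> x) has_integral 0) {0..1})"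
proof -
  define c :: "real poly" where "c = [:0, -1, 1:]"
  define A where "A i = (pderiv ^^ i) (c ^ m)" for i
  have deg: "degree (A i) = 2 * m - i" for i
    unfolding A_def by (induction i) (simp_all add: degree_pderiv degree_power_eq c_def)
  have "poly (A i) 0 = 0 \<and> poly (A i) 1 = 0" if "i < m" for i
  proof -
    have "c ^ (m - i) dvd A i"
      unfolding A_def using that by (intro power_dvd_higher_pderiv) simp
    then have "c dvd A i" using that by (meson dvd_power dvd_trans zero_less_diff)
    then show ?thesis by (auto elim!: dvdE simp: c_def)
  qed
  then have orth: "((\<lambda>x. poly (A m) x * poly \<phi> x) has_integral 0) {0..1}" if "degree \<phi> < m" for \<phi>
    using higher_pderiv_orthogonal[of m "c ^ m" \<phi>] that by (simp add: A_def)
  \<comment> \<open>The reflection \<open>x -> 1 - x\<close> leaves \<open>c\<close> unchanged and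
    each derivative contributes a sign; for \<open>i = m\<close> this compares the two end
    values.\<close>
  have sym: "pcompose (A i) [:1, -1:] = smult ((-1) ^ i) (A i)" for i
  proof (induction i)
    case 0
    have "pcompose c [:1, -1:] = c" by (simp add: c_def pcompose_pCons)
    then show ?case by (simp add: A_def) (induction m, auto simp: pcompose_mult pcompose_1)
  next
    case (Suc i)
    have "pderiv (pcompose (A i) [:1, -1:]) = - pcompose (A (Suc i)) [:1, -1:]"
      by (simp add: pderiv_pcompose A_def pderiv_pCons)
    moreover have "pderiv (pcompose (A i) [:1, -1:]) = smult ((-1) ^ i) (A (Suc i))"
      by (simp add: Suc pderiv_smult) (simp add: A_def)
    ultimately show ?case by (metis minus_minus mult_minus1 power_Suc smult_minus_left)
  qed
  have val: "poly (A m) 1 = (-1) ^ m * poly (A m) 0"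
    using arg_cong[OF sym[of m], of "\<lambda>p. poly p 0"] by (simp add: poly_pcompose)
  \<comment> \<open>Were \<open>1\<close> a root, the quotient \<open>S\<close> by
    \<open>x - 1\<close> would have degree below \<open>m\<close>, hence be orthogonal to
    \<open>A m\<close>, and the nonnegative function \<open>(1 - x) * S^2\<close> would integrate to
    \<open>0\<close>.\<close>
  have nz: "poly (A m) 1 \<noteq> 0"
  proof
    assume "poly (A m) 1 = 0"
    then obtain S where S: "A m = [:-1, 1:] * S" by (metis poly_eq_0_iff_dvd dvdE)
    have cm: "c ^ m \<noteq> 0" by (simp add: c_def)
    have A0: "A m \<noteq> 0"
    proof (cases "m = 0")
      case True then show ?thesis by (simp add: A_def)
    next
      case False then show ?thesis using deg[of m] by auto
    qed
    then have S0: "S \<noteq> 0" using S by auto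
    have "degree (A m) = Suc (degree S)" unfolding S using S0 by (subst degree_mult_eq) auto
    then have "degree S < m" using deg[of m] by simp
    then have "((\<lambda>x. poly (A m) x * poly S x) has_integral 0) {0..1}" by (rule orth)
    then have i0: "((\<lambda>x. (1 - x) * (poly S x)\<^sup>2) has_integral 0) (cbox 0 1)"
      proof -
      assume "((\<lambda>x. poly (A m) x * poly S x) has_integral 0) {0..1}"
      from has_integral_neg[OF this] show ?thesis by (simp add: S power2_eq_square algebra_simps)
    qed
    have "(1 - x) * (poly S x)\<^sup>2 = 0" if "x \<in> {0..1}" for x
      by (rule has_integral_0_cbox_imp_0[OF _ _ i0, of x])
         (use that in \<open>auto intro!: continuous_intros\<close>)
    then have "{0..<1} \<subseteq> {x. poly S x = 0}" by fastforce
    then have "finite {0..<1::real}" using poly_roots_finite[OF S0] finite_subset by blast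
    then show False by (simp add: infinite_Ico)
  qed
  define L where "L = smult (1 / poly (A m) 1) (A m)"
  show ?thesis
  proof (intro exI[of _ L] conjI allI impI)
    show "degree L = m" using deg[of m] nz by (simp add: L_def)
    show "poly L 1 = 1" using nz by (simp add: L_def)
    show "poly L 0 = (-1) ^ m" using nz val by (auto simp: L_def field_simps)
    fix \<phi> :: "real poly" assume "degree \<phi> < m"
    from has_integral_mult_right[OF orth[OF this], of "1 / poly (A m) 1"]
    show "((\<lambda>x. poly L x * poly \<phi> x) has_integral 0) {0..1}" by (simp add: L_def algebra_simps)
  qed
qed

section \<open>Estimates on one cell, by scaling to the unit interval\<close>

lemma integral_affine:
  fixes f :: "real \<Rightarrow> real"
  assumes "h > 0" "continuous_on {a..a + h} f"
  shows "integral {a..a + h} f = h * integral {0..1} (\<lambda>s. f (a + h * s))"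
proof -
  have "((\<lambda>s. h *\<^sub>R f (a + h * s)) has_integral (integral {a + h * 0..a + h * 1} f)) {0..1}"
    using assms by (intro has_integral_substitution[where c = a and d = "a + h"])
      (auto intro!: derivative_eq_intros)
  from integral_unique[OF this] show ?thesis by simp
qed

text \<open>The orthogonal part of \<open>Q\<close> is a multiple of the Legendre polynomial, whose values at the two end
  points have equal modulus; this is what keeps the amplification factor of one step at \<open>1\<close>.\<close>

lemma poly_step_unit:
  assumes "m \<ge> 1"
  shows "\<exists>C\<ge>1. \<forall>(Q::real poly) \<theta>. degree Q \<le> m \<longrightarrow> 0 \<le> \<theta> \<longrightarrow>
    (\<forall>\<phi>. degree \<phi> \<le> m - 1 \<longrightarrow>
       \<bar>integral {0..1} (\<lambda>x. poly Q x * poly \<phi> x)\<bar> \<le> \<theta> * integral {0..1} (\<lambda>x. \<bar>poly \<phi> x\<bar>)) \<longrightarrow>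
    \<bar>poly Q 1\<bar> \<le> \<bar>poly Q 0\<bar> + C * \<theta> \<and> (\<forall>x\<in>{0..1}. \<bar>poly Q x\<bar> \<le> C * (\<bar>poly Q 0\<bar> + \<theta>))"
proof -
  obtain L :: "real poly" where L: "degree L = m" "poly L 1 = 1" "poly L 0 = (-1) ^ m"
    "\<And>\<phi>. degree \<phi> < m \<Longrightarrow> ((\<lambda>x. poly L x * poly \<phi> x) has_integral 0) {0..1}"
    using legendre_exists[of m] by blast
  have "compact ((\<lambda>x. poly L x) ` {0..1})"
    by (intro compact_continuous_image continuous_intros compact_Icc)
  then obtain BL where BL: "\<And>x. x \<in> {0..1} \<Longrightarrow> \<bar>poly L x\<bar> \<le> BL"
    using compact_imp_bounded bounded_iff by (metis imageI real_norm_def)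
  have BL1: "BL \<ge> 1" using BL[of 1] L(2) by simp
  obtain C where C: "C > 0" "\<And>(S::real poly) \<theta> x. degree S \<le> m - 1 \<Longrightarrow> 0 \<le> \<theta> \<Longrightarrow>
     integral {0..1} (\<lambda>x. x * (poly S x)\<^sup>2) \<le> \<theta> * integral {0..1} (\<lambda>x. \<bar>poly S x\<bar>) \<Longrightarrow> x \<in> {0..1} \<Longrightarrow>
     \<bar>poly S x\<bar> \<le> C * \<theta>"
    using poly_bound_of_weighted_square[of "m - 1"] by blast
  have "\<bar>poly Q 1\<bar> \<le> \<bar>poly Q 0\<bar> + (BL + C) * \<theta> \<and> (\<forall>x\<in>{0..1}. \<bar>poly Q x\<bar> \<le> (BL + C) * (\<bar>poly Q 0\<bar> + \<theta>))"
    if Q: "degree Q \<le> m" "0 \<le> \<theta>"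
      "\<And>\<phi>. degree \<phi> \<le> m - 1 \<Longrightarrow>
       \<bar>integral {0..1} (\<lambda>x. poly Q x * poly \<phi> x)\<bar> \<le> \<theta> * integral {0..1} (\<lambda>x. \<bar>poly \<phi> x\<bar>)" for Q \<theta>
  proof -
    \<comment> \<open>Since \<open>poly L 0 = (-1) ^ m\<close>, the multiple \<open>\<alpha>\<close>
      of \<open>L\<close> has the value of \<open>Q\<close> at \<open>0\<close>, and what remains of
      \<open>Q\<close> is divisible by \<open>x\<close>.\<close>
    define \<alpha> where "\<alpha> = (-1) ^ m * poly Q 0"
    have al: "\<bar>\<alpha>\<bar> = \<bar>poly Q 0\<bar>" by (simp add: \<alpha>_def abs_mult power_abs)
    have "poly (Q - smult \<alpha> L) 0 = 0" by (simp add: \<alpha>_def L(3) algebra_simps flip: power_add)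
    then obtain S where S: "Q - smult \<alpha> L = [:0, 1:] * S"
      using poly_eq_0_iff_dvd[of "Q - smult \<alpha> L" 0] by (auto elim: dvdE)
    have Q_eq: "poly Q x = \<alpha> * poly L x + x * poly S x" for x
      using arg_cong[OF S, of "\<lambda>p. poly p x"] by simp
    have dS: "degree S \<le> m - 1"
    proof (cases "S = 0")
      case False
      have "degree ([:0, 1:] * S) = Suc (degree S)"
        using False by (subst degree_mult_eq) auto
      moreover have "degree (Q - smult \<alpha> L) \<le> m"
        using Q L by (intro degree_diff_le) (auto intro: order_trans[OF degree_smult_le])
      ultimately show ?thesis using S by simp
    qed simp
    \<comment> \<open>Testing with \<open>S\<close> itself: the Legendre part is orthogonal to
      \<open>S\<close>, so only the weighted square of \<open>S\<close> is left.\<close>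
    have "((\<lambda>x. poly Q x * poly S x) has_integral integral {0..1} (\<lambda>x. poly Q x * poly S x)) {0..1}"
      by (intro integrable_integral integrable_continuous_real continuous_intros)
    from has_integral_diff[OF this has_integral_mult_right[OF L(4)[of S], of \<alpha>]] dS assms
    have "((\<lambda>x. x * (poly S x)\<^sup>2) has_integral integral {0..1} (\<lambda>x. poly Q x * poly S x)) {0..1}"
      by (simp add: Q_eq algebra_simps power2_eq_square)
    then have "integral {0..1} (\<lambda>x. x * (poly S x)\<^sup>2) \<le> \<theta> * integral {0..1} (\<lambda>x. \<bar>poly S x\<bar>)"
      using Q(3)[OF dS] by (simp add: integral_unique)
    then have Sb: "\<bar>poly S x\<bar> \<le> C * \<theta>" if "x \<in> {0..1}" for x
      using C(2)[OF dS Q(2) _ that] by blast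
    have th: "0 \<le> C * \<theta>" "0 \<le> BL * \<theta>" "0 \<le> C * \<bar>\<alpha>\<bar>" using C Q BL1 by auto
    show ?thesis
    proof
      have "\<bar>poly Q 1\<bar> \<le> \<bar>\<alpha>\<bar> + \<bar>poly S 1\<bar>" using Q_eq[of 1] L(2) by simp
      then show "\<bar>poly Q 1\<bar> \<le> \<bar>poly Q 0\<bar> + (BL + C) * \<theta>"
        using Sb[of 1] al th by (simp add: algebra_simps)
      show "\<forall>x\<in>{0..1}. \<bar>poly Q x\<bar> \<le> (BL + C) * (\<bar>poly Q 0\<bar> + \<theta>)"
      proof
        fix x :: real assume x: "x \<in> {0..1}"
        have "\<bar>\<alpha> * poly L x\<bar> \<le> \<bar>\<alpha>\<bar> * BL" using BL[OF x] by (simp add: abs_mult mult_left_mono)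
        moreover have "\<bar>x * poly S x\<bar> \<le> 1 * (C * \<theta>)"
          unfolding abs_mult using Sb[OF x] x by (intro mult_mono) auto
        ultimately show "\<bar>poly Q x\<bar> \<le> (BL + C) * (\<bar>poly Q 0\<bar> + \<theta>)"
          using Q_eq[of x] th unfolding al by (simp add: algebra_simps)
      qed
    qed
  qed
  moreover have "BL + C \<ge> 1" using BL1 C by simp
  ultimately show ?thesis by blast
qed

lemma degree_pcompose_linear_le:
  fixes p :: "real poly"
  shows "degree (pcompose p [:u, v:]) \<le> degree p"
  using degree_pcompose_le[of p "[:u, v:]"] by (auto intro: order_trans split: if_splits)

text \<open>The constant is the same on all cells, because both sides of the test condition pick up
  the same factor \<open>h\<close> under \<open>t = a + h * s\<close>.\<close>

lemma poly_step:
  assumes "m \<ge> 1"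
  shows "\<exists>C\<ge>1. \<forall>(Q::real poly) \<theta> a h. degree Q \<le> m \<longrightarrow> 0 \<le> \<theta> \<longrightarrow> h > 0 \<longrightarrow>
    (\<forall>\<phi>. degree \<phi> \<le> m - 1 \<longrightarrow>
       \<bar>integral {a..a + h} (\<lambda>x. poly Q x * poly \<phi> x)\<bar> \<le> \<theta> * integral {a..a + h} (\<lambda>x. \<bar>poly \<phi> x\<bar>)) \<longrightarrow>
    \<bar>poly Q (a + h)\<bar> \<le> \<bar>poly Q a\<bar> + C * \<theta> \<and> (\<forall>x\<in>{a..a + h}. \<bar>poly Q x\<bar> \<le> C * (\<bar>poly Q a\<bar> + \<theta>))"
proof -
  obtain C where C: "C \<ge> 1" "\<And>(Q::real poly) \<theta>. degree Q \<le> m \<Longrightarrow> 0 \<le> \<theta> \<Longrightarrow>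
    (\<And>\<phi>. degree \<phi> \<le> m - 1 \<Longrightarrow>
       \<bar>integral {0..1} (\<lambda>x. poly Q x * poly \<phi> x)\<bar> \<le> \<theta> * integral {0..1} (\<lambda>x. \<bar>poly \<phi> x\<bar>)) \<Longrightarrow>
    \<bar>poly Q 1\<bar> \<le> \<bar>poly Q 0\<bar> + C * \<theta> \<and> (\<forall>x\<in>{0..1}. \<bar>poly Q x\<bar> \<le> C * (\<bar>poly Q 0\<bar> + \<theta>))"
    using poly_step_unit[OF assms] by blast
  have "\<bar>poly Q (a + h)\<bar> \<le> \<bar>poly Q a\<bar> + C * \<theta> \<and> (\<forall>x\<in>{a..a + h}. \<bar>poly Q x\<bar> \<le> C * (\<bar>poly Q a\<bar> + \<theta>))"
    if Q: "degree Q \<le> m" "0 \<le> \<theta>" and h: "h > 0" and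
      H: "\<And>\<phi>. degree \<phi> \<le> m - 1 \<Longrightarrow>
       \<bar>integral {a..a + h} (\<lambda>x. poly Q x * poly \<phi> x)\<bar> \<le> \<theta> * integral {a..a + h} (\<lambda>x. \<bar>poly \<phi> x\<bar>)" for Q \<theta> a h
  proof -
    define Q' where "Q' = pcompose Q [:a, h:]"
    have Q': "poly Q' s = poly Q (a + h * s)" for s by (simp add: Q'_def poly_pcompose mult.commute)
    have "\<bar>integral {0..1} (\<lambda>x. poly Q' x * poly \<phi> x)\<bar> \<le> \<theta> * integral {0..1} (\<lambda>x. \<bar>poly \<phi> x\<bar>)"
      if \<phi>: "degree \<phi> \<le> m - 1" for \<phi>
    proof -
      define \<psi> where "\<psi> = pcompose \<phi> [:-a / h, 1 / h:]"
      have \<psi>: "poly \<psi> (a + h * s) = poly \<phi> s" for s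
        using h by (simp add: \<psi>_def poly_pcompose field_simps)
      have "degree \<psi> \<le> m - 1" unfolding \<psi>_def using \<phi> degree_pcompose_linear_le order_trans by blast
      from H[OF this]
      have "\<bar>h * integral {0..1} (\<lambda>x. poly Q' x * poly \<phi> x)\<bar> \<le> \<theta> * (h * integral {0..1} (\<lambda>x. \<bar>poly \<phi> x\<bar>))"
        using h by (simp add: integral_affine continuous_intros \<psi> Q')
      then have "h * \<bar>integral {0..1} (\<lambda>x. poly Q' x * poly \<phi> x)\<bar> \<le> h * (\<theta> * integral {0..1} (\<lambda>x. \<bar>poly \<phi> x\<bar>))"
        using h by (simp add: abs_mult algebra_simps)
      then show ?thesis using h by simp
    qed
    moreover have "degree Q' \<le> m" unfolding Q'_def using Q degree_pcompose_linear_le order_trans by blast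
    ultimately have R: "\<bar>poly Q' 1\<bar> \<le> \<bar>poly Q' 0\<bar> + C * \<theta>" "\<And>x. x\<in>{0..1} \<Longrightarrow> \<bar>poly Q' x\<bar> \<le> C * (\<bar>poly Q' 0\<bar> + \<theta>)"
      using C(2)[of Q' \<theta>] Q by auto
    have "\<bar>poly Q x\<bar> \<le> C * (\<bar>poly Q a\<bar> + \<theta>)" if "x \<in> {a..a + h}" for x
      using R(2)[of "(x - a) / h"] that h by (auto simp: Q' field_simps)
    then show ?thesis using R(1) by (simp add: Q')
  qed
  then show ?thesis using C(1) by blast
qed

text \<open>The chain rule for \<open>t = a + h * s\<close> produces the factor
  \<open>1 / h\<close>. This is the price for returning from a primitive to the piecewise polynomial
  itself.\<close>

lemma pderiv_inverse_estimate:
  "\<exists>C>0. \<forall>(p::real poly) M a h. degree p \<le> d \<longrightarrow> h > 0 \<longrightarrow> (\<forall>x\<in>{a..a + h}. \<bar>poly p x\<bar> \<le> M) \<longrightarrow>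
     (\<forall>x\<in>{a..a + h}. \<bar>poly (pderiv p) x\<bar> \<le> C * M / h)"
proof -
  obtain C where C: "C > 0" "\<And>(p::real poly) M x. degree p \<le> d \<Longrightarrow> (\<forall>x\<in>{0..1}. \<bar>poly p x\<bar> \<le> M) \<Longrightarrow> x \<in> {0..1} \<Longrightarrow>
     \<bar>poly p x\<bar> \<le> C * M \<and> \<bar>poly (pderiv p) x\<bar> \<le> C * M"
    using poly_inverse_estimate[of 0 1 d, OF zero_less_one] by blast
  have "\<bar>poly (pderiv p) x\<bar> \<le> C * M / h"
    if p: "degree p \<le> d" and h: "h > 0" and M: "\<forall>x\<in>{a..a + h}. \<bar>poly p x\<bar> \<le> M" and x: "x \<in> {a..a + h}"
    for p M a h x
  proof -
    define q where "q = pcompose p [:a, h:]"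
    have "degree q \<le> d" unfolding q_def using p degree_pcompose_linear_le order_trans by blast
    moreover have "\<forall>x\<in>{0..1}. \<bar>poly q x\<bar> \<le> M" using M h by (auto simp: q_def poly_pcompose)
    ultimately have "\<bar>poly (pderiv q) ((x - a) / h)\<bar> \<le> C * M" using C(2)[of q M "(x - a) / h"] x h by (auto simp: field_simps)
    then have "h * \<bar>poly (pderiv p) x\<bar> \<le> C * M" using h
      by (simp add: q_def pderiv_pcompose poly_pcompose pderiv_pCons abs_mult)
    then show ?thesis using h by (simp add: field_simps)
  qed
  then show ?thesis using C(1) by blast
qed

section \<open>Volterra operators with Lipschitz kernels\<close>

lemma continuous_on_real_lipschitz:
  fixes f :: "real \<Rightarrow> real"
  assumes "\<And>x y. x \<in> S \<Longrightarrow> y \<in> S \<Longrightarrow> \<bar>f x - f y\<bar> \<le> L * \<bar>x - y\<bar>"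
  shows "continuous_on S f"
proof -
  have "(max L 0)-lipschitz_on S f"
  proof (rule lipschitz_onI)
    fix x y assume "x \<in> S" "y \<in> S"
    then have "\<bar>f x - f y\<bar> \<le> L * \<bar>x - y\<bar>" by (rule assms)
    also have "\<dots> \<le> max L 0 * \<bar>x - y\<bar>" by (rule mult_right_mono) auto
    finally show "dist (f x) (f y) \<le> max L 0 * dist x y" by (simp add: dist_real_def)
  qed simp
  then show ?thesis by (rule lipschitz_on_continuous_on)
qed

lemma bounded_on_Icc:
  fixes F :: "real \<Rightarrow> real"
  assumes "continuous_on {a..b} F"
  obtains M where "M \<ge> 0" "\<And>x. x \<in> {a..b} \<Longrightarrow> \<bar>F x\<bar> \<le> M"
proof -
  have "bounded (F ` {a..b})"
    by (intro compact_imp_bounded compact_continuous_image assms compact_Icc)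
  then obtain M where "0 < M" "\<forall>y\<in>F ` {a..b}. norm y \<le> M" by (auto simp: bounded_pos)
  then show thesis by (intro that[of M]) auto
qed

text \<open>One constant serves for the size and for the Lipschitz bound in both variables, so that
  later estimates involve a single \<open>B\<close>.\<close>

definition lipschitz_kernel :: "real \<Rightarrow> real \<Rightarrow> (real \<Rightarrow> real \<Rightarrow> real) \<Rightarrow> bool" where
  "lipschitz_kernel T B \<kappa> \<longleftrightarrow> 0 \<le> B \<and>
     (\<forall>t s. (t, s) \<in> triangle T \<longrightarrow> \<bar>\<kappa> t s\<bar> \<le> B) \<and>
     (\<forall>t s t' s'. (t, s) \<in> triangle T \<longrightarrow> (t', s') \<in> triangle T \<longrightarrow>
        \<bar>\<kappa> t s - \<kappa> t' s'\<bar> \<le> B * (\<bar>t - t'\<bar> + \<bar>s - s'\<bar>))"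

lemma
  assumes "lipschitz_kernel T B \<kappa>"
  shows lipschitz_kernel_nonneg: "0 \<le> B"
    and lipschitz_kernel_bound: "0 \<le> s \<Longrightarrow> s \<le> t \<Longrightarrow> t \<le> T \<Longrightarrow> \<bar>\<kappa> t s\<bar> \<le> B"
    and lipschitz_kernel_fst: "0 \<le> s \<Longrightarrow> s \<le> t \<Longrightarrow> t \<le> T \<Longrightarrow> s \<le> t' \<Longrightarrow> t' \<le> T \<Longrightarrow>
          \<bar>\<kappa> t s - \<kappa> t' s\<bar> \<le> B * \<bar>t - t'\<bar>"
    and lipschitz_kernel_snd: "0 \<le> s \<Longrightarrow> s \<le> t \<Longrightarrow> t \<le> T \<Longrightarrow> 0 \<le> s' \<Longrightarrow> s' \<le> t \<Longrightarrow>
          \<bar>\<kappa> t s - \<kappa> t s'\<bar> \<le> B * \<bar>s - s'\<bar>"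
    and lipschitz_kernel_continuous: "t \<le> T \<Longrightarrow> continuous_on {0..t} (\<kappa> t)"
proof -
  show "0 \<le> B" using assms by (simp add: lipschitz_kernel_def)
  show "\<bar>\<kappa> t s\<bar> \<le> B" if "0 \<le> s" "s \<le> t" "t \<le> T"
    using assms that by (simp add: lipschitz_kernel_def triangle_def)
  have *: "\<bar>\<kappa> t s - \<kappa> t' s'\<bar> \<le> B * (\<bar>t - t'\<bar> + \<bar>s - s'\<bar>)"
    if "0 \<le> s" "s \<le> t" "t \<le> T" "0 \<le> s'" "s' \<le> t'" "t' \<le> T" for t s t' s'
    using assms that by (simp add: lipschitz_kernel_def triangle_def)
  show "\<bar>\<kappa> t s - \<kappa> t' s\<bar> \<le> B * \<bar>t - t'\<bar>" if "0 \<le> s" "s \<le> t" "t \<le> T" "s \<le> t'" "t' \<le> T"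
    using *[of s t s t'] that by simp
  show snd: "\<bar>\<kappa> t s - \<kappa> t s'\<bar> \<le> B * \<bar>s - s'\<bar>" if "0 \<le> s" "s \<le> t" "t \<le> T" "0 \<le> s'" "s' \<le> t" for t s s'
    using *[of s t s' t] that by simp
  show "continuous_on {0..t} (\<kappa> t)" if "t \<le> T"
    by (rule continuous_on_real_lipschitz[of _ _ B]) (use that snd in auto)
qed

text \<open>The factor \<open>T + 1\<close> collects two contributions: the change of the kernel
  over \<open>{0..t}\<close>, whose length is at most \<open>T\<close>, and the new piece
  \<open>{t..t'}\<close> of the domain.\<close>

lemma volterra_integral_lipschitz:
  fixes P :: "real \<Rightarrow> real"
  assumes \<kappa>: "lipschitz_kernel T B \<kappa>" and P: "continuous_on {0..b} P" and M: "\<And>s. s \<in> {0..b} \<Longrightarrow> \<bar>P s\<bar> \<le> M"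
    and b: "b \<le> T" and t: "t \<in> {0..b}" "t' \<in> {0..b}"
  shows "\<bar>integral {0..t} (\<lambda>s. \<kappa> t s * P s) - integral {0..t'} (\<lambda>s. \<kappa> t' s * P s)\<bar> \<le> B * (T + 1) * M * \<bar>t - t'\<bar>"
  using t
proof (induction t t' rule: linorder_wlog)
  case (sym t t')
  then show ?case by (simp add: abs_minus_commute)
next
  case (le t t')
  have c: "continuous_on {0..u} (\<kappa> u)" "continuous_on {0..u} P" if "u \<le> b" for u
    using that b by (auto intro!: lipschitz_kernel_continuous[OF \<kappa>] continuous_on_subset[OF P])
  have c': "continuous_on {0..t} (\<kappa> t')" "continuous_on {t..t'} (\<kappa> t')" "continuous_on {t..t'} P"
    using c[of t'] le by (auto elim!: continuous_on_subset)
  have M0: "0 \<le> M" using M[of t] le by auto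
  have B0: "0 \<le> B" by (rule lipschitz_kernel_nonneg[OF \<kappa>])
  have "integral {0..t'} (\<lambda>s. \<kappa> t' s * P s) =
      integral {0..t} (\<lambda>s. \<kappa> t' s * P s) + integral {t..t'} (\<lambda>s. \<kappa> t' s * P s)"
    using le c[of t'] by (intro Henstock_Kurzweil_Integration.integral_combine[symmetric] integrable_continuous_real continuous_intros) auto
  moreover have "integral {0..t} (\<lambda>s. \<kappa> t' s * P s) - integral {0..t} (\<lambda>s. \<kappa> t s * P s) =
      integral {0..t} (\<lambda>s. (\<kappa> t' s - \<kappa> t s) * P s)"
    using le c[of t] c'(1)
    by (subst Henstock_Kurzweil_Integration.integral_diff[symmetric])
       (auto intro!: integrable_continuous_real continuous_intros simp: algebra_simps)
  ultimately have eq: "integral {0..t} (\<lambda>s. \<kappa> t s * P s) - integral {0..t'} (\<lambda>s. \<kappa> t' s * P s) =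
      - integral {0..t} (\<lambda>s. (\<kappa> t' s - \<kappa> t s) * P s) - integral {t..t'} (\<lambda>s. \<kappa> t' s * P s)" by simp
  have "norm (integral {0..t} (\<lambda>s. (\<kappa> t' s - \<kappa> t s) * P s)) \<le> (B * (t' - t) * M) * (t - 0)"
  proof (rule integral_bound)
    fix s assume s: "s \<in> {0..t}"
    have "\<bar>\<kappa> t' s - \<kappa> t s\<bar> \<le> B * \<bar>t' - t\<bar>"
      using s le b by (intro lipschitz_kernel_fst[OF \<kappa>]) auto
    then show "norm ((\<kappa> t' s - \<kappa> t s) * P s) \<le> B * (t' - t) * M"
      using s le M[of s] B0 unfolding real_norm_def abs_mult by (intro mult_mono) auto
  qed (use le c[of t] c' in \<open>auto intro!: continuous_intros\<close>)
  also have "\<dots> \<le> B * (t' - t) * M * T"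
    using le b B0 M0 by (intro mult_left_mono) auto
  finally have 1: "\<bar>integral {0..t} (\<lambda>s. (\<kappa> t' s - \<kappa> t s) * P s)\<bar> \<le> B * (t' - t) * M * T" by simp
  have "norm (integral {t..t'} (\<lambda>s. \<kappa> t' s * P s)) \<le> (B * M) * (t' - t)"
  proof (rule integral_bound)
    fix s assume s: "s \<in> {t..t'}"
    have "\<bar>\<kappa> t' s\<bar> \<le> B" using s le b by (intro lipschitz_kernel_bound[OF \<kappa>]) auto
    then show "norm (\<kappa> t' s * P s) \<le> B * M"
      using s le M[of s] B0 unfolding real_norm_def abs_mult by (intro mult_mono) auto
  qed (use le c' in \<open>auto intro!: continuous_intros\<close>)
  then have 2: "\<bar>integral {t..t'} (\<lambda>s. \<kappa> t' s * P s)\<bar> \<le> (B * M) * (t' - t)" by simp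
  show ?case unfolding eq using 1 2 le(1) by (simp add: algebra_simps abs_if split: if_splits)
qed

text \<open>After integration by parts only the diagonal of \<open>k\<close> and its derivative
  \<open>ks\<close> in the second variable appear, so these are the data on which bounds are
  imposed; one \<open>B\<close> serves for all of them.\<close>

locale volterra_kernel =
  fixes T k0 B :: real and k ks :: "real \<Rightarrow> real \<Rightarrow> real"
  assumes T_pos: "0 < T" and k0_pos: "0 < k0" and B_pos: "0 < B"
    and diag_lower: "t \<in> {0..T} \<Longrightarrow> k0 \<le> \<bar>k t t\<bar>"
    and diag_upper: "t \<in> {0..T} \<Longrightarrow> \<bar>k t t\<bar> \<le> B"
    and diag_lipschitz: "t \<in> {0..T} \<Longrightarrow> t' \<in> {0..T} \<Longrightarrow> \<bar>k t t - k t' t'\<bar> \<le> B * \<bar>t - t'\<bar>"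
    and has_derivative_snd: "0 \<le> s \<Longrightarrow> s \<le> t \<Longrightarrow> t \<le> T \<Longrightarrow> (k t has_real_derivative ks t s) (at s within {0..t})"
    and lipschitz_ks: "lipschitz_kernel T B ks"
begin

definition mem :: "(real \<Rightarrow> real) \<Rightarrow> real \<Rightarrow> real" where
  "mem P t = integral {0..t} (\<lambda>s. ks t s * P s)"

lemma diag_continuous: "continuous_on {0..T} (\<lambda>t. k t t)"
  by (rule continuous_on_real_lipschitz[of _ _ B]) (rule diag_lipschitz)

lemma mem_lipschitz:
  assumes "continuous_on {0..b} P" "\<And>s. s \<in> {0..b} \<Longrightarrow> \<bar>P s\<bar> \<le> M" "b \<le> T" "t \<in> {0..b}" "t' \<in> {0..b}"
  shows "\<bar>mem P t - mem P t'\<bar> \<le> B * (T + 1) * M * \<bar>t - t'\<bar>"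
  unfolding mem_def by (rule volterra_integral_lipschitz[OF lipschitz_ks assms])

lemma mem_0 [simp]: "mem P 0 = 0" by (simp add: mem_def)

lemma mem_continuous:
  assumes "continuous_on {0..T} P"
  shows "continuous_on {0..T} (mem P)"
proof -
  obtain M where "\<And>s. s \<in> {0..T} \<Longrightarrow> \<bar>P s\<bar> \<le> M"
    using bounded_on_Icc[OF assms] by blast
  then show ?thesis
    using mem_lipschitz[OF assms _ order_refl] by (blast intro: continuous_on_real_lipschitz)
qed

text \<open>The exceptional set \<open>Z\<close> will consist of the mesh points, where
  \<open>p\<close> jumps and \<open>P\<close> is only continuous. The condition
  \<open>P 0 = 0\<close> removes the boundary term with \<open>k t 0\<close>.\<close>

lemma integration_by_parts_kernel:
  assumes "continuous_on {0..T} P" "P 0 = 0" "finite Z"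
    and "\<And>s. s \<in> {0<..<T} - Z \<Longrightarrow> (P has_real_derivative p s) (at s)" and t: "t \<in> {0..T}"
  shows "((\<lambda>s. k t s * p s) has_integral (k t t * P t - mem P t)) {0..t}"
proof -
  have dk: "(k t has_real_derivative ks t s) (at s within {0..t})" if "s \<in> {0..t}" for s
    using that t has_derivative_snd[of s t] by auto
  have ck: "continuous_on {0..t} (k t)"
    by (rule DERIV_continuous_on[OF dk])
  have cP: "continuous_on {0..t} P" using assms t by (auto elim: continuous_on_subset)
  have "((\<lambda>s. ks t s * P s) has_integral mem P t) {0..t}"
    unfolding mem_def using t cP lipschitz_kernel_continuous[OF lipschitz_ks, of t]
    by (intro integrable_integral integrable_continuous_real continuous_intros) auto
  then have "((\<lambda>s. P s * ks t s) has_integral P t * k t t - P 0 * k t 0 - (k t t * P t - mem P t)) {0..t}"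
    using assms(2) by (simp add: mult.commute)
  then have "((\<lambda>s. p s * k t s) has_integral (k t t * P t - mem P t)) {0..t}"
  proof (rule integration_by_parts_interior_strong[OF bounded_bilinear_mult assms(3), rotated -1])
    fix s assume s: "s \<in> {0<..<t} - Z"
    show "(P has_vector_derivative p s) (at s)"
      using assms(4)[of s] s t by (simp add: has_real_derivative_iff_has_vector_derivative)
    have "at s within {0..t} = at s" using s by (intro at_within_Icc_at) auto
    then show "(k t has_vector_derivative ks t s) (at s)"
      using dk[of s] s by (simp add: has_real_derivative_iff_has_vector_derivative)
  qed (use t cP ck in auto)
  then show ?thesis by (simp add: mult.commute)
qed

text \<open>Weighted maximum norm: at a maximum point of \<open>|P t| * exp (- l * t)\<close> the
  memory term is at most \<open>B / l * |P|\<close>. The choice \<open>l = 2 * B / k0\<close> makes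
  this half of the lower bound \<open>k0 * |P|\<close> for the diagonal term, so it can be absorbed.
  Removing the weight costs the exponential.\<close>

lemma gronwall:
  assumes P: "continuous_on {0..b} P" and b: "b \<le> T" and w: "\<And>t. t \<in> {0..b} \<Longrightarrow> \<bar>k t t * P t - mem P t\<bar> \<le> w"
    and t: "t \<in> {0..b}"
  shows "\<bar>P t\<bar> \<le> 2 / k0 * exp (2 * B / k0 * T) * w"
proof -
  define l where "l = 2 * B / k0"
  have l: "l > 0" using B_pos k0_pos by (simp add: l_def)
  have "continuous_on {0..b} (\<lambda>t. \<bar>P t\<bar> * exp (- l * t))" using P by (intro continuous_intros)
  then obtain \<tau> where \<tau>: "\<tau> \<in> {0..b}" "\<And>t. t \<in> {0..b} \<Longrightarrow> \<bar>P t\<bar> * exp (- l * t) \<le> \<bar>P \<tau>\<bar> * exp (- l * \<tau>)"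
    using continuous_attains_sup[of "{0..b}" "\<lambda>t. \<bar>P t\<bar> * exp (- l * t)"] t by auto
  define \<mu> where "\<mu> = \<bar>P \<tau>\<bar> * exp (- l * \<tau>)"
  have mu: "\<mu> \<ge> 0" by (simp add: \<mu>_def)
  have P_le: "\<bar>P t\<bar> \<le> \<mu> * exp (l * t)" if "t \<in> {0..b}" for t
    using \<tau>(2)[OF that] by (simp add: \<mu>_def exp_minus field_simps)
  have P\<tau>: "\<bar>P \<tau>\<bar> = \<mu> * exp (l * \<tau>)" by (simp add: \<mu>_def exp_minus field_simps)
  have I: "((\<lambda>s. B * \<mu> * exp (l * s)) has_integral (B * \<mu> * (exp (l * \<tau>) / l) - B * \<mu> * (exp (l * 0) / l))) {0..\<tau>}"
    using \<tau> l by (intro fundamental_theorem_of_calculus)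
      (auto intro!: derivative_eq_intros simp flip: has_real_derivative_iff_has_vector_derivative)
  have "norm (mem P \<tau>) \<le> integral {0..\<tau>} (\<lambda>s. B * \<mu> * exp (l * s))"
    unfolding mem_def
  proof (rule integral_norm_bound_integral)
    show "(\<lambda>s. ks \<tau> s * P s) integrable_on {0..\<tau>}"
      using \<tau> b lipschitz_kernel_continuous[OF lipschitz_ks, of \<tau>]
      by (intro integrable_continuous_real continuous_intros continuous_on_subset[OF P]) auto
    show "norm (ks \<tau> s * P s) \<le> B * \<mu> * exp (l * s)" if "s \<in> {0..\<tau>}" for s
      using mult_mono[OF lipschitz_kernel_bound[OF lipschitz_ks, of s \<tau>] P_le[of s]] that \<tau> b B_pos
      by (simp add: abs_mult mult.assoc)
  qed (use I in blast)
  also have "\<dots> = B * \<mu> / l * (exp (l * \<tau>) - 1)"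
    by (subst integral_unique[OF I]) (simp add: diff_divide_distrib algebra_simps)
  also have "\<dots> \<le> B * \<mu> / l * exp (l * \<tau>)"
    using mu B_pos l by (intro mult_left_mono) auto
  also have "\<dots> = k0 / 2 * \<bar>P \<tau>\<bar>" using B_pos k0_pos unfolding P\<tau> by (simp add: l_def)
  finally have m: "\<bar>mem P \<tau>\<bar> \<le> k0 / 2 * \<bar>P \<tau>\<bar>" by simp
  have "k0 * \<bar>P \<tau>\<bar> \<le> \<bar>k \<tau> \<tau>\<bar> * \<bar>P \<tau>\<bar>"
    using diag_lower[of \<tau>] \<tau> b by (intro mult_right_mono) auto
  also have "\<dots> \<le> w + k0 / 2 * \<bar>P \<tau>\<bar>" using w[OF \<tau>(1)] m by (simp flip: abs_mult)
  finally have "\<bar>P \<tau>\<bar> \<le> 2 / k0 * w" using k0_pos by (simp add: field_simps)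
  moreover have "\<mu> \<le> \<bar>P \<tau>\<bar>" unfolding \<mu>_def using \<tau>(1) l by (simp add: mult_left_le)
  ultimately have "\<mu> \<le> 2 / k0 * w" by simp
  then have "\<mu> * exp (l * t) \<le> (2 / k0 * w) * exp (l * T)"
    using mu l t b by (intro mult_mono) auto
  then show ?thesis using P_le[OF t] by (simp add: l_def algebra_simps)
qed

text \<open>Freezing the coefficients at the left end \<open>a\<close> replaces the residual by a
  polynomial of degree at most \<open>m\<close>, to which \<open>poly_step\<close> applies. The
  extra \<open>1\<close> added to its constant pays for the difference.\<close>

lemma local_step:
  assumes "m \<ge> 1"
  shows "\<exists>C\<ge>1. \<forall>P d D e M a h. 0 < h \<longrightarrow> 0 \<le> a \<longrightarrow> a + h \<le> T \<longrightarrow> 0 \<le> D \<longrightarrow> 0 \<le> e \<longrightarrow>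
     continuous_on {0..T} P \<longrightarrow> (\<forall>t\<in>{0..a + h}. \<bar>P t\<bar> \<le> M) \<longrightarrow>
     (\<forall>t\<in>{0..T}. \<forall>t'\<in>{0..T}. \<bar>d t - d t'\<bar> \<le> D * \<bar>t - t'\<bar>) \<longrightarrow>
     (\<exists>Q. degree Q \<le> m \<and> (\<forall>t\<in>{a..a + h}. P t = poly Q t)) \<longrightarrow>
     (\<forall>\<phi>. degree \<phi> \<le> m - 1 \<longrightarrow> \<bar>integral {a..a + h} (\<lambda>t. (k t t * P t - mem P t - d t) * poly \<phi> t)\<bar>
        \<le> e * integral {a..a + h} (\<lambda>t. \<bar>poly \<phi> t\<bar>)) \<longrightarrow>
     \<bar>k (a + h) (a + h) * P (a + h) - mem P (a + h) - d (a + h)\<bar> \<le>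
       \<bar>k a a * P a - mem P a - d a\<bar> + C * (e + h * (B * (T + 2) * M + D)) \<and>
     (\<forall>t\<in>{a..a + h}. \<bar>k t t * P t - mem P t - d t\<bar> \<le>
       C * (\<bar>k a a * P a - mem P a - d a\<bar> + e + h * (B * (T + 2) * M + D)))"
proof -
  obtain C where C: "C \<ge> 1" "\<And>(Q::real poly) \<theta> a h. degree Q \<le> m \<Longrightarrow> 0 \<le> \<theta> \<Longrightarrow> h > 0 \<Longrightarrow>
    (\<forall>\<phi>. degree \<phi> \<le> m - 1 \<longrightarrow>
       \<bar>integral {a..a + h} (\<lambda>x. poly Q x * poly \<phi> x)\<bar> \<le> \<theta> * integral {a..a + h} (\<lambda>x. \<bar>poly \<phi> x\<bar>)) \<Longrightarrow>
    \<bar>poly Q (a + h)\<bar> \<le> \<bar>poly Q a\<bar> + C * \<theta> \<and> (\<forall>x\<in>{a..a + h}. \<bar>poly Q x\<bar> \<le> C * (\<bar>poly Q a\<bar> + \<theta>))"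
    using poly_step[OF assms] by blast
  have "\<bar>k (a + h) (a + h) * P (a + h) - mem P (a + h) - d (a + h)\<bar> \<le>
       \<bar>k a a * P a - mem P a - d a\<bar> + (C + 1) * (e + h * (B * (T + 2) * M + D)) \<and>
     (\<forall>t\<in>{a..a + h}. \<bar>k t t * P t - mem P t - d t\<bar> \<le>
       (C + 1) * (\<bar>k a a * P a - mem P a - d a\<bar> + e + h * (B * (T + 2) * M + D)))"
    if h: "0 < h" "0 \<le> a" "a + h \<le> T" and D: "0 \<le> D" and e: "0 \<le> e" and P: "continuous_on {0..T} P"
      and M: "\<forall>t\<in>{0..a + h}. \<bar>P t\<bar> \<le> M"
      and d: "\<forall>t\<in>{0..T}. \<forall>t'\<in>{0..T}. \<bar>d t - d t'\<bar> \<le> D * \<bar>t - t'\<bar>"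
      and Q: "degree Q \<le> m" "\<forall>t\<in>{a..a + h}. P t = poly Q t"
      and orth: "\<forall>\<phi>. degree \<phi> \<le> m - 1 \<longrightarrow> \<bar>integral {a..a + h} (\<lambda>t. (k t t * P t - mem P t - d t) * poly \<phi> t)\<bar>
        \<le> e * integral {a..a + h} (\<lambda>t. \<bar>poly \<phi> t\<bar>)" for P d D e M a h Q
  proof -
    define W where "W t = k t t * P t - mem P t - d t" for t
    \<comment> \<open>Bound for the freezing error: \<open>T + 1\<close> comes from the memory term,
      another \<open>1\<close> from the variation of \<open>k t t\<close>, and \<open>D\<close> from
      \<open>d\<close>.\<close>
    define \<eta> where "\<eta> = h * (B * (T + 2) * M + D)"
    have M0: "0 \<le> M" using M h by (meson abs_ge_zero atLeastAtMost_iff order_trans less_imp_le add_nonneg_nonneg order_refl)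
    have \<eta>0: "0 \<le> \<eta>" using h B_pos T_pos M0 D by (simp add: \<eta>_def)
    \<comment> \<open>The diagonal value is frozen at \<open>a\<close>, and memory term and
      \<open>d\<close> enter only through \<open>W a\<close>; hence \<open>Q'\<close> agrees with
      \<open>W\<close> at \<open>a\<close>.\<close>
    define Q' where "Q' = smult (k a a) (Q - [:P a:]) + [:W a:]"
    have Q': "poly Q' t = k a a * (P t - P a) + W a" if "t \<in> {a..a + h}" for t
      using Q(2) that by (simp add: Q'_def)
    have degQ': "degree Q' \<le> m"
      unfolding Q'_def using Q(1)
      by (intro degree_add_le order_trans[OF degree_smult_le] degree_diff_le) auto
    have diff: "\<bar>W t - poly Q' t\<bar> \<le> \<eta>" if t: "t \<in> {a..a + h}" for t
    proof -
      have "W t - poly Q' t = (k t t - k a a) * P t - (mem P t - mem P a) - (d t - d a)"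
        unfolding Q'[OF t] by (simp add: W_def algebra_simps)
      moreover have "\<bar>(k t t - k a a) * P t\<bar> \<le> (B * h) * M"
      proof -
        have "\<bar>k t t - k a a\<bar> \<le> B * \<bar>t - a\<bar>" using t h by (intro diag_lipschitz) auto
        also have "\<dots> \<le> B * h" using t B_pos by (intro mult_left_mono) auto
        finally show ?thesis unfolding abs_mult using M t h B_pos by (intro mult_mono) auto
      qed
      moreover have "\<bar>mem P t - mem P a\<bar> \<le> B * (T + 1) * M * h"
      proof -
        have "\<bar>mem P t - mem P a\<bar> \<le> B * (T + 1) * M * \<bar>t - a\<bar>"
          using M t h by (intro mem_lipschitz[of "a + h"] continuous_on_subset[OF P]) auto
        also have "\<dots> \<le> B * (T + 1) * M * h" using t B_pos M0 T_pos by (intro mult_left_mono) auto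
        finally show ?thesis .
      qed
      moreover have "\<bar>d t - d a\<bar> \<le> D * h"
      proof -
        have "\<bar>d t - d a\<bar> \<le> D * \<bar>t - a\<bar>" using t h by (intro d[rule_format]) auto
        also have "\<dots> \<le> D * h" using t D by (intro mult_left_mono) auto
        finally show ?thesis .
      qed
      ultimately show ?thesis unfolding \<eta>_def by (simp add: algebra_simps)
    qed
    have sub: "{a..a + h} \<subseteq> {0..T}" using h by auto
    have "continuous_on {0..T} W" unfolding W_def
      by (intro continuous_intros diag_continuous P mem_continuous continuous_on_real_lipschitz[of _ d D])
         (use d in auto)
    then have cW: "continuous_on {a..a + h} W" by (rule continuous_on_subset[OF _ sub])
    have "\<bar>integral {a..a + h} (\<lambda>x. poly Q' x * poly \<phi> x)\<bar> \<le> (e + \<eta>) * integral {a..a + h} (\<lambda>x. \<bar>poly \<phi> x\<bar>)"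
      if \<phi>: "degree \<phi> \<le> m - 1" for \<phi>
    proof -
      have "norm (integral {a..a + h} (\<lambda>x. (W x - poly Q' x) * poly \<phi> x)) \<le> integral {a..a + h} (\<lambda>x. \<eta> * \<bar>poly \<phi> x\<bar>)"
        by (rule integral_norm_bound_integral)
           (auto intro!: integrable_continuous_real continuous_intros cW mult_right_mono diff simp: abs_mult)
      moreover have "integral {a..a + h} (\<lambda>x. (W x - poly Q' x) * poly \<phi> x) =
        integral {a..a + h} (\<lambda>x. W x * poly \<phi> x) - integral {a..a + h} (\<lambda>x. poly Q' x * poly \<phi> x)"
        by (subst Henstock_Kurzweil_Integration.integral_diff[symmetric])
           (auto intro!: integrable_continuous_real continuous_intros cW simp: algebra_simps)
      moreover have "\<bar>integral {a..a + h} (\<lambda>x. W x * poly \<phi> x)\<bar> \<le> e * integral {a..a + h} (\<lambda>x. \<bar>poly \<phi> x\<bar>)"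
        using orth \<phi> by (simp add: W_def)
      ultimately show ?thesis by (simp add: algebra_simps)
    qed
    then have R: "\<bar>poly Q' (a + h)\<bar> \<le> \<bar>poly Q' a\<bar> + C * (e + \<eta>)"
        "\<And>x. x\<in>{a..a + h} \<Longrightarrow> \<bar>poly Q' x\<bar> \<le> C * (\<bar>poly Q' a\<bar> + (e + \<eta>))"
      using C(2)[OF degQ', of "e + \<eta>" h a] e \<eta>0 h by auto
    have Qa: "poly Q' a = W a" using Q'[of a] h by simp
    have "\<bar>W (a + h)\<bar> \<le> \<bar>W a\<bar> + (C + 1) * (e + \<eta>)"
      using R(1) diff[of "a + h"] h e unfolding Qa by (simp add: algebra_simps)
    moreover have "\<bar>W t\<bar> \<le> (C + 1) * (\<bar>W a\<bar> + e + \<eta>)" if t: "t \<in> {a..a + h}" for t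
      using R(2)[OF t] diff[OF t] e unfolding Qa by (simp add: algebra_simps)
    ultimately show ?thesis unfolding W_def \<eta>_def by blast
  qed
  then show ?thesis using C(1) by (intro exI[of _ "C + 1"]) auto
qed

end

section \<open>Stability of the discontinuous Galerkin scheme\<close>

lemma node_simps:
  "node T N 0 = 0" "node T N (Suc n) = node T N n + mesh_size T N" "N \<noteq> 0 \<Longrightarrow> node T N N = T"
  by (simp_all add: node_def mesh_size_def algebra_simps add_divide_distrib)

lemma node_mono: "0 \<le> T \<Longrightarrow> i \<le> j \<Longrightarrow> node T N i \<le> node T N j"
  by (simp add: node_def mesh_size_def mult_right_mono divide_right_mono)

lemma node_le: "0 \<le> T \<Longrightarrow> n \<le> N \<Longrightarrow> node T N n \<le> T"
  using node_mono[of T n N N] by (cases "N = 0") (auto simp: node_simps)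

lemma node_nonneg: "0 \<le> T \<Longrightarrow> 0 \<le> node T N n"
  by (simp add: node_def mesh_size_def)

text \<open>The last conclusion is there because the pieces in \<open>dg_space\<close> live on
  half-open cells: apart from the first cell, the left node has to be excluded.\<close>

lemma in_some_cell:
  assumes "0 \<le> t" "t \<le> node T N (Suc n)"
  obtains j where "j \<le> n" "t \<in> {node T N j..node T N (Suc j)}" "j = 0 \<or> node T N j < t"
proof -
  define j where "j = (LEAST j. t \<le> node T N (Suc j))"
  have 1: "t \<le> node T N (Suc j)" unfolding j_def by (rule LeastI) (rule assms(2))
  have 2: "j \<le> n" unfolding j_def by (rule Least_le) (rule assms(2))
  have 3: "j = 0 \<or> node T N j < t"
  proof (cases j)
    case (Suc i)
    then have "\<not> t \<le> node T N (Suc i)" using not_less_Least[of i "\<lambda>j. t \<le> node T N (Suc j)"] by (simp add: j_def)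
    then show ?thesis using Suc by simp
  qed simp
  show thesis using that[of j] 1 2 3 assms(1) by (auto simp: node_simps)
qed

context volterra_kernel
begin

text \<open>A discrete Gronwall argument for the nodal values of \<open>W\<close>. Their increments
  involve the maximum of \<open>P\<close> up to the current cell, which the continuous estimate
  \<open>gronwall\<close> bounds in turn by \<open>W\<close>; for small \<open>h\<close> this circle
  closes.\<close>

theorem dg_stability:
  assumes "m \<ge> 1"
  shows "\<exists>C>0. \<exists>h0>0. \<forall>N P d D e. 0 < N \<longrightarrow> mesh_size T N < h0 \<longrightarrow> 0 \<le> D \<longrightarrow> 0 \<le> e \<longrightarrow>
     continuous_on {0..T} P \<longrightarrow> P 0 = 0 \<longrightarrow> \<bar>d 0\<bar> \<le> D \<longrightarrow>
     (\<forall>t\<in>{0..T}. \<forall>t'\<in>{0..T}. \<bar>d t - d t'\<bar> \<le> D * \<bar>t - t'\<bar>) \<longrightarrow>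
     (\<forall>n<N. \<exists>Q. degree Q \<le> m \<and> (\<forall>t\<in>{node T N n..node T N (Suc n)}. P t = poly Q t)) \<longrightarrow>
     (\<forall>n<N. \<forall>\<phi>. degree \<phi> \<le> m - 1 \<longrightarrow>
        \<bar>integral {node T N n..node T N (Suc n)} (\<lambda>t. (k t t * P t - mem P t - d t) * poly \<phi> t)\<bar>
        \<le> e * integral {node T N n..node T N (Suc n)} (\<lambda>t. \<bar>poly \<phi> t\<bar>)) \<longrightarrow>
     (\<forall>t\<in>{0..T}. \<bar>P t\<bar> \<le> C * (D + e / mesh_size T N))"
proof -
  obtain C1 where C1: "C1 \<ge> 1" and step: "\<And>P d D e M a h. 0 < h \<Longrightarrow> 0 \<le> a \<Longrightarrow> a + h \<le> T \<Longrightarrow> 0 \<le> D \<Longrightarrow> 0 \<le> e \<Longrightarrow>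
     continuous_on {0..T} P \<Longrightarrow> (\<forall>t\<in>{0..a + h}. \<bar>P t\<bar> \<le> M) \<Longrightarrow>
     (\<forall>t\<in>{0..T}. \<forall>t'\<in>{0..T}. \<bar>d t - d t'\<bar> \<le> D * \<bar>t - t'\<bar>) \<Longrightarrow>
     (\<exists>Q. degree Q \<le> m \<and> (\<forall>t\<in>{a..a + h}. P t = poly Q t)) \<Longrightarrow>
     (\<forall>\<phi>. degree \<phi> \<le> m - 1 \<longrightarrow> \<bar>integral {a..a + h} (\<lambda>t. (k t t * P t - mem P t - d t) * poly \<phi> t)\<bar>
        \<le> e * integral {a..a + h} (\<lambda>t. \<bar>poly \<phi> t\<bar>)) \<Longrightarrow>
     \<bar>k (a + h) (a + h) * P (a + h) - mem P (a + h) - d (a + h)\<bar> \<le>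
       \<bar>k a a * P a - mem P a - d a\<bar> + C1 * (e + h * (B * (T + 2) * M + D)) \<and>
     (\<forall>t\<in>{a..a + h}. \<bar>k t t * P t - mem P t - d t\<bar> \<le>
       C1 * (\<bar>k a a * P a - mem P a - d a\<bar> + e + h * (B * (T + 2) * M + D)))"
    using local_step[OF assms] by blast
  \<comment> \<open>\<open>G\<close> is the constant of \<open>gronwall\<close>; \<open>C3\<close>
    converts a nodal bound for \<open>W\<close> into a bound for \<open>P\<close>, its factor
    \<open>2\<close> paying for an absorption; \<open>C4\<close> is the growth rate of the nodal
    recursion. The threshold \<open>h0\<close> gives \<open>G * C1 * c * h <= 1/2\<close>, so that
    the maximum of \<open>P\<close> can be absorbed from its own bound.\<close>
  define G where "G = 2 / k0 * exp (2 * B / k0 * T)"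
  define c where "c = B * (T + 2)"
  define C3 where "C3 = 2 * G * (C1 + C1 * T + 1 + T)"
  define C4 where "C4 = C1 * (1 + c * C3 + c * C3 * T)"
  define h0 where "h0 = 1 / (2 * G * C1 * c)"
  define C where "C = C3 * (2 * exp (C4 * T) + T + 1)"
  have G: "G > 0" using k0_pos by (simp add: G_def)
  have c: "c > 0" using B_pos T_pos by (simp add: c_def)
  have C3: "C3 > 0" using G C1 T_pos by (simp add: C3_def add_pos_pos)
  have C4: "C4 > 0" using c C1 T_pos C3 by (simp add: C4_def add_pos_pos)
  have h0: "h0 > 0" using G c C1 by (simp add: h0_def)
  have "C > 0" using C3 T_pos by (simp add: C_def add_pos_pos)
  moreover have "\<forall>N P d D e. 0 < N \<longrightarrow> mesh_size T N < h0 \<longrightarrow> 0 \<le> D \<longrightarrow> 0 \<le> e \<longrightarrow>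
     continuous_on {0..T} P \<longrightarrow> P 0 = 0 \<longrightarrow> \<bar>d 0\<bar> \<le> D \<longrightarrow>
     (\<forall>t\<in>{0..T}. \<forall>t'\<in>{0..T}. \<bar>d t - d t'\<bar> \<le> D * \<bar>t - t'\<bar>) \<longrightarrow>
     (\<forall>n<N. \<exists>Q. degree Q \<le> m \<and> (\<forall>t\<in>{node T N n..node T N (Suc n)}. P t = poly Q t)) \<longrightarrow>
     (\<forall>n<N. \<forall>\<phi>. degree \<phi> \<le> m - 1 \<longrightarrow>
        \<bar>integral {node T N n..node T N (Suc n)} (\<lambda>t. (k t t * P t - mem P t - d t) * poly \<phi> t)\<bar>
        \<le> e * integral {node T N n..node T N (Suc n)} (\<lambda>t. \<bar>poly \<phi> t\<bar>)) \<longrightarrow>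
     (\<forall>t\<in>{0..T}. \<bar>P t\<bar> \<le> C * (D + e / mesh_size T N))"
  proof (intro allI impI ballI)
    fix N P d D e t
    assume N: "0 < N" and small: "mesh_size T N < h0" and D: "0 \<le> D" and e: "0 \<le> e"
      and P: "continuous_on {0..T} P" "P 0 = 0" and d0: "\<bar>d 0\<bar> \<le> D"
      and d: "\<forall>t\<in>{0..T}. \<forall>t'\<in>{0..T}. \<bar>d t - d t'\<bar> \<le> D * \<bar>t - t'\<bar>"
      and Q: "\<forall>n<N. \<exists>Q. degree Q \<le> m \<and> (\<forall>t\<in>{node T N n..node T N (Suc n)}. P t = poly Q t)"
      and orth: "\<forall>n<N. \<forall>\<phi>. degree \<phi> \<le> m - 1 \<longrightarrow>
        \<bar>integral {node T N n..node T N (Suc n)} (\<lambda>t. (k t t * P t - mem P t - d t) * poly \<phi> t)\<bar>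
        \<le> e * integral {node T N n..node T N (Suc n)} (\<lambda>t. \<bar>poly \<phi> t\<bar>)"
      and t: "t \<in> {0..T}"
    define h where "h = mesh_size T N"
    \<comment> \<open>Writing \<open>e = h * (e / h)\<close> makes the contribution of one cell
      proportional to \<open>h\<close>; here the factor \<open>1 / h\<close> for rough residuals
      arises.\<close>
    define v where "v = D + e / h"
    define W where "W t = k t t * P t - mem P t - d t" for t
    have h: "h > 0" using T_pos N by (simp add: h_def mesh_size_def)
    have hT: "h \<le> T" using T_pos N by (simp add: h_def mesh_size_def divide_le_eq)
    have Nh: "real N * h = T" using N by (simp add: h_def mesh_size_def)
    have small': "G * (C1 * (c * h)) \<le> 1 / 2"
      using small G c C1 unfolding h0_def h_def[symmetric] by (simp add: field_simps)
    have nodes: "0 \<le> node T N n" "node T N n + h \<le> T" if "n < N" for n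
      using node_le[of T "Suc n" N] node_nonneg[of T N n] T_pos that by (auto simp: node_simps h_def)
    have cW: "continuous_on {0..T} W" unfolding W_def
      by (intro continuous_intros diag_continuous P mem_continuous continuous_on_real_lipschitz[of _ d D])
         (use d in auto)
    have v0: "v \<ge> D" "v \<ge> 0" using D e h by (auto simp: v_def)
    have ev: "e \<le> T * v"
    proof -
      have "e = h * (e / h)" using h by simp
      also have "\<dots> \<le> T * v" using hT D e h T_pos unfolding v_def by (intro mult_mono) auto
      finally show ?thesis .
    qed
    have W_step: "\<bar>W (node T N (Suc j))\<bar> \<le> \<bar>W (node T N j)\<bar> + C1 * (e + h * (c * M + D))"
         "\<And>t. t\<in>{node T N j..node T N (Suc j)} \<Longrightarrow> \<bar>W t\<bar> \<le> C1 * (\<bar>W (node T N j)\<bar> + e + h * (c * M + D))"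
      if j: "j < N" and M: "\<forall>t\<in>{0..node T N (Suc j)}. \<bar>P t\<bar> \<le> M" for j M
      using step[of h "node T N j" D e P M d] nodes[OF j] h D e P M d Q[rule_format, OF j] orth[rule_format, OF j]
      unfolding W_def c_def by (simp_all add: node_simps h_def)
    have d_le: "\<bar>d t\<bar> \<le> D * (1 + T)" if "t \<in> {0..T}" for t
    proof -
      have "\<bar>d t - d 0\<bar> \<le> D * \<bar>t - 0\<bar>" using that T_pos by (intro d[rule_format]) auto
      also have "\<dots> \<le> D * T" using that D by (intro mult_left_mono) auto
      finally show ?thesis using d0 by (simp add: algebra_simps)
    qed
    \<comment> \<open>Nodal bounds up to \<open>n\<close> control \<open>W\<close> on all of
      \<open>{0..b}\<close>; then \<open>gronwall\<close> bounds \<open>P\<close> there, up to the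
      absorbed term, and this bound feeds the next nodal value.\<close>
    have advance: "(\<forall>t\<in>{0..node T N (Suc n)}. \<bar>P t\<bar> \<le> C3 * (w + e + D)) \<and>
        \<bar>W (node T N (Suc n))\<bar> \<le> w + C4 * h * (w + v)"
      if n: "n < N" and w: "\<And>j. j \<le> n \<Longrightarrow> \<bar>W (node T N j)\<bar> \<le> w" for n w
    proof -
      define b where "b = node T N (Suc n)"
      have b: "0 \<le> b" "b \<le> T" using nodes[OF n] h by (auto simp: b_def node_simps h_def)
      have w0: "0 \<le> w" using w[of 0] abs_ge_zero order_trans by blast
      have "continuous_on {0..b} (\<lambda>t. \<bar>P t\<bar>)" using b by (intro continuous_intros continuous_on_subset[OF P(1)]) auto
      then obtain tP where tP: "tP \<in> {0..b}" "\<And>t. t \<in> {0..b} \<Longrightarrow> \<bar>P t\<bar> \<le> \<bar>P tP\<bar>"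
        using continuous_attains_sup[of "{0..b}" "\<lambda>t. \<bar>P t\<bar>"] b by auto
      define M where "M = \<bar>P tP\<bar>"
      have M0: "0 \<le> M" by (simp add: M_def)
      have MP: "\<bar>P t\<bar> \<le> M" if "t \<in> {0..b}" for t using tP that by (simp add: M_def)
      have Mj: "\<forall>t\<in>{0..node T N (Suc j)}. \<bar>P t\<bar> \<le> M" if "j \<le> n" for j
        using MP node_mono[of T "Suc j" "Suc n" N] that T_pos by (auto simp: b_def)
      define S where "S = C1 * (w + e + h * (c * M + D))"
      have S: "\<bar>W t\<bar> \<le> S" if t: "t \<in> {0..b}" for t
      proof -
        obtain j where j: "j \<le> n" "t \<in> {node T N j..node T N (Suc j)}"
          using in_some_cell[of t T N n] t by (auto simp: b_def)
        have "\<bar>W t\<bar> \<le> C1 * (\<bar>W (node T N j)\<bar> + e + h * (c * M + D))"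
          using W_step(2)[of j M t] Mj j n by auto
        also have "\<dots> \<le> S" unfolding S_def using w[OF j(1)] C1 by (intro mult_left_mono) auto
        finally show ?thesis .
      qed
      have "\<bar>P tP\<bar> \<le> G * (S + D * (1 + T))"
        unfolding G_def
      proof (rule gronwall[of b P])
        fix t assume t: "t \<in> {0..b}"
        have "k t t * P t - mem P t = W t + d t" by (simp add: W_def)
        then show "\<bar>k t t * P t - mem P t\<bar> \<le> S + D * (1 + T)"
          using S[OF t] d_le[of t] t b by auto
      qed (use b tP in \<open>auto intro!: continuous_on_subset[OF P(1)]\<close>)
      also have "\<dots> = G * (C1 * (w + e) + C1 * D * h + D * (1 + T)) + G * (C1 * (c * h)) * M"
        by (simp add: S_def algebra_simps)
      also have "\<dots> \<le> G * (C1 * (w + e) + C1 * D * T + D * (1 + T)) + 1 / 2 * M"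
        using small' M0 G C1 hT D by (intro add_mono mult_left_mono mult_right_mono) auto
      finally have "M \<le> 2 * G * (C1 * (w + e) + C1 * D * T + D * (1 + T))" by (simp add: M_def)
      also have "\<dots> \<le> 2 * G * ((C1 + C1 * T + 1 + T) * (w + e + D))"
      proof (intro mult_left_mono)
        have "0 \<le> C1 * T * (w + e)" "0 \<le> C1 * D" "0 \<le> (1 + T) * (w + e)" using C1 T_pos w0 e D by auto
        then show "C1 * (w + e) + C1 * D * T + D * (1 + T) \<le> (C1 + C1 * T + 1 + T) * (w + e + D)"
          by (simp add: algebra_simps)
      qed (use G in auto)
      finally have M: "M \<le> C3 * (w + e + D)" by (simp add: C3_def)
      have "\<bar>W (node T N (Suc n))\<bar> \<le> w + C1 * (e + h * (c * M + D))"
        using W_step(1)[OF n Mj[OF order_refl]] w[of n] by simp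
      also have "C1 * (e + h * (c * M + D)) \<le> C1 * (e + h * (c * (C3 * (w + e + D)) + D))"
        using M C1 h c by (intro mult_left_mono add_mono) auto
      also have "\<dots> = C1 * (h * v + h * c * C3 * (w + D) + h * c * C3 * e)"
        using h by (simp add: v_def algebra_simps)
      also have "\<dots> \<le> C1 * (h * (w + v) + h * c * C3 * (w + v) + h * c * C3 * (T * (w + v)))"
      proof (intro mult_left_mono add_mono)
        have "0 \<le> T * w" using w0 T_pos by simp
        then show "e \<le> T * (w + v)" using ev by (simp add: algebra_simps)
      qed (use C1 h c C3 w0 v0 in auto)
      also have "\<dots> = C4 * h * (w + v)" by (simp add: C4_def algebra_simps)
      finally show ?thesis using MP M by (fastforce simp: b_def)
    qed
    \<comment> \<open>The right-hand side solves the recursion in which \<open>w\<close> is followed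
      by \<open>w + C4 * h * (w + v)\<close>, with initial value \<open>D\<close>, a bound for
      \<open>|W 0| = |d 0|\<close>.\<close>
    have W_le: "\<bar>W (node T N j)\<bar> \<le> (1 + C4 * h) ^ n * (v + D) - v" if "n \<le> N" "j \<le> n" for n j
      using that
    proof (induction n arbitrary: j)
      case 0
      then show ?case using P d0 by (simp add: node_simps W_def)
    next
      case (Suc n)
      define w where "w = (1 + C4 * h) ^ n * (v + D) - v"
      have w: "\<bar>W (node T N j)\<bar> \<le> w" if "j \<le> n" for j using Suc.IH[of j] Suc.prems that by (simp add: w_def)
      have w0: "0 \<le> w" using w[of 0] abs_ge_zero order_trans by blast
      have eq: "(1 + C4 * h) ^ Suc n * (v + D) - v = w + C4 * h * (w + v)"
        by (simp add: w_def algebra_simps)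
      show ?case
      proof (cases "j = Suc n")
        case True
        then show ?thesis using advance[of n w] w Suc.prems unfolding eq by simp
      next
        case False
        then have "\<bar>W (node T N j)\<bar> \<le> w" using w Suc.prems by simp
        moreover have "0 \<le> C4 * h * (w + v)" using C4 h w0 v0 by simp
        ultimately show ?thesis unfolding eq by simp
      qed
    qed
    \<comment> \<open>Nodal values up to \<open>N - 1\<close> suffice, since \<open>advance\<close>
      at \<open>n = N - 1\<close> already covers the last cell and hence
      \<open>{0..T}\<close>.\<close>
    define w where "w = (1 + C4 * h) ^ (N - 1) * (v + D) - v"
    have "t \<in> {0..node T N (Suc (N - 1))}" using t N by (simp add: node_simps del: node_simps(2))
    then have "\<bar>P t\<bar> \<le> C3 * (w + e + D)"
      using advance[of "N - 1" w] W_le[of "N - 1"] N by (simp add: w_def)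
    also have "\<dots> \<le> C3 * (exp (C4 * T) * (2 * v) + T * v + v)"
    proof (intro mult_left_mono add_mono)
      have "(1 + C4 * h) ^ (N - 1) \<le> (1 + C4 * h) ^ N" using C4 h by (intro power_increasing) auto
      also have "\<dots> \<le> exp (C4 * h) ^ N" using C4 h by (intro power_mono) auto
      also have "\<dots> = exp (C4 * T)" by (simp add: exp_of_nat_mult[symmetric] Nh[symmetric] algebra_simps)
      finally have "(1 + C4 * h) ^ (N - 1) * (v + D) \<le> exp (C4 * T) * (2 * v)"
        using v0 D by (intro mult_mono) auto
      then show "w \<le> exp (C4 * T) * (2 * v)" using v0 by (simp add: w_def)
    qed (use ev v0 C3 in auto)
    also have "\<dots> = C * v" by (simp add: C_def algebra_simps)
    finally show "\<bar>P t\<bar> \<le> C * (D + e / mesh_size T N)" by (simp add: v_def h_def)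
  qed
  ultimately show ?thesis using h0 by (intro exI[of _ C] exI[of _ h0] conjI)
qed

end

section \<open>Regularity of the exact solution\<close>

lemma C_diff_on_cong:
  assumes "\<And>x. x \<in> S \<Longrightarrow> f x = g x"
  shows "C_diff_on n S f \<longleftrightarrow> C_diff_on n S g"
proof (cases n)
  case 0
  then show ?thesis using assms by (simp cong: continuous_on_cong)
next
  case (Suc j)
  have "(f has_derivative f') (at x within S) \<longleftrightarrow> (g has_derivative f') (at x within S)" if "x \<in> S" for x f'
    using assms that has_derivative_transform[of x S f g f'] has_derivative_transform[of x S g f f'] by auto
  then show ?thesis using Suc by (simp cong: ball_cong)
qed

lemma C_diff_on_Suc_imp: "C_diff_on (Suc n) S f \<Longrightarrow> C_diff_on n S f"
proof (induction n arbitrary: f)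
  case 0
  then show ?case
    by (auto simp: continuous_on_eq_continuous_within dest: has_derivative_continuous)
next
  case (Suc n)
  then obtain f' where "\<forall>x\<in>S. (f has_derivative f' x) (at x within S)" "\<forall>v. C_diff_on (Suc n) S (\<lambda>x. f' x v)"
    by (subst (asm) C_diff_on.simps(2)) blast
  then show ?case using Suc.IH by (subst C_diff_on.simps(2)) blast
qed

lemma C_diff_on_le: "C_diff_on n S f \<Longrightarrow> j \<le> n \<Longrightarrow> C_diff_on j S f"
proof (induction n)
  case (Suc n)
  show ?case
  proof (cases "j = Suc n")
    case False
    then have "j \<le> n" using Suc.prems(2) by simp
    then show ?thesis using Suc.IH C_diff_on_Suc_imp[OF Suc.prems(1)] by blast
  qed (use Suc.prems in simp)
qed simp

lemma C_diff_on_imp_continuous_on: "C_diff_on n S f \<Longrightarrow> continuous_on S f"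
  using C_diff_on_le[of n S f 0] by simp

lemma C_diff_on_add: "C_diff_on n S f \<Longrightarrow> C_diff_on n S g \<Longrightarrow> C_diff_on n S (\<lambda>x. f x + g x)"
proof (induction n arbitrary: f g)
  case (Suc n)
  from Suc.prems obtain f' g' where
    "\<forall>x\<in>S. (f has_derivative f' x) (at x within S)" "\<forall>v. C_diff_on n S (\<lambda>x. f' x v)"
    "\<forall>x\<in>S. (g has_derivative g' x) (at x within S)" "\<forall>v. C_diff_on n S (\<lambda>x. g' x v)" by auto
  then show ?case using Suc.IH
    by (auto intro!: exI[of _ "\<lambda>x v. f' x v + g' x v"] derivative_intros)
qed (simp add: continuous_on_add)

lemma C_diff_on_cmult: "C_diff_on n S f \<Longrightarrow> C_diff_on n S (\<lambda>x. c * f x)"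
proof (induction n arbitrary: f)
  case (Suc n)
  from Suc.prems obtain f' where
    "\<forall>x\<in>S. (f has_derivative f' x) (at x within S)" "\<forall>v. C_diff_on n S (\<lambda>x. f' x v)" by auto
  then show ?case using Suc.IH
    by (auto intro!: exI[of _ "\<lambda>x v. c * f' x v"] has_derivative_mult_right)
qed (simp add: continuous_on_mult_left)

lemma C_diff_on_diff: "C_diff_on n S f \<Longrightarrow> C_diff_on n S g \<Longrightarrow> C_diff_on n S (\<lambda>x. f x - g x)"
  using C_diff_on_add[of n S f "\<lambda>x. (-1) * g x"] C_diff_on_cmult[of n S g "-1"] by simp

text \<open>On the line every directional derivative is a multiple of the one in direction
  \<open>1\<close>, so the quantifier over directions collapses to one function.\<close>

lemma C_diff_on_Suc_real:
  fixes S :: "real set"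
  shows "C_diff_on (Suc n) S f \<longleftrightarrow>
    (\<exists>f'. (\<forall>x\<in>S. (f has_real_derivative f' x) (at x within S)) \<and> C_diff_on n S f')" (is "_ \<longleftrightarrow> ?R")
proof
  assume "C_diff_on (Suc n) S f"
  then obtain f' where f': "\<And>x. x\<in>S \<Longrightarrow> (f has_derivative f' x) (at x within S)" "\<And>v. C_diff_on n S (\<lambda>x. f' x v)" by auto
  have "(f has_real_derivative f' x 1) (at x within S)" if "x \<in> S" for x
  proof (rule has_derivative_imp_has_field_derivative[OF f'(1)[OF that]])
    have "linear (f' x)" using f'(1)[OF that] has_derivative_bounded_linear bounded_linear.linear by blast
    then show "v * f' x 1 = f' x v" for v using linear_scale[of "f' x" v 1] by simp
  qed
  then show ?R by (intro exI[of _ "\<lambda>x. f' x 1"] conjI ballI f'(2))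
next
  assume ?R
  then obtain f' where "\<And>x. x\<in>S \<Longrightarrow> (f has_real_derivative f' x) (at x within S)" "C_diff_on n S f'" by blast
  then show "C_diff_on (Suc n) S f"
    using C_diff_on_cmult[of n S f']
    by (auto intro!: exI[of _ "\<lambda>x v. f' x * v"] simp: has_field_derivative_def mult.commute)
qed

lemma C_diff_on_mult:
  fixes S :: "real set"
  shows "C_diff_on n S f \<Longrightarrow> C_diff_on n S g \<Longrightarrow> C_diff_on n S (\<lambda>x. f x * g x)"
proof (induction n arbitrary: f g)
  case (Suc n)
  from Suc.prems obtain f' g' where d:
    "\<forall>x\<in>S. (f has_real_derivative f' x) (at x within S)" "C_diff_on n S f'"
    "\<forall>x\<in>S. (g has_real_derivative g' x) (at x within S)" "C_diff_on n S g'"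
    unfolding C_diff_on_Suc_real by blast
  have "C_diff_on n S (\<lambda>x. f' x * g x + g' x * f x)"
    using Suc.IH d Suc.prems C_diff_on_Suc_imp by (intro C_diff_on_add Suc.IH) blast+
  moreover have "\<forall>x\<in>S. ((\<lambda>x. f x * g x) has_real_derivative f' x * g x + g' x * f x) (at x within S)"
    using d by (auto intro!: DERIV_mult)
  ultimately show ?case unfolding C_diff_on_Suc_real by (intro exI conjI)
qed (simp add: continuous_on_mult)

lemma C_diff_on_inverse:
  fixes S :: "real set"
  assumes "\<And>x. x \<in> S \<Longrightarrow> f x \<noteq> 0"
  shows "C_diff_on n S f \<Longrightarrow> C_diff_on n S (\<lambda>x. inverse (f x))"
proof (induction n)
  case 0
  then show ?case using assms by (simp add: continuous_on_inverse)
next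
  case (Suc n)
  from Suc.prems obtain f' where d:
    "\<forall>x\<in>S. (f has_real_derivative f' x) (at x within S)" "C_diff_on n S f'"
    unfolding C_diff_on_Suc_real by blast
  have "C_diff_on n S (\<lambda>x. inverse (f x))" using Suc C_diff_on_Suc_imp by blast
  then have "C_diff_on n S (\<lambda>x. (-1) * (inverse (f x) * f' x * inverse (f x)))"
    using d by (intro C_diff_on_cmult C_diff_on_mult)
  moreover have "\<forall>x\<in>S. ((\<lambda>x. inverse (f x)) has_real_derivative (-1) * (inverse (f x) * f' x * inverse (f x))) (at x within S)"
    using d assms by (auto intro!: derivative_eq_intros)
  ultimately show ?case unfolding C_diff_on_Suc_real by (intro exI conjI)
qed

text \<open>Differentiating along the diagonal is the directional derivative in direction
  \<open>(v, v)\<close>, which belongs to the family that \<open>C_diff_on\<close> controls; so the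
  induction closes.\<close>

lemma C_diff_on_diagonal:
  "C_diff_on n (triangle T) f \<Longrightarrow> C_diff_on n {0..T} (\<lambda>t. f (t, t))"
proof (induction n arbitrary: f)
  case 0
  then have "continuous_on (triangle T) f" by simp
  then show ?case unfolding C_diff_on.simps
    by (rule continuous_on_compose2) (auto intro!: continuous_intros simp: triangle_def)
next
  case (Suc n)
  from Suc.prems obtain f' where d:
    "\<And>x. x\<in>triangle T \<Longrightarrow> (f has_derivative f' x) (at x within triangle T)" "\<And>v. C_diff_on n (triangle T) (\<lambda>x. f' x v)" by auto
  have "((\<lambda>t. f (t, t)) has_derivative (\<lambda>v. f' (t, t) (v, v))) (at t within {0..T})" if "t \<in> {0..T}" for t
  proof -
    have "((\<lambda>t. (t, t)) has_derivative (\<lambda>v. (v, v))) (at t within {0..T})"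
      by (intro derivative_intros)
    moreover have "(f has_derivative f' (t, t)) (at (t, t) within (\<lambda>t. (t, t)) ` {0..T})"
      using that by (intro has_derivative_subset[OF d(1)]) (auto simp: triangle_def)
    ultimately show ?thesis by (rule has_derivative_in_compose)
  qed
  moreover have "C_diff_on n {0..T} (\<lambda>t. f' (t, t) (v, v))" for v
    using Suc.IH[OF d(2)[of "(v, v)"]] .
  ultimately show ?case unfolding C_diff_on.simps
    by (intro exI[of _ "\<lambda>t v. f' (t, t) (v, v)"]) auto
qed

lemma compact_triangle: "compact (triangle T)"
proof -
  have eq: "triangle T = {x. 0 \<le> snd x} \<inter> {x. snd x \<le> fst x} \<inter> {x. fst x \<le> T}" by (auto simp: triangle_def)
  have "closed (triangle T)" unfolding eq
    by (intro closed_Int closed_Collect_le continuous_intros)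
  moreover have "triangle T \<subseteq> cbox (0, 0) (T, T)" by (auto simp: triangle_def cbox_Pair_eq)
  ultimately show ?thesis by (meson bounded_cbox bounded_subset compact_eq_bounded_closed)
qed

lemma convex_triangle: "convex (triangle T)"
proof -
  have eq: "triangle T = (\<lambda>x. snd x) -` {0..} \<inter> (\<lambda>x. fst x - snd x) -` {0..} \<inter> (\<lambda>x. fst x) -` {..T}" by (auto simp: triangle_def)
  show ?thesis unfolding eq
    by (intro convex_Int convex_linear_vimage bounded_linear.linear bounded_linear_intros) auto
qed

text \<open>Compactness bounds the two partial derivatives, linearity extends the bound to all
  directions, and convexity of the triangle allows the mean value inequality.\<close>

lemma C_diff_on_imp_lipschitz_kernel:
  assumes "C_diff_on (Suc n) (triangle T) (\<lambda>(t, s). \<kappa> t s)"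
  obtains B where "lipschitz_kernel T B \<kappa>"
proof -
  define f where "f = (\<lambda>(t, s). \<kappa> t s)"
  from assms obtain f' where d:
    "\<And>x. x\<in>triangle T \<Longrightarrow> (f has_derivative f' x) (at x within triangle T)" "\<And>v. C_diff_on n (triangle T) (\<lambda>x. f' x v)"
    by (auto simp: f_def)
  have bdd: "\<exists>B. \<forall>x\<in>triangle T. \<bar>F x\<bar> \<le> B" if "continuous_on (triangle T) F" for F :: "real \<times> real \<Rightarrow> real"
    using compact_continuous_image[OF that compact_triangle] compact_imp_bounded bounded_iff
    by (metis imageI real_norm_def)
  obtain B1 where B1: "\<And>x. x \<in> triangle T \<Longrightarrow> \<bar>f' x (1, 0)\<bar> \<le> B1"
    using bdd C_diff_on_imp_continuous_on[OF d(2)] by metis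
  obtain B2 where B2: "\<And>x. x \<in> triangle T \<Longrightarrow> \<bar>f' x (0, 1)\<bar> \<le> B2"
    using bdd C_diff_on_imp_continuous_on[OF d(2)] by metis
  obtain B0 where B0: "\<And>x. x \<in> triangle T \<Longrightarrow> \<bar>f x\<bar> \<le> B0"
    using bdd C_diff_on_imp_continuous_on[OF assms] by (metis f_def)
  define B where "B = \<bar>B0\<bar> + \<bar>B1\<bar> + \<bar>B2\<bar>"
  have lip: "\<bar>f x - f y\<bar> \<le> B * norm (x - y)" if "x \<in> triangle T" "y \<in> triangle T" for x y
    unfolding real_norm_def[symmetric]
  proof (rule differentiable_bound[OF convex_triangle d(1) _ that])
    fix x assume x: "x \<in> triangle T"
    show "onorm (f' x) \<le> B"
    proof (rule onorm_le)
      fix v :: "real \<times> real"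
      have lin: "linear (f' x)" using d(1)[OF x] has_derivative_bounded_linear bounded_linear.linear by blast
      have "f' x (fst v *\<^sub>R (1, 0) + snd v *\<^sub>R (0, 1)) = fst v * f' x (1, 0) + snd v * f' x (0, 1)"
        by (simp only: linear_add[OF lin] linear_scale[OF lin] real_scaleR_def)
      moreover have "fst v *\<^sub>R (1, 0) + snd v *\<^sub>R (0, 1) = v" by (simp add: prod_eq_iff)
      ultimately have "f' x v = fst v * f' x (1, 0) + snd v * f' x (0, 1)" by (simp only:)
      then have "\<bar>f' x v\<bar> \<le> \<bar>fst v\<bar> * \<bar>f' x (1, 0)\<bar> + \<bar>snd v\<bar> * \<bar>f' x (0, 1)\<bar>"
        by (metis abs_mult abs_triangle_ineq)
      also have "\<dots> \<le> norm v * \<bar>B1\<bar> + norm v * \<bar>B2\<bar>"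
        using B1[OF x] B2[OF x] norm_fst_le[of "fst v" "snd v"] norm_snd_le[of "snd v" "fst v"]
        by (intro add_mono mult_mono) auto
      also have "\<dots> \<le> B * norm v" by (simp add: B_def algebra_simps)
      finally show "norm (f' x v) \<le> B * norm v" by simp
    qed
  qed
  have "lipschitz_kernel T B \<kappa>"
    unfolding lipschitz_kernel_def
  proof (intro conjI allI impI)
    show "0 \<le> B" by (simp add: B_def)
    show "\<bar>\<kappa> t s\<bar> \<le> B" if "(t, s) \<in> triangle T" for t s
      using B0[OF that] by (simp add: B_def f_def)
    show "\<bar>\<kappa> t s - \<kappa> t' s'\<bar> \<le> B * (\<bar>t - t'\<bar> + \<bar>s - s'\<bar>)"
      if "(t, s) \<in> triangle T" "(t', s') \<in> triangle T" for t s t' s'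
    proof -
      have "\<bar>\<kappa> t s - \<kappa> t' s'\<bar> \<le> B * norm (t - t', s - s')" using lip[OF that] by (simp add: f_def)
      also have "\<dots> \<le> B * (\<bar>t - t'\<bar> + \<bar>s - s'\<bar>)"
        using norm_Pair_le[of "t - t'" "s - s'"] by (intro mult_left_mono) (auto simp: B_def)
      finally show ?thesis .
    qed
  qed
  then show thesis by (rule that)
qed

section \<open>Differentiation of Volterra integrals and smoothness of solutions\<close>

lemma has_real_derivative_of_quadratic_bound:
  fixes H :: "real \<Rightarrow> real"
  assumes "\<And>u. u \<in> S \<Longrightarrow> \<bar>H u - H t - c * (u - t)\<bar> \<le> E * (u - t)\<^sup>2"
  shows "(H has_real_derivative c) (at t within S)"
  unfolding has_field_derivative_def has_derivative_within_alt
proof (intro conjI allI impI bounded_linear_mult_right)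
  fix e :: real assume e: "e > 0"
  show "\<exists>d>0. \<forall>y\<in>S. norm (y - t) < d \<longrightarrow> norm (H y - H t - c * (y - t)) \<le> e * norm (y - t)"
  proof (intro exI[of _ "e / (\<bar>E\<bar> + 1)"] conjI ballI impI)
    fix u assume u: "u \<in> S" "norm (u - t) < e / (\<bar>E\<bar> + 1)"
    have "E * \<bar>u - t\<bar> \<le> (\<bar>E\<bar> + 1) * \<bar>u - t\<bar>" by (intro mult_right_mono) auto
    also have "\<dots> \<le> e" using u(2) by (simp add: field_simps)
    finally have "(E * \<bar>u - t\<bar>) * \<bar>u - t\<bar> \<le> e * \<bar>u - t\<bar>" by (intro mult_right_mono) auto
    then show "norm (H u - H t - c * (u - t)) \<le> e * norm (u - t)"
      using assms[OF u(1)] by (simp add: power2_eq_square mult.assoc)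
  qed (use e in auto)
qed

text \<open>Leibniz rule for a kernel controlled only for \<open>s <= t\<close> and a merely
  continuous \<open>y\<close>. The function \<open>J\<close> carries the moving end point and is
  differentiated by the fundamental theorem; the increments of the rest \<open>H\<close> are linear
  up to a quadratic error, by the Lipschitz bounds of both kernels.\<close>

lemma volterra_integral_has_derivative:
  fixes y :: "real \<Rightarrow> real"
  assumes \<kappa>: "lipschitz_kernel T B \<kappa>" and \<kappa>': "lipschitz_kernel T B' \<kappa>'"
    and d: "\<And>t s. (t, s) \<in> triangle T \<Longrightarrow> ((\<lambda>t. \<kappa> t s) has_real_derivative \<kappa>' t s) (at t within {s..T})"
    and y: "continuous_on {0..T} y" and t: "t \<in> {0..T}"
  shows "((\<lambda>t. integral {0..t} (\<lambda>s. \<kappa> t s * y s)) has_real_derivative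
           \<kappa> t t * y t + integral {0..t} (\<lambda>s. \<kappa>' t s * y s)) (at t within {0..T})"
proof -
  define F where "F t = integral {0..t} (\<lambda>s. \<kappa> t s * y s)" for t
  define \<Gamma> where "\<Gamma> t = integral {0..t} (\<lambda>s. \<kappa>' t s * y s)" for t
  define J where "J t = integral {0..t} (\<lambda>s. \<kappa> s s * y s)" for t
  define H where "H t = F t - J t" for t
  obtain M where M: "\<And>s. s \<in> {0..T} \<Longrightarrow> \<bar>y s\<bar> \<le> M"
    using bounded_on_Icc[OF y] by blast
  have M0: "0 \<le> M" using M[OF t] by simp
  have B0: "0 \<le> B" "0 \<le> B'" using \<kappa> \<kappa>' by (auto dest: lipschitz_kernel_nonneg)
  have T0: "0 \<le> T" using t by simp
  have cdiag: "continuous_on {0..T} (\<lambda>s. \<kappa> s s)"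
  proof (rule continuous_on_real_lipschitz[of _ _ "2 * B"])
    fix s u assume "s \<in> {0..T}" "u \<in> {0..T}"
    then have "(s, s) \<in> triangle T" "(u, u) \<in> triangle T" by (auto simp: triangle_def)
    then have "\<bar>\<kappa> s s - \<kappa> u u\<bar> \<le> B * (\<bar>s - u\<bar> + \<bar>s - u\<bar>)"
      using \<kappa> unfolding lipschitz_kernel_def by blast
    then show "\<bar>\<kappa> s s - \<kappa> u u\<bar> \<le> 2 * B * \<bar>s - u\<bar>" by simp
  qed
  have J: "(J has_real_derivative \<kappa> t t * y t) (at t within {0..T})"
    unfolding J_def has_real_derivative_iff_has_vector_derivative
    by (rule integral_has_vector_derivative) (use t cdiag y in \<open>auto intro!: continuous_intros\<close>)
  have \<Gamma>_lip: "\<bar>\<Gamma> a - \<Gamma> b\<bar> \<le> B' * (T + 1) * M * \<bar>a - b\<bar>" if "a \<in> {0..T}" "b \<in> {0..T}" for a b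
    unfolding \<Gamma>_def by (rule volterra_integral_lipschitz[OF \<kappa>' y M _ that]) auto
  define E where "E = B' * T * M + B * M"
  have E0: "0 \<le> E" using B0 T0 M0 by (simp add: E_def)
  have forward: "\<bar>H b - H a - \<Gamma> a * (b - a)\<bar> \<le> E * (b - a)\<^sup>2" if ab: "0 \<le> a" "a \<le> b" "b \<le> T" for a b
  proof -
    have c: "continuous_on {0..u} (\<kappa> u)" "continuous_on {0..u} (\<kappa>' u)" "continuous_on {0..u} y" if "u \<le> T" for u
      using that by (auto intro!: lipschitz_kernel_continuous[OF \<kappa>] lipschitz_kernel_continuous[OF \<kappa>'] continuous_on_subset[OF y])
    have c': "continuous_on {0..a} (\<kappa> b)" "continuous_on {a..b} (\<kappa> b)" "continuous_on {a..b} y"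
      using c[of b] ab by (auto elim!: continuous_on_subset)
    have cd: "continuous_on {0..b} (\<lambda>s. \<kappa> s s)" "continuous_on {a..b} (\<lambda>s. \<kappa> s s)"
      using cdiag ab by (auto elim!: continuous_on_subset)
    have 1: "F b = integral {0..a} (\<lambda>s. \<kappa> b s * y s) + integral {a..b} (\<lambda>s. \<kappa> b s * y s)"
      unfolding F_def using ab c[of b]
      by (intro Henstock_Kurzweil_Integration.integral_combine[symmetric] integrable_continuous_real continuous_intros) auto
    have 2: "J b = J a + integral {a..b} (\<lambda>s. \<kappa> s s * y s)"
      unfolding J_def using ab c[of b] cd
      by (intro Henstock_Kurzweil_Integration.integral_combine[symmetric] integrable_continuous_real continuous_intros) auto
    have 3: "integral {a..b} (\<lambda>s. \<kappa> b s * y s) - integral {a..b} (\<lambda>s. \<kappa> s s * y s) =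
      integral {a..b} (\<lambda>s. (\<kappa> b s - \<kappa> s s) * y s)"
      using c' cd by (subst Henstock_Kurzweil_Integration.integral_diff[symmetric])
        (auto intro!: integrable_continuous_real continuous_intros simp: algebra_simps)
    have i: "(\<lambda>s. \<kappa> b s * y s) integrable_on {0..a}" "(\<lambda>s. \<kappa> a s * y s) integrable_on {0..a}"
        "(\<lambda>s. \<kappa>' a s * y s * (b - a)) integrable_on {0..a}"
      using c' c[of a] ab by (auto intro!: integrable_continuous_real continuous_intros)
    have 4: "integral {0..a} (\<lambda>s. \<kappa> b s * y s) - F a - \<Gamma> a * (b - a) =
        integral {0..a} (\<lambda>s. (\<kappa> b s - \<kappa> a s - \<kappa>' a s * (b - a)) * y s)"
    proof -
      have "\<Gamma> a * (b - a) = integral {0..a} (\<lambda>s. \<kappa>' a s * y s * (b - a))" by (simp add: \<Gamma>_def)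
      then show ?thesis unfolding F_def
        using i by (simp add: Henstock_Kurzweil_Integration.integral_diff[symmetric] integrable_diff algebra_simps)
    qed
    have eq: "H b - H a - \<Gamma> a * (b - a) = integral {0..a} (\<lambda>s. (\<kappa> b s - \<kappa> a s - \<kappa>' a s * (b - a)) * y s)
        + integral {a..b} (\<lambda>s. (\<kappa> b s - \<kappa> s s) * y s)"
      unfolding 3[symmetric] 4[symmetric] H_def using 1 2 by simp
    have "norm (integral {0..a} (\<lambda>s. (\<kappa> b s - \<kappa> a s - \<kappa>' a s * (b - a)) * y s)) \<le> (B' * (b - a)\<^sup>2 * M) * (a - 0)"
    proof (rule integral_bound)
      fix s assume s: "s \<in> {0..a}"
      have "norm ((\<kappa> b s - \<kappa>' a s * (b - a)) - (\<kappa> a s - \<kappa>' a s * (a - a))) \<le> B' * (b - a) * norm (b - a)"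
      proof (rule field_differentiable_bound[of "{a..b}" "\<lambda>u. \<kappa> u s - \<kappa>' a s * (u - a)" "\<lambda>u. \<kappa>' u s - \<kappa>' a s"])
        fix u assume u: "u \<in> {a..b}"
        have "((\<lambda>t. \<kappa> t s) has_real_derivative \<kappa>' u s) (at u within {a..b})"
          using u s ab by (intro DERIV_subset[OF d]) (auto simp: triangle_def)
        then show "((\<lambda>u. \<kappa> u s - \<kappa>' a s * (u - a)) has_real_derivative \<kappa>' u s - \<kappa>' a s) (at u within {a..b})"
          by (auto intro!: derivative_eq_intros)
        have "\<bar>\<kappa>' u s - \<kappa>' a s\<bar> \<le> B' * \<bar>u - a\<bar>"
          using u s ab by (intro lipschitz_kernel_fst[OF \<kappa>']) auto
        also have "\<dots> \<le> B' * (b - a)" using u B0 by (intro mult_left_mono) auto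
        finally show "norm (\<kappa>' u s - \<kappa>' a s) \<le> B' * (b - a)" by simp
      qed (use ab in auto)
      then have "\<bar>\<kappa> b s - \<kappa> a s - \<kappa>' a s * (b - a)\<bar> \<le> B' * (b - a)\<^sup>2"
        using ab by (simp add: power2_eq_square algebra_simps)
      then show "norm ((\<kappa> b s - \<kappa> a s - \<kappa>' a s * (b - a)) * y s) \<le> B' * (b - a)\<^sup>2 * M"
        using s ab M[of s] B0 unfolding real_norm_def abs_mult by (intro mult_mono) auto
    qed (use ab c[of a] c' in \<open>auto intro!: continuous_intros\<close>)
    also have "\<dots> \<le> (B' * (b - a)\<^sup>2 * M) * T" using ab B0 M0 by (intro mult_left_mono) auto
    finally have 5: "\<bar>integral {0..a} (\<lambda>s. (\<kappa> b s - \<kappa> a s - \<kappa>' a s * (b - a)) * y s)\<bar> \<le> (B' * (b - a)\<^sup>2 * M) * T"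
      by simp
    have "norm (integral {a..b} (\<lambda>s. (\<kappa> b s - \<kappa> s s) * y s)) \<le> (B * (b - a) * M) * (b - a)"
    proof (rule integral_bound)
      fix s assume s: "s \<in> {a..b}"
      have "\<bar>\<kappa> b s - \<kappa> s s\<bar> \<le> B * \<bar>b - s\<bar>"
        using s ab by (intro lipschitz_kernel_fst[OF \<kappa>]) auto
      also have "\<dots> \<le> B * (b - a)" using s B0 by (intro mult_left_mono) auto
      finally show "norm ((\<kappa> b s - \<kappa> s s) * y s) \<le> B * (b - a) * M"
        using s ab M[of s] B0 unfolding real_norm_def abs_mult by (intro mult_mono) auto
    qed (use ab cd c' in \<open>auto intro!: continuous_intros\<close>)
    then have 6: "\<bar>integral {a..b} (\<lambda>s. (\<kappa> b s - \<kappa> s s) * y s)\<bar> \<le> B * (b - a) * M * (b - a)" by simp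
    show ?thesis unfolding eq using 5 6 by (simp add: E_def algebra_simps power2_eq_square)
  qed
  have "(H has_real_derivative \<Gamma> t) (at t within {0..T})"
  proof (rule has_real_derivative_of_quadratic_bound[of _ _ _ _ "E + B' * (T + 1) * M"])
    fix u assume u: "u \<in> {0..T}"
    have nn: "0 \<le> B' * (T + 1) * M" using B0 T0 M0 by simp
    show "\<bar>H u - H t - \<Gamma> t * (u - t)\<bar> \<le> (E + B' * (T + 1) * M) * (u - t)\<^sup>2"
    proof (cases "t \<le> u")
      case True
      have "E * (u - t)\<^sup>2 \<le> (E + B' * (T + 1) * M) * (u - t)\<^sup>2" using nn by (intro mult_right_mono) auto
      then show ?thesis using forward[of t u] True t u by auto
    next
      \<comment> \<open>The expansion \<open>forward\<close> starts from the left point, which keeps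
        all kernel arguments in the triangle. For \<open>u < t\<close> it is taken from
        \<open>u\<close>, and exchanging \<open>\<Gamma> u\<close> for \<open>\<Gamma> t\<close>
        costs another quadratic term.\<close>
      case False
      have "\<bar>(\<Gamma> t - \<Gamma> u) * (u - t)\<bar> \<le> B' * (T + 1) * M * \<bar>t - u\<bar> * \<bar>u - t\<bar>"
        unfolding abs_mult by (intro mult_right_mono \<Gamma>_lip t u) auto
      also have "\<dots> = B' * (T + 1) * M * (u - t)\<^sup>2"
        by (simp add: abs_minus_commute[of t u] power2_eq_square mult.assoc flip: abs_mult)
      finally have a: "\<bar>(\<Gamma> t - \<Gamma> u) * (u - t)\<bar> \<le> B' * (T + 1) * M * (u - t)\<^sup>2" .
      have b: "\<bar>H t - H u - \<Gamma> u * (t - u)\<bar> \<le> E * (u - t)\<^sup>2"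
        using forward[of u t] False t u by (simp add: power2_commute)
      have "H u - H t - \<Gamma> t * (u - t) = - (H t - H u - \<Gamma> u * (t - u)) - (\<Gamma> t - \<Gamma> u) * (u - t)"
        by (simp add: algebra_simps)
      then have "\<bar>H u - H t - \<Gamma> t * (u - t)\<bar> \<le> \<bar>H t - H u - \<Gamma> u * (t - u)\<bar> + \<bar>(\<Gamma> t - \<Gamma> u) * (u - t)\<bar>"
        by linarith
      then show ?thesis using a b by (simp only: distrib_right)
    qed
  qed
  from DERIV_add[OF J this] have "((\<lambda>t. F t) has_real_derivative \<kappa> t t * y t + \<Gamma> t) (at t within {0..T})"
    by (simp add: H_def)
  then show ?thesis by (simp add: F_def \<Gamma>_def)
qed

lemma triangle_partial_derivatives:
  assumes "(f has_derivative f') (at (t, s) within triangle T)" "(t, s) \<in> triangle T"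
  shows "((\<lambda>t. f (t, s)) has_real_derivative f' (1, 0)) (at t within {s..T})"
    and "((\<lambda>s. f (t, s)) has_real_derivative f' (0, 1)) (at s within {0..t})"
proof -
  have lin: "linear f'" using assms(1) has_derivative_bounded_linear bounded_linear.linear by blast
  have "((\<lambda>t. (t, s)) has_derivative (\<lambda>v. (v, 0))) (at t within {s..T})" by (auto intro!: derivative_eq_intros)
  moreover have "(f has_derivative f') (at (t, s) within (\<lambda>t. (t, s)) ` {s..T})"
    using assms by (intro has_derivative_subset[OF assms(1)]) (auto simp: triangle_def)
  ultimately have "((\<lambda>t. f (t, s)) has_derivative (\<lambda>v. f' (v, 0))) (at t within {s..T})"
    by (rule has_derivative_in_compose)
  moreover have "(\<lambda>v. f' (v, 0)) = (*) (f' (1, 0))"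
  proof
    show "f' (v, 0) = f' (1, 0) * v" for v using linear_scale[OF lin, of v "(1, 0)"] by simp
  qed
  ultimately show "((\<lambda>t. f (t, s)) has_real_derivative f' (1, 0)) (at t within {s..T})"
    by (simp only: has_field_derivative_def)
  have "((\<lambda>s. (t, s)) has_derivative (\<lambda>v. (0, v))) (at s within {0..t})" by (auto intro!: derivative_eq_intros)
  moreover have "(f has_derivative f') (at (t, s) within (\<lambda>s. (t, s)) ` {0..t})"
    using assms by (intro has_derivative_subset[OF assms(1)]) (auto simp: triangle_def)
  ultimately have "((\<lambda>s. f (t, s)) has_derivative (\<lambda>v. f' (0, v))) (at s within {0..t})"
    by (rule has_derivative_in_compose)
  moreover have "(\<lambda>v. f' (0, v)) = (*) (f' (0, 1))"
  proof
    show "f' (0, v) = f' (0, 1) * v" for v using linear_scale[OF lin, of v "(0, 1)"] by simp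
  qed
  ultimately show "((\<lambda>s. f (t, s)) has_real_derivative f' (0, 1)) (at s within {0..t})"
    by (simp only: has_field_derivative_def)
qed

lemma C_diff_on_kernel_partials:
  assumes "C_diff_on (Suc n) (triangle T) (\<lambda>(t, s). \<kappa> t s)"
  obtains \<kappa>t \<kappa>s where
    "\<And>t s. (t, s) \<in> triangle T \<Longrightarrow> ((\<lambda>t. \<kappa> t s) has_real_derivative \<kappa>t t s) (at t within {s..T})"
    "\<And>t s. (t, s) \<in> triangle T \<Longrightarrow> (\<kappa> t has_real_derivative \<kappa>s t s) (at s within {0..t})"
    "C_diff_on n (triangle T) (\<lambda>(t, s). \<kappa>t t s)" "C_diff_on n (triangle T) (\<lambda>(t, s). \<kappa>s t s)"
proof -
  from assms obtain f' where f':
    "\<And>x. x \<in> triangle T \<Longrightarrow> ((\<lambda>(t, s). \<kappa> t s) has_derivative f' x) (at x within triangle T)"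
    "\<And>v. C_diff_on n (triangle T) (\<lambda>x. f' x v)" by auto
  show thesis
  proof (rule that[of "\<lambda>t s. f' (t, s) (1, 0)" "\<lambda>t s. f' (t, s) (0, 1)"])
    show "((\<lambda>t. \<kappa> t s) has_real_derivative f' (t, s) (1, 0)) (at t within {s..T})"
      "(\<kappa> t has_real_derivative f' (t, s) (0, 1)) (at s within {0..t})"
      if "(t, s) \<in> triangle T" for t s
      using triangle_partial_derivatives[OF f'(1)[OF that] that] by simp_all
  qed (use f'(2) in \<open>simp_all add: case_prod_unfold\<close>)
qed

text \<open>Integration gains one order over \<open>y\<close>, and this gain drives the regularity
  bootstrap. Truncated subtraction makes \<open>j = 0\<close> ask for continuity of
  \<open>y\<close>. The additional order of the kernel supplies the Lipschitz bounds at each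
  differentiation.\<close>

lemma C_diff_on_volterra_integral:
  assumes "C_diff_on (Suc j) (triangle T) (\<lambda>(t, s). \<kappa> t s)" "C_diff_on (j - 1) {0..T} y"
  shows "C_diff_on j {0..T} (\<lambda>t. integral {0..t} (\<lambda>s. \<kappa> t s * y s))"
  using assms
proof (induction j arbitrary: \<kappa>)
  case 0
  obtain B where B: "lipschitz_kernel T B \<kappa>" using C_diff_on_imp_lipschitz_kernel[OF 0(1)] .
  have y: "continuous_on {0..T} y" using 0 by simp
  obtain M where M: "\<And>s. s \<in> {0..T} \<Longrightarrow> \<bar>y s\<bar> \<le> M"
    using bounded_on_Icc[OF y] by blast
  show ?case unfolding C_diff_on.simps
    using volterra_integral_lipschitz[OF B y M order_refl] by (rule continuous_on_real_lipschitz) auto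
next
  case (Suc j)
  obtain \<kappa>t \<kappa>s where d: "\<And>t s. (t, s) \<in> triangle T \<Longrightarrow> ((\<lambda>t. \<kappa> t s) has_real_derivative \<kappa>t t s) (at t within {s..T})"
    "C_diff_on (Suc j) (triangle T) (\<lambda>(t, s). \<kappa>t t s)"
    using C_diff_on_kernel_partials[OF Suc.prems(1)] by metis
  obtain B where B: "lipschitz_kernel T B \<kappa>" using C_diff_on_imp_lipschitz_kernel[OF Suc.prems(1)] .
  obtain B' where B': "lipschitz_kernel T B' \<kappa>t" using C_diff_on_imp_lipschitz_kernel[OF d(2)] .
  have yj: "C_diff_on j {0..T} y" using Suc.prems(2) by simp
  have y: "continuous_on {0..T} y" by (rule C_diff_on_imp_continuous_on[OF yj])
  have "C_diff_on j {0..T} (\<lambda>t. \<kappa> t t * y t + integral {0..t} (\<lambda>s. \<kappa>t t s * y s))"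
  proof (intro C_diff_on_add C_diff_on_mult yj Suc.IH d(2) C_diff_on_le[OF yj])
    have "C_diff_on (Suc (Suc j)) {0..T} (\<lambda>t. \<kappa> t t)" using C_diff_on_diagonal[OF Suc.prems(1)] by simp
    then show "C_diff_on j {0..T} (\<lambda>t. \<kappa> t t)" by (rule C_diff_on_le) simp
  qed simp
  then show ?case unfolding C_diff_on_Suc_real
    using volterra_integral_has_derivative[OF B B' d(1) y] by (intro exI conjI ballI)
qed

text \<open>Differentiating the equation once gives the second-kind form \<open>g' t = k t t * y t +
  integral {0..t} (\<lambda>s. kt t s * y s)\<close>. Solved for \<open>y\<close>, its right-hand
  side is one order smoother than \<open>y\<close>, so the order of \<open>y\<close> can be raised
  step by step until \<open>g'\<close> limits it.\<close>

lemma volterra_solution_C_diff_on: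
  assumes T: "0 < T" and g: "C_diff_on (Suc (Suc n)) {0..T} g" and k: "C_diff_on (Suc (Suc (Suc n))) (triangle T) (\<lambda>(t, s). k t s)"
    and nz: "\<And>t. t \<in> {0..T} \<Longrightarrow> k t t \<noteq> 0" and sol: "volterra_solution T k g y"
  shows "C_diff_on (Suc n) {0..T} y"
proof -
  obtain kt ks where d: "\<And>t s. (t, s) \<in> triangle T \<Longrightarrow> ((\<lambda>t. k t s) has_real_derivative kt t s) (at t within {s..T})"
    "C_diff_on (Suc (Suc n)) (triangle T) (\<lambda>(t, s). kt t s)"
    using C_diff_on_kernel_partials[OF k] by metis
  obtain B where B: "lipschitz_kernel T B k" using C_diff_on_imp_lipschitz_kernel[OF k] .
  obtain B' where B': "lipschitz_kernel T B' kt" using C_diff_on_imp_lipschitz_kernel[OF d(2)] .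
  have y: "continuous_on {0..T} y" and eq: "\<And>t. t \<in> {0..T} \<Longrightarrow> g t = integral {0..t} (\<lambda>s. k t s * y s)"
    using sol by (auto simp: volterra_solution_def)
  obtain g' where g': "\<And>t. t \<in> {0..T} \<Longrightarrow> (g has_real_derivative g' t) (at t within {0..T})" "C_diff_on (Suc n) {0..T} g'"
    using g unfolding C_diff_on_Suc_real[of "Suc n"] by blast
  have g'_eq: "g' t = k t t * y t + integral {0..t} (\<lambda>s. kt t s * y s)" if t: "t \<in> {0..T}" for t
  proof -
    have "(g has_real_derivative k t t * y t + integral {0..t} (\<lambda>s. kt t s * y s)) (at t within {0..T})"
      using volterra_integral_has_derivative[OF B B' d(1) y t] unfolding has_field_derivative_def
      by (rule has_derivative_transform[rotated 2]) (use eq t in auto)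
    then show ?thesis using g'(1)[OF t] T t
      by (intro vector_derivative_unique_within_closed_interval[of 0 T t g])
         (simp_all add: has_real_derivative_iff_has_vector_derivative)
  qed
  have y_eq: "y t = (g' t - integral {0..t} (\<lambda>s. kt t s * y s)) * inverse (k t t)" if "t \<in> {0..T}" for t
    using g'_eq[OF that] nz[OF that] by simp
  have K: "C_diff_on (Suc (Suc (Suc n))) {0..T} (\<lambda>t. k t t)" using C_diff_on_diagonal[OF k] by simp
  have "C_diff_on j {0..T} y" if "j \<le> Suc n" for j
    using that
  proof (induction j)
    case 0
    then show ?case using y by simp
  next
    case (Suc j)
    have "C_diff_on (Suc j) {0..T} (\<lambda>t. (g' t - integral {0..t} (\<lambda>s. kt t s * y s)) * inverse (k t t))"
      using Suc
      by (intro C_diff_on_mult C_diff_on_diff C_diff_on_le[OF g'(2)] C_diff_on_inverse nz C_diff_on_le[OF K]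
          C_diff_on_volterra_integral C_diff_on_le[OF d(2)]) auto
    moreover have "C_diff_on (Suc j) {0..T} y \<longleftrightarrow>
        C_diff_on (Suc j) {0..T} (\<lambda>t. (g' t - integral {0..t} (\<lambda>s. kt t s * y s)) * inverse (k t t))"
      by (rule C_diff_on_cong) (rule y_eq)
    ultimately show ?case by blast
  qed
  from this[OF order_refl] show ?thesis .
qed

text \<open>Unrolls the nested existential quantifiers into one sequence of derivatives, as Taylor's
  formula requires.\<close>

lemma C_diff_on_derivative_sequence:
  fixes S :: "real set"
  assumes "C_diff_on n S f"
  obtains D where "D 0 = f"
    "\<And>i t. i < n \<Longrightarrow> t \<in> S \<Longrightarrow> (D i has_real_derivative D (Suc i) t) (at t within S)"
    "\<And>i. i \<le> n \<Longrightarrow> continuous_on S (D i)"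
  using assms
proof (induction n arbitrary: f thesis)
  case 0
  show ?case by (rule 0(1)[of "\<lambda>_. f"]) (use 0(2) in auto)
next
  case (Suc n)
  obtain f' where f': "\<And>x. x\<in>S \<Longrightarrow> (f has_real_derivative f' x) (at x within S)" "C_diff_on n S f'"
    using Suc.prems(2) unfolding C_diff_on_Suc_real by blast
  obtain D where D: "D 0 = f'"
    "\<And>i t. i < n \<Longrightarrow> t \<in> S \<Longrightarrow> (D i has_real_derivative D (Suc i) t) (at t within S)"
    "\<And>i. i \<le> n \<Longrightarrow> continuous_on S (D i)" using Suc.IH[OF _ f'(2)] by blast
  show ?case
  proof (rule Suc.prems(1)[of "case_nat f D"])
    show "(case_nat f D i has_real_derivative case_nat f D (Suc i) t) (at t within S)" if "i < Suc n" "t \<in> S" for i t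
      using f' D that by (cases i) auto
    show "continuous_on S (case_nat f D i)" if "i \<le> Suc n" for i
      using D(3) that C_diff_on_imp_continuous_on[OF Suc.prems(2)] by (cases i) auto
  qed simp
qed

section \<open>Piecewise approximation of the solution\<close>

lemma has_integral_abs_le:
  fixes f :: "real \<Rightarrow> real"
  assumes "(f has_integral i) {a..b}" "a \<le> b" "0 \<le> B" "\<And>x. x \<in> {a..b} \<Longrightarrow> \<bar>f x\<bar> \<le> B"
  shows "\<bar>i\<bar> \<le> B * (b - a)"
  using has_integral_bound_real[of B "{}" f i a b] assms by simp

text \<open>\<open>\<Psi>\<close> is a free profile. Its third condition says that
  \<open>pderiv \<Psi>\<close> is \<open>x ^ m\<close> up to lower degree, so the Taylor term of
  degree \<open>m\<close> can be traded for the profile and the difference goes into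
  \<open>q\<close>. The zeros of \<open>\<Psi>\<close> at \<open>0\<close> and \<open>1\<close> give
  the profile mean zero, so a constant of order \<open>h ^ (m + 1)\<close> is enough to make the
  defect mean zero.\<close>

lemma cell_approximation:
  fixes D :: "nat \<Rightarrow> real \<Rightarrow> real" and \<Psi> :: "real poly"
  assumes m: "m \<ge> 1"
    and deriv: "\<forall>i\<le>m. \<forall>t\<in>{0..T}. (D i has_real_derivative D (Suc i) t) (at t within {0..T})"
    and cont: "\<forall>i\<le>Suc m. continuous_on {0..T} (D i)"
    and \<Psi>: "poly \<Psi> 0 = 0" "poly \<Psi> 1 = 0" "degree (monom 1 m - pderiv \<Psi>) \<le> m - 1"
  shows "\<exists>C\<ge>0. \<forall>a h. 0 < h \<longrightarrow> 0 \<le> a \<longrightarrow> a + h \<le> T \<longrightarrow>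
    (\<exists>q. degree q \<le> m - 1 \<and> integral {a..a + h} (\<lambda>t. D 0 t - poly q t) = 0 \<and>
      (\<forall>t\<in>{a..a + h}. \<bar>D 0 t - poly q t - h ^ m * (D m a / fact m) * poly (pderiv \<Psi>) ((t - a) / h)\<bar> \<le> C * h ^ Suc m))"
proof -
  obtain C0 where C0: "0 \<le> C0" "\<And>t. t \<in> {0..T} \<Longrightarrow> \<bar>D (Suc m) t\<bar> \<le> C0"
    using bounded_on_Icc[OF cont[rule_format, OF order_refl]] by blast
  define \<zeta> where "\<zeta> = monom 1 m - pderiv \<Psi>"
  have *: "\<exists>q. degree q \<le> m - 1 \<and> integral {a..a + h} (\<lambda>t. D 0 t - poly q t) = 0 \<and>
      (\<forall>t\<in>{a..a + h}. \<bar>D 0 t - poly q t - h ^ m * (D m a / fact m) * poly (pderiv \<Psi>) ((t - a) / h)\<bar> \<le> 2 * C0 * h ^ Suc m)"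
    if h: "0 < h" and a: "0 \<le> a" "a + h \<le> T" for a h
  proof -
    define A where "A = D m a / fact m"
    \<comment> \<open>The Taylor polynomial of degree below \<open>m\<close>, plus the lower-degree
      difference \<open>\<zeta>\<close> between \<open>x ^ m\<close> and the profile, scaled to the
      cell.\<close>
    define q0 where "q0 = (\<Sum>i<m. smult (D i a / fact i) ([:-a, 1:] ^ i)) + smult (h ^ m * A) (pcompose \<zeta> [:-a / h, 1 / h:])"
    define \<rho> where "\<rho> t = D 0 t - poly q0 t - h ^ m * A * poly (pderiv \<Psi>) ((t - a) / h)" for t
    have cD: "continuous_on {a..a + h} (D i)" if "i \<le> Suc m" for i
      using a by (intro continuous_on_subset[OF cont[rule_format, OF that]]) auto
    have \<rho>: "\<bar>\<rho> t\<bar> \<le> C0 * h ^ Suc m" if t: "t \<in> {a..a + h}" for t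
    proof -
      have "((\<lambda>x. ((t - x) ^ (Suc m - 1) / fact (Suc m - 1)) *\<^sub>R D (Suc m) x) has_integral
          D 0 t - (\<Sum>i<Suc m. ((t - a) ^ i / fact i) *\<^sub>R D i a)) {a..t}"
      proof (rule Taylor_has_integral)
        fix i x assume "i < Suc m" "a \<le> x" "x \<le> t"
        then have "(D i has_real_derivative D (Suc i) x) (at x within {a..t})"
          using t a by (intro DERIV_subset[OF deriv[rule_format]]) auto
        then show "(D i has_vector_derivative D (Suc i) x) (at x within {a..t})"
          by (simp only: has_real_derivative_iff_has_vector_derivative)
      qed (use t in auto)
      moreover have "poly q0 t + h ^ m * A * poly (pderiv \<Psi>) ((t - a) / h) = (\<Sum>i<Suc m. ((t - a) ^ i / fact i) *\<^sub>R D i a)"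
      proof -
        have "h ^ m * ((t - a) / h) ^ m = (t - a) ^ m" using h by (simp add: power_divide)
        moreover have "poly q0 t = (\<Sum>i<m. ((t - a) ^ i / fact i) * D i a) +
            h ^ m * A * (((t - a) / h) ^ m - poly (pderiv \<Psi>) ((t - a) / h))"
          using h by (simp add: q0_def \<zeta>_def poly_sum poly_pcompose poly_monom diff_divide_distrib mult.commute)
        ultimately show ?thesis by (simp add: A_def algebra_simps)
      qed
      ultimately have I: "((\<lambda>x. (t - x) ^ m / fact m * D (Suc m) x) has_integral \<rho> t) {a..t}"
        by (simp add: \<rho>_def algebra_simps)
      have "\<bar>\<rho> t\<bar> \<le> (h ^ m * C0) * (t - a)"
      proof (rule has_integral_abs_le[OF I])
        fix x assume x: "x \<in> {a..t}"
        have "(t - x) ^ m / fact m \<le> (t - x) ^ m / 1"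
          using x by (intro divide_left_mono) (auto simp: fact_ge_1)
        also have "\<dots> \<le> h ^ m" using x t by (simp add: power_mono)
        finally have "\<bar>(t - x) ^ m / fact m\<bar> \<le> h ^ m" using x by simp
        moreover have "\<bar>D (Suc m) x\<bar> \<le> C0" using C0(2)[of x] x t a by auto
        ultimately show "\<bar>(t - x) ^ m / fact m * D (Suc m) x\<bar> \<le> h ^ m * C0"
          unfolding abs_mult using h by (intro mult_mono) auto
      qed (use t h C0(1) in auto)
      also have "\<dots> \<le> (h ^ m * C0) * h" using t h C0(1) by (intro mult_left_mono) auto
      finally show ?thesis by (simp add: algebra_simps)
    qed
    have c\<rho>: "continuous_on {a..a + h} \<rho>" unfolding \<rho>_def using h by (intro continuous_intros cD) auto
    \<comment> \<open>As the profile has mean zero, \<open>c\<close> is the mean of the Taylor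
      remainder \<open>\<rho>\<close> and obeys the same bound; hence the factor \<open>2\<close> in
      the final constant.\<close>
    define c where "c = integral {a..a + h} (\<lambda>t. D 0 t - poly q0 t) / h"
    have "integral {a..a + h} (\<lambda>t. h ^ m * A * poly (pderiv \<Psi>) ((t - a) / h)) = 0"
      using h integral_unique[OF has_integral_pderiv[of 0 1 \<Psi>]] \<Psi>
      by (subst integral_affine) (auto intro!: continuous_intros)
    moreover have "integral {a..a + h} (\<lambda>t. D 0 t - poly q0 t) =
        integral {a..a + h} \<rho> + integral {a..a + h} (\<lambda>t. h ^ m * A * poly (pderiv \<Psi>) ((t - a) / h))"
      using h by (subst Henstock_Kurzweil_Integration.integral_add[symmetric])
        (auto intro!: integrable_continuous_real continuous_intros c\<rho> simp: \<rho>_def)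
    ultimately have "h * c = integral {a..a + h} \<rho>" using h by (simp add: c_def)
    moreover have "norm (integral {a..a + h} \<rho>) \<le> (C0 * h ^ Suc m) * ((a + h) - a)"
      using h \<rho> by (intro integral_bound c\<rho>) auto
    ultimately have "\<bar>h * c\<bar> \<le> h * (C0 * h ^ Suc m)" by (simp add: mult.commute)
    then have "h * \<bar>c\<bar> \<le> h * (C0 * h ^ Suc m)" using h by (simp only: abs_mult abs_of_pos)
    then have c: "\<bar>c\<bar> \<le> C0 * h ^ Suc m" using h by (rule mult_left_le_imp_le)
    define q where "q = q0 + [:c:]"
    show ?thesis
    proof (intro exI[of _ q] conjI ballI)
      have "degree ([:-a, 1:] ^ i) \<le> m - 1" if "i < m" for i
        using that degree_power_le[of "[:-a, 1:]" i] by simp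
      then show "degree q \<le> m - 1" unfolding q_def q0_def
        using \<Psi>(3) degree_pcompose_linear_le[of \<zeta> "-a / h" "1 / h"]
        by (intro degree_add_le degree_sum_le order_trans[OF degree_smult_le]) (auto simp: \<zeta>_def)
      have "integral {a..a + h} (\<lambda>t. D 0 t - poly q t) = integral {a..a + h} (\<lambda>t. D 0 t - poly q0 t) - integral {a..a + h} (\<lambda>t. c)"
        using h cD[of 0]
        by (subst Henstock_Kurzweil_Integration.integral_diff[symmetric])
           (auto intro!: integrable_continuous_real continuous_intros simp: q_def algebra_simps)
      then show "integral {a..a + h} (\<lambda>t. D 0 t - poly q t) = 0" using h by (simp add: c_def)
      fix t assume t: "t \<in> {a..a + h}"
      have "D 0 t - poly q t - h ^ m * (D m a / fact m) * poly (pderiv \<Psi>) ((t - a) / h) = \<rho> t - c"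
        by (simp add: \<rho>_def q_def A_def)
      then show "\<bar>D 0 t - poly q t - h ^ m * (D m a / fact m) * poly (pderiv \<Psi>) ((t - a) / h)\<bar> \<le> 2 * C0 * h ^ Suc m"
        using \<rho>[OF t] c by simp
    qed
  qed
  show ?thesis by (rule exI[of _ "2 * C0"]) (use * C0(1) in simp)
qed

definition cell_index :: "real \<Rightarrow> nat \<Rightarrow> real \<Rightarrow> nat" where
  "cell_index T N t = (LEAST j. t \<le> node T N (Suc j))"

lemma cell_index_eq:
  assumes "0 \<le> T" "node T N n < t" "t \<le> node T N (Suc n)"
  shows "cell_index T N t = n"
  unfolding cell_index_def
proof (rule Least_equality)
  show "n \<le> j" if "t \<le> node T N (Suc j)" for j
    using node_mono[OF assms(1), of "Suc j" n N] that assms by (force simp: not_le Suc_le_eq)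
qed (rule assms(3))

text \<open>\<open>f\<close> is unconstrained at the nodes, a finite set that integration does not
  see. Each \<open>c n\<close> is continuous on its closed cell, so it describes the primitive up to
  both ends. The lemma serves both for \<open>y - q\<close> and for the discontinuous error
  \<open>y - yh\<close>.\<close>

lemma piecewise_antiderivative:
  fixes f :: "real \<Rightarrow> real"
  assumes T: "0 < T" and N: "0 < N"
    and c: "\<And>n. n < N \<Longrightarrow> continuous_on {node T N n..node T N (Suc n)} (c n)"
    and f: "\<And>n t. n < N \<Longrightarrow> t \<in> {node T N n<..<node T N (Suc n)} \<Longrightarrow> f t = c n t"
  obtains F where "continuous_on {0..T} F" "F 0 = 0"
    "\<And>s. s \<in> {0<..<T} - node T N ` {..N} \<Longrightarrow> (F has_real_derivative f s) (at s)"
    "\<And>n t. n < N \<Longrightarrow> t \<in> {node T N n..node T N (Suc n)} \<Longrightarrow> F t = F (node T N n) + integral {node T N n..t} (c n)"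
proof -
  define F where "F t = integral {0..t} f" for t
  have T0: "0 \<le> T" using T by simp
  have mono: "node T N n \<le> node T N (Suc n)" for n using node_mono[OF T0] by simp
  have cell: "f integrable_on {node T N n..t}" "integral {node T N n..t} f = integral {node T N n..t} (c n)"
    if n: "n < N" and t: "t \<in> {node T N n..node T N (Suc n)}" for n t
  proof -
    have eq: "f x = c n x" if "x \<in> {node T N n..t} - {node T N n, node T N (Suc n)}" for x
      using that t by (intro f n) auto
    have "c n integrable_on {node T N n..t}"
      using t by (intro integrable_continuous_real continuous_on_subset[OF c[OF n]]) auto
    then show "f integrable_on {node T N n..t}"
      by (rule integrable_spike_finite[rotated 2, where S = "{node T N n, node T N (Suc n)}"]) (use eq in auto)
    show "integral {node T N n..t} f = integral {node T N n..t} (c n)"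
      by (rule integral_spike[OF negligible_finite[of "{node T N n, node T N (Suc n)}"]]) (use eq in auto)
  qed
  have "f integrable_on {0..node T N n}" if "n \<le> N" for n
    using that
  proof (induction n)
    case 0
    show ?case using integrable_on_refl[of f "0::real"] by (simp add: node_simps)
  next
    case (Suc n)
    show ?case
      by (rule Henstock_Kurzweil_Integration.integrable_combine[of _ "node T N n"])
         (use Suc cell[of n "node T N (Suc n)"] mono[of n] node_nonneg[OF T0] in auto)
  qed
  from this[of N] have int: "f integrable_on {0..T}" using N by (simp add: node_simps)
  have piece: "F t = F (node T N n) + integral {node T N n..t} (c n)"
    if n: "n < N" and t: "t \<in> {node T N n..node T N (Suc n)}" for n t
  proof -
    have "t \<le> T" using t node_le[OF T0, of "Suc n" N] n by auto
    then have "F (node T N n) + integral {node T N n..t} f = F t"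
      unfolding F_def using t node_nonneg[OF T0, of N n]
      by (intro Henstock_Kurzweil_Integration.integral_combine integrable_on_subinterval[OF int]) auto
    then show ?thesis using cell(2)[OF n t] by simp
  qed
  show thesis
  proof (rule that[of F])
    show "continuous_on {0..T} F" unfolding F_def by (rule indefinite_integral_continuous_1[OF int])
    show "F 0 = 0" by (simp add: F_def)
    show "F t = F (node T N n) + integral {node T N n..t} (c n)"
      if "n < N" "t \<in> {node T N n..node T N (Suc n)}" for n t using piece[OF that] .
    fix s assume s: "s \<in> {0<..<T} - node T N ` {..N}"
    have "s \<le> node T N (Suc (N - 1))" using s N by (simp add: node_simps del: node_simps(2))
    then obtain n where n: "n \<le> N - 1" "s \<in> {node T N n..node T N (Suc n)}"
      using in_some_cell[of s T N "N - 1"] s by auto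
    have nN: "n < N" using n N by simp
    have s': "s \<in> {node T N n<..<node T N (Suc n)}"
      using n s nN by (auto simp: less_le)
    have "((\<lambda>t. integral {node T N n..t} (c n)) has_real_derivative c n s) (at s within {node T N n..node T N (Suc n)})"
      using integral_has_real_derivative[OF c[OF nN] n(2)] .
    then have "((\<lambda>t. F (node T N n) + integral {node T N n..t} (c n)) has_real_derivative f s) (at s)"
      using s' f[OF nN s'] by (auto intro!: derivative_eq_intros simp: at_within_Icc_at)
    then show "(F has_real_derivative f s) (at s)"
    proof (rule has_field_derivative_transform_within_open[of _ _ _ "{node T N n<..<node T N (Suc n)}"])
      show "F (node T N n) + integral {node T N n..x} (c n) = F x" if "x \<in> {node T N n<..<node T N (Suc n)}" for x
        using that by (intro piece[OF nN, symmetric]) auto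
    qed (use s' in auto)
  qed
qed

text \<open>Because of the zero mean, \<open>R\<close> returns to \<open>0\<close> at every node:
  the defect of size \<open>h ^ m\<close> is integrated over at most one cell and gains a factor
  \<open>h\<close> instead of accumulating. The same integration turns the profile
  \<open>pderiv \<Psi>\<close> into \<open>\<Psi>\<close>.\<close>

lemma defect_antiderivative:
  fixes D :: "nat \<Rightarrow> real \<Rightarrow> real" and \<Psi> :: "real poly"
  assumes T: "0 < T" and m: "m \<ge> 1"
    and deriv: "\<forall>i\<le>m. \<forall>t\<in>{0..T}. (D i has_real_derivative D (Suc i) t) (at t within {0..T})"
    and cont: "\<forall>i\<le>Suc m. continuous_on {0..T} (D i)"
    and \<Psi>: "poly \<Psi> 0 = 0" "poly \<Psi> 1 = 0" "degree (monom 1 m - pderiv \<Psi>) \<le> m - 1"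
  shows "\<exists>C\<ge>0. \<forall>N>0. \<exists>q R. (\<forall>n<N. degree (q n) \<le> m - 1) \<and>
    (\<forall>n<N. \<forall>t\<in>{node T N n..node T N (Suc n)}. \<bar>D 0 t - poly (q n) t\<bar> \<le> C * mesh_size T N ^ m) \<and>
    continuous_on {0..T} R \<and> R 0 = 0 \<and>
    (\<forall>n<N. \<forall>t\<in>{node T N n..node T N (Suc n)}.
       R t = R (node T N n) + integral {node T N n..t} (\<lambda>x. D 0 x - poly (q n) x)) \<and>
    (\<forall>n<N. \<forall>t\<in>{node T N n..node T N (Suc n)}. \<bar>R t\<bar> \<le> C * mesh_size T N ^ (m + 1) \<and>
       \<bar>R t - mesh_size T N ^ (m + 1) * (D m (node T N n) / fact m) * poly \<Psi> ((t - node T N n) / mesh_size T N)\<bar>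
         \<le> C * mesh_size T N ^ (m + 2))"
proof -
  obtain C where C: "C \<ge> 0" "\<And>a h. 0 < h \<Longrightarrow> 0 \<le> a \<Longrightarrow> a + h \<le> T \<Longrightarrow>
    (\<exists>q. degree q \<le> m - 1 \<and> integral {a..a + h} (\<lambda>t. D 0 t - poly q t) = 0 \<and>
      (\<forall>t\<in>{a..a + h}. \<bar>D 0 t - poly q t - h ^ m * (D m a / fact m) * poly (pderiv \<Psi>) ((t - a) / h)\<bar> \<le> C * h ^ Suc m))"
    using cell_approximation[where T = T and D = D, OF m deriv cont \<Psi>] by blast
  obtain M1 where M1: "M1 \<ge> 0" "\<And>t. t \<in> {0..T} \<Longrightarrow> \<bar>D m t / fact m\<bar> \<le> M1"
  proof -
    have "continuous_on {0..T} (\<lambda>t. D m t / fact m)" using cont[rule_format, of m] by (intro continuous_intros) auto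
    then show thesis using bounded_on_Icc that by blast
  qed
  obtain M2 where M2: "M2 \<ge> 0" "\<And>x. x \<in> {0..1} \<Longrightarrow> \<bar>poly (pderiv \<Psi>) x\<bar> \<le> M2"
  proof -
    have "continuous_on {0..1} (poly (pderiv \<Psi>))" by (intro continuous_intros)
    then show thesis using bounded_on_Icc that by blast
  qed
  \<comment> \<open>\<open>M1 * M2\<close> bounds the profile term; the remainder of order
    \<open>h ^ (m + 1)\<close> is reduced to \<open>h ^ m\<close> by
    \<open>h \<le> T\<close>.\<close>
  define E where "E = C * T + M1 * M2"
  have E: "E \<ge> 0" using C M1 M2 T by (simp add: E_def)
  have T0: "0 \<le> T" using T by simp
  have "\<exists>q R. (\<forall>n<N. degree (q n) \<le> m - 1) \<and>
    (\<forall>n<N. \<forall>t\<in>{node T N n..node T N (Suc n)}. \<bar>D 0 t - poly (q n) t\<bar> \<le> (E + C) * mesh_size T N ^ m) \<and>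
    continuous_on {0..T} R \<and> R 0 = 0 \<and>
    (\<forall>n<N. \<forall>t\<in>{node T N n..node T N (Suc n)}.
       R t = R (node T N n) + integral {node T N n..t} (\<lambda>x. D 0 x - poly (q n) x)) \<and>
    (\<forall>n<N. \<forall>t\<in>{node T N n..node T N (Suc n)}. \<bar>R t\<bar> \<le> (E + C) * mesh_size T N ^ (m + 1) \<and>
       \<bar>R t - mesh_size T N ^ (m + 1) * (D m (node T N n) / fact m) * poly \<Psi> ((t - node T N n) / mesh_size T N)\<bar>
         \<le> (E + C) * mesh_size T N ^ (m + 2))" if N: "N > 0" for N
  proof -
    define h where "h = mesh_size T N"
    have h: "0 < h" using T N by (simp add: h_def mesh_size_def)
    have hT: "h \<le> T" using T N by (simp add: h_def mesh_size_def divide_le_eq)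
    have node_Suc: "node T N (Suc n) = node T N n + h" for n by (simp add: h_def node_simps)
    have nodes: "0 \<le> node T N n" "node T N n + h \<le> T" if "n < N" for n
      using node_le[of T "Suc n" N] node_nonneg[of T N n] T that by (auto simp: node_simps h_def)
    have "\<forall>n\<in>{..<N}. \<exists>q. degree q \<le> m - 1 \<and> integral {node T N n..node T N n + h} (\<lambda>t. D 0 t - poly q t) = 0 \<and>
      (\<forall>t\<in>{node T N n..node T N n + h}. \<bar>D 0 t - poly q t - h ^ m * (D m (node T N n) / fact m) * poly (pderiv \<Psi>) ((t - node T N n) / h)\<bar> \<le> C * h ^ Suc m)"
      using C(2)[OF h] nodes by auto
    from bchoice[OF this] obtain q where q: "\<forall>n\<in>{..<N}. degree (q n) \<le> m - 1 \<and> integral {node T N n..node T N n + h} (\<lambda>t. D 0 t - poly (q n) t) = 0 \<and>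
      (\<forall>t\<in>{node T N n..node T N n + h}. \<bar>D 0 t - poly (q n) t - h ^ m * (D m (node T N n) / fact m) * poly (pderiv \<Psi>) ((t - node T N n) / h)\<bar> \<le> C * h ^ Suc m)"
      by blast
    have cD: "continuous_on {node T N n..node T N n + h} (D 0)" if "n < N" for n
      using nodes[OF that] by (intro continuous_on_subset[OF cont[rule_format, of 0]]) auto
    define f where "f t = D 0 t - poly (q (cell_index T N t)) t" for t
    have c: "continuous_on {node T N n..node T N (Suc n)} (\<lambda>x. D 0 x - poly (q n) x)" if "n < N" for n
      using cD[OF that] by (auto simp: node_Suc intro!: continuous_intros)
    have f: "f t = D 0 t - poly (q n) t" if "n < N" "t \<in> {node T N n<..<node T N (Suc n)}" for n t
      using cell_index_eq[OF T0, of N n t] that by (simp add: f_def)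
    obtain R where R: "continuous_on {0..T} R" "R 0 = 0"
      "\<And>s. s \<in> {0<..<T} - node T N ` {..N} \<Longrightarrow> (R has_real_derivative f s) (at s)"
      "\<And>n t. n < N \<Longrightarrow> t \<in> {node T N n..node T N (Suc n)} \<Longrightarrow> R t = R (node T N n) + integral {node T N n..t} (\<lambda>x. D 0 x - poly (q n) x)"
    proof (rule piecewise_antiderivative[OF T N c f])
      fix F assume F: "continuous_on {0..T} F" "F 0 = 0"
        "\<And>s. s \<in> {0<..<T} - node T N ` {..N} \<Longrightarrow> (F has_real_derivative f s) (at s)"
        "\<And>n t. n < N \<Longrightarrow> t \<in> {node T N n..node T N (Suc n)} \<Longrightarrow> F t = F (node T N n) + integral {node T N n..t} (\<lambda>x. D 0 x - poly (q n) x)"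
      show thesis by (rule that) (fact F)+
    qed
    have R3: "R t = R (node T N n) + integral {node T N n..t} (\<lambda>x. D 0 x - poly (q n) x)"
      if "n < N" "t \<in> {node T N n..node T N n + h}" for n t using R(4)[of n t] that by (simp add: node_Suc)
    have R0: "R (node T N n) = 0" if "n \<le> N" for n
      using that
    proof (induction n)
      case 0
      then show ?case using R by (simp add: node_simps)
    next
      case (Suc n)
      then show ?case using R3[of n "node T N n + h"] q h by (simp add: node_Suc)
    qed
    have A: "\<bar>D m (node T N n) / fact m\<bar> \<le> M1" if "n < N" for n
      using nodes[OF that] h by (intro M1(2)) auto
    have r: "\<bar>D 0 t - poly (q n) t\<bar> \<le> E * h ^ m" if n: "n < N" and t: "t \<in> {node T N n..node T N n + h}" for n t
    proof -
      have "\<bar>poly (pderiv \<Psi>) ((t - node T N n) / h)\<bar> \<le> M2" using t h by (intro M2(2)) (auto simp: field_simps)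
      then have "\<bar>h ^ m * (D m (node T N n) / fact m) * poly (pderiv \<Psi>) ((t - node T N n) / h)\<bar> \<le> h ^ m * M1 * M2"
        unfolding abs_mult using A[OF n] h M1 M2 by (intro mult_mono) auto
      moreover have "\<bar>D 0 t - poly (q n) t - h ^ m * (D m (node T N n) / fact m) * poly (pderiv \<Psi>) ((t - node T N n) / h)\<bar> \<le> C * h ^ Suc m"
        using q n t by blast
      moreover have "C * h ^ Suc m \<le> C * (T * h ^ m)" using C hT h by (intro mult_left_mono) auto
      moreover have "E * h ^ m = C * (T * h ^ m) + h ^ m * M1 * M2" by (simp add: E_def algebra_simps)
      ultimately show ?thesis by linarith
    qed
    have C_int: "continuous_on {node T N n..t} (\<lambda>x. D 0 x - poly (q n) x)" if n: "n < N" and t: "t \<in> {node T N n..node T N n + h}" for n t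
      using t by (intro continuous_intros continuous_on_subset[OF cD[OF n]]) auto
    have main: "\<bar>R t\<bar> \<le> E * h ^ (m + 1) \<and> \<bar>R t - h ^ (m + 1) * (D m (node T N n) / fact m) * poly \<Psi> ((t - node T N n) / h)\<bar> \<le> C * h ^ (m + 2)"
      if n: "n < N" and t: "t \<in> {node T N n..node T N n + h}" for n t
    proof
      have Rt: "R t = integral {node T N n..t} (\<lambda>x. D 0 x - poly (q n) x)"
        using R3[OF n t] R0[of n] n by simp
      have "norm (R t) \<le> (E * h ^ m) * (t - node T N n)"
        unfolding Rt using t r[OF n] by (intro integral_bound C_int n) auto
      also have "\<dots> \<le> (E * h ^ m) * h" using t E h by (intro mult_left_mono) auto
      finally show "\<bar>R t\<bar> \<le> E * h ^ (m + 1)" by (simp add: algebra_simps)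
      define A where "A = D m (node T N n) / fact m"
      have "((\<lambda>x. h ^ m * A * poly (pderiv \<Psi>) ((x - node T N n) / h)) has_integral
          (h ^ (m + 1) * A * poly \<Psi> ((t - node T N n) / h) - h ^ (m + 1) * A * poly \<Psi> ((node T N n - node T N n) / h))) {node T N n..t}"
        using t h by (intro fundamental_theorem_of_calculus)
          (auto intro!: derivative_eq_intros simp: field_simps simp flip: has_real_derivative_iff_has_vector_derivative)
      then have I: "((\<lambda>x. h ^ m * A * poly (pderiv \<Psi>) ((x - node T N n) / h)) has_integral
          h ^ (m + 1) * A * poly \<Psi> ((t - node T N n) / h)) {node T N n..t}" using \<Psi> by simp
      have "((\<lambda>x. D 0 x - poly (q n) x) has_integral R t) {node T N n..t}"
        unfolding Rt by (intro integrable_integral integrable_continuous_real C_int n t)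
      from has_integral_diff[OF this I]
      have "\<bar>R t - h ^ (m + 1) * A * poly \<Psi> ((t - node T N n) / h)\<bar> \<le> (C * h ^ Suc m) * (t - node T N n)"
        by (rule has_integral_abs_le) (use q n t C h in \<open>auto simp: A_def\<close>)
      also have "\<dots> \<le> (C * h ^ Suc m) * h" using t C h by (intro mult_left_mono) auto
      finally show "\<bar>R t - h ^ (m + 1) * (D m (node T N n) / fact m) * poly \<Psi> ((t - node T N n) / h)\<bar> \<le> C * h ^ (m + 2)"
        by (simp add: A_def algebra_simps)
    qed
    have le: "E * h ^ i \<le> (E + C) * h ^ i" "C * h ^ i \<le> (E + C) * h ^ i" for i
      using E C h by (auto intro!: mult_right_mono)
    show ?thesis unfolding h_def[symmetric] node_Suc
    proof (intro exI[of _ q] exI[of _ R] conjI allI impI ballI)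
      fix n t assume n: "n < N" and t: "t \<in> {node T N n..node T N n + h}"
      show "\<bar>D 0 t - poly (q n) t\<bar> \<le> (E + C) * h ^ m" using r[OF n t] le(1)[of m] by linarith
      show "R t = R (node T N n) + integral {node T N n..t} (\<lambda>x. D 0 x - poly (q n) x)" by (rule R3[OF n t])
      show "\<bar>R t\<bar> \<le> (E + C) * h ^ (m + 1)" using main[OF n t] le(1)[of "m + 1"] by linarith
      show "\<bar>R t - h ^ (m + 1) * (D m (node T N n) / fact m) * poly \<Psi> ((t - node T N n) / h)\<bar> \<le> (E + C) * h ^ (m + 2)"
        using main[OF n t] le(2)[of "m + 2"] by linarith
    qed (use q R(1,2) in auto)
  qed
  then show ?thesis using E C(1) by (intro exI[of _ "E + C"] conjI allI impI) simp_all
qed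

section \<open>The error of the perturbed scheme\<close>

context volterra_kernel
begin

text \<open>\<open>q\<close> approximates \<open>y\<close> with error \<open>\<beta>\<close>, \<open>R\<close> is the primitive of the defect, and \<open>d\<close> is the Lipschitz part of its
  residual; the rest of the residual is of size \<open>e\<close>, but only when tested against polynomials.\<close>

definition comparison ::
  "(real \<Rightarrow> real) \<Rightarrow> nat \<Rightarrow> nat \<Rightarrow> real \<Rightarrow> real \<Rightarrow> real \<Rightarrow> (nat \<Rightarrow> real poly) \<Rightarrow> (real \<Rightarrow> real) \<Rightarrow> (real \<Rightarrow> real) \<Rightarrow> bool"
where
  "comparison y m N \<beta> D e q R d \<longleftrightarrow>
     (\<forall>n<N. degree (q n) \<le> m - 1) \<and>
     (\<forall>n<N. \<forall>t\<in>{node T N n..node T N (Suc n)}. \<bar>y t - poly (q n) t\<bar> \<le> \<beta>) \<and>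
     continuous_on {0..T} R \<and> R 0 = 0 \<and>
     (\<forall>n<N. \<forall>t\<in>{node T N n..node T N (Suc n)}.
        R t = R (node T N n) + integral {node T N n..t} (\<lambda>x. y x - poly (q n) x)) \<and>
     \<bar>d 0\<bar> \<le> D \<and> (\<forall>t\<in>{0..T}. \<forall>t'\<in>{0..T}. \<bar>d t - d t'\<bar> \<le> D * \<bar>t - t'\<bar>) \<and>
     (\<forall>n<N. \<forall>\<phi>. degree \<phi> \<le> m - 1 \<longrightarrow>
        \<bar>integral {node T N n..node T N (Suc n)} (\<lambda>t. (k t t * R t - mem R t - d t) * poly \<phi> t)\<bar>
        \<le> e * integral {node T N n..node T N (Suc n)} (\<lambda>t. \<bar>poly \<phi> t\<bar>))"

text \<open>The first half-open cell omits \<open>0\<close>; there the value is identified through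
  uniqueness of the limit from the right.\<close>

lemma dg_space_pieces:
  assumes "0 < N" "v \<in> dg_space T N d"
  obtains p where "\<And>n. n < N \<Longrightarrow> degree (p n) \<le> d"
    "\<And>n t. n < N \<Longrightarrow> t \<in> {node T N n<..node T N (Suc n)} \<Longrightarrow> v t = poly (p n) t" "v 0 = poly (p 0) 0"
proof -
  have "\<forall>n\<in>{..<N}. \<exists>p. degree p \<le> d \<and> (\<forall>t\<in>{node T N n<..node T N (Suc n)}. v t = poly p t)"
    using assms by (auto simp: dg_space_def)
  from bchoice[OF this] obtain p where
    p: "\<forall>n\<in>{..<N}. degree (p n) \<le> d \<and> (\<forall>t\<in>{node T N n<..node T N (Suc n)}. v t = poly (p n) t)" by blast
  have pos: "0 < node T N 1" using T_pos assms by (simp add: node_def mesh_size_def)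
  have "eventually (\<lambda>t. v t = poly (p 0) t) (at_right 0)"
    unfolding eventually_at_right_field
    using pos p assms(1) by (intro exI[of _ "node T N 1"]) (auto simp: node_simps(1))
  moreover have "(poly (p 0) \<longlongrightarrow> poly (p 0) 0) (at_right 0)" by (intro tendsto_intros)
  ultimately have "(v \<longlongrightarrow> poly (p 0) 0) (at_right 0)" by (simp add: filterlim_cong)
  moreover have "(v \<longlongrightarrow> v 0) (at_right 0)" using assms by (simp add: dg_space_def)
  ultimately have "v 0 = poly (p 0) 0" using tendsto_unique trivial_limit_at_right_real by blast
  then show thesis using that[of p] p by auto
qed

text \<open>The scheme tests cell by cell, so global polynomials are sufficient as test
  functions.\<close>

lemma poly_in_dg_space: "degree \<phi> \<le> d \<Longrightarrow> poly \<phi> \<in> dg_space T N d"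
  unfolding dg_space_def by (auto intro!: exI[of _ \<phi>] tendsto_intros)

lemma mem_diff:
  assumes "continuous_on {0..T} F" "continuous_on {0..T} R" "t \<in> {0..T}"
  shows "mem (\<lambda>t. F t - R t) t = mem F t - mem R t"
proof -
  have "(\<lambda>s. ks t s * F s) integrable_on {0..t}" "(\<lambda>s. ks t s * R s) integrable_on {0..t}"
    using assms lipschitz_kernel_continuous[OF lipschitz_ks, of t]
    by (auto intro!: integrable_continuous_real continuous_intros elim!: continuous_on_subset)
  then show ?thesis unfolding mem_def
    by (simp add: Henstock_Kurzweil_Integration.integral_diff[symmetric] algebra_simps)
qed

text \<open>\<open>F\<close> is the primitive of the error \<open>y - yh\<close> and
  \<open>R\<close> that of the comparison defect, so \<open>F - R\<close> is a primitive of
  \<open>q - yh\<close> and piecewise polynomial. Its residual consists of the perturbation and of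
  the residual of \<open>R\<close>; stability bounds it, and the inverse estimate then returns to
  \<open>q - yh\<close>, which costs the last division by the mesh size.\<close>

theorem dg_error:
  assumes m: "m \<ge> 1" and g: "continuous_on {0..T} g" and sol: "volterra_solution T k g y"
  shows "\<exists>C>0. \<exists>h0>0. \<forall>N \<delta> yh \<Delta> \<beta> D e q R d. 0 < N \<longrightarrow> mesh_size T N < h0 \<longrightarrow> 0 \<le> D \<longrightarrow> 0 \<le> e \<longrightarrow>
    comparison y m N \<beta> D e q R d \<longrightarrow> perturbed_dg_solution T N m k g \<delta> yh \<longrightarrow>
    (\<forall>t\<in>{0..T}. \<bar>\<delta> t\<bar> \<le> \<Delta>) \<longrightarrow>
    (\<forall>t\<in>{0..T}. \<bar>y t - yh t\<bar> \<le> \<beta> + C * (D + (e + \<Delta>) / mesh_size T N) / mesh_size T N)"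
proof -
  obtain C1 h0 where C1: "C1 > 0" and h0: "h0 > 0"
    and stab: "\<forall>N P d D e. 0 < N \<longrightarrow> mesh_size T N < h0 \<longrightarrow> 0 \<le> D \<longrightarrow> 0 \<le> e \<longrightarrow>
     continuous_on {0..T} P \<longrightarrow> P 0 = 0 \<longrightarrow> \<bar>d 0\<bar> \<le> D \<longrightarrow>
     (\<forall>t\<in>{0..T}. \<forall>t'\<in>{0..T}. \<bar>d t - d t'\<bar> \<le> D * \<bar>t - t'\<bar>) \<longrightarrow>
     (\<forall>n<N. \<exists>Q. degree Q \<le> m \<and> (\<forall>t\<in>{node T N n..node T N (Suc n)}. P t = poly Q t)) \<longrightarrow>
     (\<forall>n<N. \<forall>\<phi>. degree \<phi> \<le> m - 1 \<longrightarrow>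
        \<bar>integral {node T N n..node T N (Suc n)} (\<lambda>t. (k t t * P t - mem P t - d t) * poly \<phi> t)\<bar>
        \<le> e * integral {node T N n..node T N (Suc n)} (\<lambda>t. \<bar>poly \<phi> t\<bar>)) \<longrightarrow>
     (\<forall>t\<in>{0..T}. \<bar>P t\<bar> \<le> C1 * (D + e / mesh_size T N))"
    using dg_stability[OF m] by blast
  obtain C2 where C2: "C2 > 0" and inv: "\<forall>(p::real poly) M a h. degree p \<le> m \<longrightarrow> h > 0 \<longrightarrow> (\<forall>x\<in>{a..a + h}. \<bar>poly p x\<bar> \<le> M) \<longrightarrow>
     (\<forall>x\<in>{a..a + h}. \<bar>poly (pderiv p) x\<bar> \<le> C2 * M / h)"
    using pderiv_inverse_estimate[of m] by blast
  have y: "continuous_on {0..T} y" and y_int: "\<And>t. t \<in> {0..T} \<Longrightarrow> integral {0..t} (\<lambda>s. k t s * y s) = g t"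
    using sol by (auto simp: volterra_solution_def)
  have "\<bar>y t - yh t\<bar> \<le> \<beta> + C2 * C1 * (D + (e + \<Delta>) / mesh_size T N) / mesh_size T N"
    if N: "0 < N" and small: "mesh_size T N < h0" and D: "0 \<le> D" and e: "0 \<le> e"
      and cmp: "comparison y m N \<beta> D e q R d" and dg: "perturbed_dg_solution T N m k g \<delta> yh"
      and \<delta>: "\<forall>t\<in>{0..T}. \<bar>\<delta> t\<bar> \<le> \<Delta>" and t: "t \<in> {0..T}" for N \<delta> yh \<Delta> \<beta> D e q R d t
  proof -
    define h where "h = mesh_size T N"
    have h: "h > 0" using T_pos N by (simp add: h_def mesh_size_def)
    have T0: "0 \<le> T" using T_pos by simp
    have sub: "{node T N n..node T N (Suc n)} \<subseteq> {0..T}" if "n < N" for n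
      using node_le[OF T0, of "Suc n" N] node_nonneg[OF T0, of N n] that by auto
    have \<Delta>0: "0 \<le> \<Delta>" using \<delta> T0 by (metis abs_ge_zero atLeastAtMost_iff order_refl order_trans)
    have q: "\<And>n. n < N \<Longrightarrow> degree (q n) \<le> m - 1"
      and \<beta>: "\<And>n t. n < N \<Longrightarrow> t \<in> {node T N n..node T N (Suc n)} \<Longrightarrow> \<bar>y t - poly (q n) t\<bar> \<le> \<beta>"
      and R: "continuous_on {0..T} R" "R 0 = 0"
      and R_cell: "\<And>n t. n < N \<Longrightarrow> t \<in> {node T N n..node T N (Suc n)} \<Longrightarrow>
        R t = R (node T N n) + integral {node T N n..t} (\<lambda>x. y x - poly (q n) x)"
      and d: "\<bar>d 0\<bar> \<le> D" "\<forall>t\<in>{0..T}. \<forall>t'\<in>{0..T}. \<bar>d t - d t'\<bar> \<le> D * \<bar>t - t'\<bar>"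
      and R_orth: "\<And>n \<phi>. n < N \<Longrightarrow> degree \<phi> \<le> m - 1 \<Longrightarrow>
        \<bar>integral {node T N n..node T N (Suc n)} (\<lambda>t. (k t t * R t - mem R t - d t) * poly \<phi> t)\<bar>
        \<le> e * integral {node T N n..node T N (Suc n)} (\<lambda>t. \<bar>poly \<phi> t\<bar>)"
      using cmp unfolding comparison_def by blast+
    have yh: "yh \<in> dg_space T N (m - 1)" and
      dg_eq: "\<And>\<phi> n. degree \<phi> \<le> m - 1 \<Longrightarrow> n < N \<Longrightarrow>
        integral {node T N n..node T N (Suc n)} (\<lambda>s. integral {0..s} (\<lambda>\<tau>. k s \<tau> * yh \<tau>) * poly \<phi> s) =
        integral {node T N n..node T N (Suc n)} (\<lambda>s. g s * poly \<phi> s) +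
        integral {node T N n..node T N (Suc n)} (\<lambda>s. \<delta> s * poly \<phi> s)"
      using dg poly_in_dg_space unfolding perturbed_dg_solution_def by blast+
    obtain qh where qh: "\<And>n. n < N \<Longrightarrow> degree (qh n) \<le> m - 1"
      "\<And>n t. n < N \<Longrightarrow> t \<in> {node T N n<..node T N (Suc n)} \<Longrightarrow> yh t = poly (qh n) t" "yh 0 = poly (qh 0) 0"
      using dg_space_pieces[OF N yh] by metis
    have cy: "continuous_on {node T N n..node T N (Suc n)} y" if "n < N" for n
      by (rule continuous_on_subset[OF y sub[OF that]])
    have c: "continuous_on {node T N n..node T N (Suc n)} (\<lambda>x. y x - poly (qh n) x)" if "n < N" for n
      by (intro continuous_intros cy that)
    have f: "y t - yh t = y t - poly (qh n) t" if "n < N" "t \<in> {node T N n<..<node T N (Suc n)}" for n t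
      using qh(2)[of n t] that by simp
    obtain F where F: "continuous_on {0..T} F" "F 0 = 0"
      "\<And>s. s \<in> {0<..<T} - node T N ` {..N} \<Longrightarrow> (F has_real_derivative y s - yh s) (at s)"
      "\<And>n t. n < N \<Longrightarrow> t \<in> {node T N n..node T N (Suc n)} \<Longrightarrow> F t = F (node T N n) + integral {node T N n..t} (\<lambda>x. y x - poly (qh n) x)"
    proof (rule piecewise_antiderivative[OF T_pos N c f])
      fix F assume F: "continuous_on {0..T} F" "F 0 = 0"
        "\<And>s. s \<in> {0<..<T} - node T N ` {..N} \<Longrightarrow> (F has_real_derivative y s - yh s) (at s)"
        "\<And>n t. n < N \<Longrightarrow> t \<in> {node T N n..node T N (Suc n)} \<Longrightarrow> F t = F (node T N n) + integral {node T N n..t} (\<lambda>x. y x - poly (qh n) x)"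
      show thesis by (rule that) (fact F)+
    qed
    define P where "P t = F t - R t" for t
    have P: "continuous_on {0..T} P" "P 0 = 0" unfolding P_def using F R by (auto intro!: continuous_intros)
    have P_poly: "\<exists>Q. degree Q \<le> m \<and> pderiv Q = q n - qh n \<and> (\<forall>t\<in>{node T N n..node T N (Suc n)}. P t = poly Q t)" if n: "n < N" for n
    proof -
      define a where "a = node T N n"
      obtain Q where Q: "pderiv Q = q n - qh n" "degree Q \<le> Suc (degree (q n - qh n))"
        using poly_antiderivative by blast
      have "degree (q n - qh n) \<le> m - 1" using q[OF n] qh(1)[OF n] by (intro degree_diff_le)
      then have degQ: "degree Q \<le> m" using Q(2) m by simp
      have "P t = poly (Q + [:P a - poly Q a:]) t" if t: "t \<in> {a..node T N (Suc n)}" for t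
      proof -
        have ci: "(\<lambda>x. y x - poly (qh n) x) integrable_on {a..t}" "(\<lambda>x. y x - poly (q n) x) integrable_on {a..t}"
          using t by (auto intro!: integrable_continuous_real continuous_intros continuous_on_subset[OF cy[OF n]] simp: a_def)
        have "P t = P a + (integral {a..t} (\<lambda>x. y x - poly (qh n) x) - integral {a..t} (\<lambda>x. y x - poly (q n) x))"
          using F(4)[OF n, of t] R_cell[OF n, of t] t unfolding P_def a_def by simp
        also have "integral {a..t} (\<lambda>x. y x - poly (qh n) x) - integral {a..t} (\<lambda>x. y x - poly (q n) x) =
            integral {a..t} (poly (pderiv Q))"
          unfolding Q by (subst Henstock_Kurzweil_Integration.integral_diff[symmetric, OF ci])
             (auto intro!: arg_cong[where f = "integral {a..t}"])
        also have "\<dots> = poly Q t - poly Q a" using t by (intro integral_unique has_integral_pderiv) auto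
        finally show ?thesis by simp
      qed
      moreover have "degree (Q + [:P a - poly Q a:]) \<le> m" using degQ by (intro degree_add_le) auto
      moreover have "pderiv (Q + [:P a - poly Q a:]) = q n - qh n" using Q by (simp add: pderiv_add)
      ultimately show ?thesis unfolding a_def by blast
    qed
    have cW: "continuous_on {0..T} (\<lambda>t. k t t * F t - mem F t)" "continuous_on {0..T} (\<lambda>t. k t t * R t - mem R t - d t)"
      by (intro continuous_intros diag_continuous F(1) R(1) mem_continuous continuous_on_real_lipschitz[of _ d D];
          use d(2) in auto)+
    \<comment> \<open>Integration by parts for \<open>y - yh\<close> together with the exact
      equation: tested by the scheme, the residual of \<open>F\<close> becomes
      \<open>- \<delta>\<close>.\<close>
    have V: "integral {0..s} (\<lambda>\<tau>. k s \<tau> * yh \<tau>) = g s - (k s s * F s - mem F s)" if s: "s \<in> {0..T}" for s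
    proof -
      have "((\<lambda>\<tau>. k s \<tau> * (y \<tau> - yh \<tau>)) has_integral (k s s * F s - mem F s)) {0..s}"
        by (rule integration_by_parts_kernel[OF F(1,2) _ F(3) s]) auto
      moreover have "((\<lambda>\<tau>. k s \<tau> * y \<tau>) has_integral g s) {0..s}"
      proof -
        have "continuous_on {0..s} (k s)"
          using s by (intro DERIV_continuous_on[OF has_derivative_snd]) auto
        then have "(\<lambda>\<tau>. k s \<tau> * y \<tau>) integrable_on {0..s}"
          using s by (intro integrable_continuous_real continuous_intros continuous_on_subset[OF y]) auto
        then show ?thesis using y_int[OF s] integrable_integral by metis
      qed
      ultimately have "((\<lambda>\<tau>. k s \<tau> * y \<tau> - k s \<tau> * (y \<tau> - yh \<tau>)) has_integral (g s - (k s s * F s - mem F s))) {0..s}"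
        by (rule has_integral_diff[rotated])
      then show ?thesis by (intro integral_unique) (simp add: algebra_simps)
    qed
    \<comment> \<open>The residual of \<open>R\<close> enters \<open>P = F - R\<close> with a minus
      sign, so the Lipschitz part to be subtracted is \<open>- d\<close>.\<close>
    have orth: "\<bar>integral {node T N n..node T N (Suc n)} (\<lambda>t. (k t t * P t - mem P t - - d t) * poly \<phi> t)\<bar>
        \<le> (e + \<Delta>) * integral {node T N n..node T N (Suc n)} (\<lambda>t. \<bar>poly \<phi> t\<bar>)" if n: "n < N" and \<phi>: "degree \<phi> \<le> m - 1" for n \<phi>
    proof -
      define S where "S = {node T N n..node T N (Suc n)}"
      have S: "S \<subseteq> {0..T}" using sub[OF n] by (simp add: S_def)
      note cS = continuous_on_subset[OF cW(1) S] continuous_on_subset[OF cW(2) S] continuous_on_subset[OF g S]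
      have ig: "(\<lambda>s. g s * poly \<phi> s) integrable_on S" "(\<lambda>s. (k s s * F s - mem F s) * poly \<phi> s) integrable_on S"
         "(\<lambda>s. (k s s * R s - mem R s - d s) * poly \<phi> s) integrable_on S" "(\<lambda>s. \<bar>poly \<phi> s\<bar>) integrable_on S"
        using cS unfolding S_def by (auto intro!: integrable_continuous_real continuous_intros)
      have "integral S (\<lambda>s. integral {0..s} (\<lambda>\<tau>. k s \<tau> * yh \<tau>) * poly \<phi> s) =
          integral S (\<lambda>s. g s * poly \<phi> s - (k s s * F s - mem F s) * poly \<phi> s)"
      proof (rule integral_cong)
        fix s assume "s \<in> S"
        then have "integral {0..s} (\<lambda>\<tau>. k s \<tau> * yh \<tau>) = g s - (k s s * F s - mem F s)" using V S by blast
        then show "integral {0..s} (\<lambda>\<tau>. k s \<tau> * yh \<tau>) * poly \<phi> s =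
            g s * poly \<phi> s - (k s s * F s - mem F s) * poly \<phi> s"
          by (simp only: left_diff_distrib)
      qed
      also have "\<dots> = integral S (\<lambda>s. g s * poly \<phi> s) - integral S (\<lambda>s. (k s s * F s - mem F s) * poly \<phi> s)"
        by (rule Henstock_Kurzweil_Integration.integral_diff[OF ig(1,2)])
      finally have 1: "integral S (\<lambda>s. (k s s * F s - mem F s) * poly \<phi> s) = - integral S (\<lambda>s. \<delta> s * poly \<phi> s)"
        using dg_eq[OF \<phi> n] by (simp add: S_def)
      have 2: "\<bar>integral S (\<lambda>s. \<delta> s * poly \<phi> s)\<bar> \<le> \<Delta> * integral S (\<lambda>s. \<bar>poly \<phi> s\<bar>)"
      proof (cases "(\<lambda>s. \<delta> s * poly \<phi> s) integrable_on S")
        case True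
        have "norm (integral S (\<lambda>s. \<delta> s * poly \<phi> s)) \<le> integral S (\<lambda>s. \<Delta> * \<bar>poly \<phi> s\<bar>)"
        proof (rule integral_norm_bound_integral[OF True])
          show "(\<lambda>s. \<Delta> * \<bar>poly \<phi> s\<bar>) integrable_on S" by (rule integrable_on_mult_right[OF ig(4)])
          show "norm (\<delta> s * poly \<phi> s) \<le> \<Delta> * \<bar>poly \<phi> s\<bar>" if "s \<in> S" for s
            using \<delta> S that by (auto simp: abs_mult intro!: mult_right_mono)
        qed
        then show ?thesis by simp
      next
        \<comment> \<open>A product that is not integrable has integral \<open>0\<close> by
          convention, and the bound is then trivial.\<close>
        case False
        then show ?thesis using \<Delta>0 ig(4) by (simp add: not_integrable_integral integral_nonneg)
      qed
      have "integral S (\<lambda>t. (k t t * P t - mem P t - - d t) * poly \<phi> t) =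
          integral S (\<lambda>t. (k t t * F t - mem F t) * poly \<phi> t - (k t t * R t - mem R t - d t) * poly \<phi> t)"
      proof (rule integral_cong)
        fix t assume "t \<in> S"
        then have eq: "mem P t = mem F t - mem R t"
          unfolding P_def using mem_diff[OF F(1) R(1)] S by blast
        show "(k t t * P t - mem P t - - d t) * poly \<phi> t =
          (k t t * F t - mem F t) * poly \<phi> t - (k t t * R t - mem R t - d t) * poly \<phi> t"
          unfolding eq by (simp add: P_def algebra_simps)
      qed
      also have "\<dots> = - integral S (\<lambda>s. \<delta> s * poly \<phi> s) - integral S (\<lambda>t. (k t t * R t - mem R t - d t) * poly \<phi> t)"
        using Henstock_Kurzweil_Integration.integral_diff[OF ig(2,3)] 1 by simp
      finally show ?thesis using 2 R_orth[OF n \<phi>] unfolding S_def[symmetric] by (simp add: algebra_simps)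
    qed
    have PQ: "\<forall>n<N. \<exists>Q. degree Q \<le> m \<and> (\<forall>t\<in>{node T N n..node T N (Suc n)}. P t = poly Q t)"
      using P_poly by blast
    define M where "M = C1 * (D + (e + \<Delta>) / h)"
    have P_le: "\<bar>P t\<bar> \<le> M" if "t \<in> {0..T}" for t
      unfolding M_def h_def
    proof (rule stab[rule_format, of N D "e + \<Delta>" P "\<lambda>t. - d t" t])
      show "\<bar>- d s - - d s'\<bar> \<le> D * \<bar>s - s'\<bar>" if "s \<in> {0..T}" "s' \<in> {0..T}" for s s'
        using d(2) that by (simp add: abs_minus_commute)
    qed (use N small D e \<Delta>0 P d(1) orth PQ that in auto)
    have "t \<le> node T N (Suc (N - 1))" using t N by (simp add: node_simps del: node_simps(2))
    then obtain j where j: "j \<le> N - 1" "t \<in> {node T N j..node T N (Suc j)}" "j = 0 \<or> node T N j < t"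
      using in_some_cell[of t T N "N - 1"] t by auto
    have jN: "j < N" using j N by simp
    \<comment> \<open>The cell contains \<open>t\<close> in its half-open part, except for
      \<open>t = 0\<close>, where \<open>yh\<close> is given by the limit from the right.\<close>
    have yht: "yh t = poly (qh j) t"
    proof (cases "node T N j < t")
      case True
      then show ?thesis using qh(2)[OF jN, of t] j by simp
    next
      case False
      then have "j = 0" "t = 0" using j by (auto simp: node_simps(1))
      then show ?thesis using qh(3) by simp
    qed
    obtain Q where Q: "degree Q \<le> m" "pderiv Q = q j - qh j" "\<forall>t\<in>{node T N j..node T N (Suc j)}. P t = poly Q t"
      using P_poly[OF jN] by blast
    have "\<bar>poly Q x\<bar> \<le> M" if "x \<in> {node T N j..node T N j + h}" for x
    proof -
      have x: "x \<in> {node T N j..node T N (Suc j)}" using that by (simp add: h_def node_simps(2))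
      then have "x \<in> {0..T}" using sub[OF jN] by blast
      then show ?thesis using P_le[of x] Q(3) x by simp
    qed
    then have "\<bar>poly (pderiv Q) t\<bar> \<le> C2 * M / h"
      using Q(1) h j(2) by (intro inv[rule_format, of Q h "node T N j"]) (simp_all add: h_def node_simps(2))
    then have "\<bar>poly (q j) t - yh t\<bar> \<le> C2 * M / h" by (simp add: Q(2) yht)
    then show ?thesis using \<beta>[OF jN j(2)] by (simp add: M_def h_def mult.assoc)
  qed
  then show ?thesis using C1 C2 h0 by (intro exI[of _ "C2 * C1"] conjI exI[of _ h0]) auto
qed

end

section \<open>Residual of the comparison function and convergence\<close>

lemma abs_integral_mult_poly_le:
  fixes f :: "real \<Rightarrow> real"
  assumes "continuous_on {a..b} f" "\<And>t. t \<in> {a..b} \<Longrightarrow> \<bar>f t\<bar> \<le> e"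
  shows "\<bar>integral {a..b} (\<lambda>t. f t * poly \<phi> t)\<bar> \<le> e * integral {a..b} (\<lambda>t. \<bar>poly \<phi> t\<bar>)"
proof -
  have "norm (integral {a..b} (\<lambda>t. f t * poly \<phi> t)) \<le> integral {a..b} (\<lambda>t. e * \<bar>poly \<phi> t\<bar>)"
    by (rule integral_norm_bound_integral)
       (use assms in \<open>auto intro!: integrable_continuous_real continuous_intros mult_right_mono simp: abs_mult\<close>)
  then show ?thesis by simp
qed

context volterra_kernel
begin

lemma bound_of_cells:
  assumes "0 < N" "\<And>n t. n < N \<Longrightarrow> t \<in> {node T N n..node T N (Suc n)} \<Longrightarrow> \<bar>R t\<bar> \<le> M" "t \<in> {0..T}"
  shows "\<bar>R t\<bar> \<le> M"
proof -
  have "t \<le> node T N (Suc (N - 1))" using assms by (simp add: node_simps del: node_simps(2))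
  then obtain j where "j \<le> N - 1" "t \<in> {node T N j..node T N (Suc j)}"
    using in_some_cell[of t T N "N - 1"] assms(3) by auto
  then show ?thesis using assms(1) by (intro assms(2)[of j]) auto
qed

lemma cell_subset:
  assumes "n < N"
  shows "{node T N n..node T N (Suc n)} \<subseteq> {0..T}"
  using node_le[of T "Suc n" N] node_nonneg[of T N n] assms T_pos by auto

text \<open>No shaping here: \<open>(x ^ (m + 1) - x) / (m + 1)\<close> is the simplest admissible
  profile, and the whole residual counts as rough (\<open>d = 0\<close>). Losing two powers of
  \<open>h\<close> leaves the order \<open>m - 1\<close>.\<close>

lemma comparison_exists:
  assumes m: "m \<ge> 1"
    and deriv: "\<forall>i\<le>m. \<forall>t\<in>{0..T}. (D i has_real_derivative D (Suc i) t) (at t within {0..T})"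
    and cont: "\<forall>i\<le>Suc m. continuous_on {0..T} (D i)"
  shows "\<exists>C\<ge>0. \<forall>N>0. \<exists>q R d. comparison (D 0) m N (C * mesh_size T N ^ m) 0 (C * mesh_size T N ^ (m + 1)) q R d"
proof -
  define \<Psi> :: "real poly" where "\<Psi> = smult (1 / real (m + 1)) (monom 1 (m + 1) - monom 1 1)"
  have "monom 1 m - pderiv \<Psi> = monom (1 / real (m + 1)) 0"
    by (simp add: \<Psi>_def pderiv_smult pderiv_diff pderiv_monom smult_diff_right smult_monom del: of_nat_Suc)
  then have \<Psi>: "poly \<Psi> 0 = 0" "poly \<Psi> 1 = 0" "degree (monom 1 m - pderiv \<Psi>) \<le> m - 1"
    by (auto simp: \<Psi>_def poly_monom degree_monom_eq)
  obtain C where C: "C \<ge> 0" and R: "\<forall>N>0. \<exists>q R. (\<forall>n<N. degree (q n) \<le> m - 1) \<and>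
    (\<forall>n<N. \<forall>t\<in>{node T N n..node T N (Suc n)}. \<bar>D 0 t - poly (q n) t\<bar> \<le> C * mesh_size T N ^ m) \<and>
    continuous_on {0..T} R \<and> R 0 = 0 \<and>
    (\<forall>n<N. \<forall>t\<in>{node T N n..node T N (Suc n)}.
       R t = R (node T N n) + integral {node T N n..t} (\<lambda>x. D 0 x - poly (q n) x)) \<and>
    (\<forall>n<N. \<forall>t\<in>{node T N n..node T N (Suc n)}. \<bar>R t\<bar> \<le> C * mesh_size T N ^ (m + 1) \<and>
       \<bar>R t - mesh_size T N ^ (m + 1) * (D m (node T N n) / fact m) * poly \<Psi> ((t - node T N n) / mesh_size T N)\<bar>
         \<le> C * mesh_size T N ^ (m + 2))"
    using defect_antiderivative[where D = D, OF T_pos m deriv cont \<Psi>] by (elim exE conjE) (rule that)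
  \<comment> \<open>\<open>B * C\<close> bounds the diagonal term;
    \<open>B * (T + 1) * C * T\<close> bounds the memory term, which is Lipschitz and vanishes at
    \<open>0\<close>.\<close>
  define C' where "C' = C + B * C + B * (T + 1) * C * T"
  have C': "C' \<ge> 0" "C \<le> C'" using C B_pos T_pos by (auto simp: C'_def)
  have "\<exists>q R d. comparison (D 0) m N (C' * mesh_size T N ^ m) 0 (C' * mesh_size T N ^ (m + 1)) q R d" if N: "N > 0" for N
  proof -
    define h where "h = mesh_size T N"
    have h: "h > 0" using T_pos N by (simp add: h_def mesh_size_def)
    obtain q R where qR: "\<forall>n<N. degree (q n) \<le> m - 1"
      "\<forall>n<N. \<forall>t\<in>{node T N n..node T N (Suc n)}. \<bar>D 0 t - poly (q n) t\<bar> \<le> C * h ^ m"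
      "continuous_on {0..T} R" "R 0 = 0"
      "\<forall>n<N. \<forall>t\<in>{node T N n..node T N (Suc n)}.
         R t = R (node T N n) + integral {node T N n..t} (\<lambda>x. D 0 x - poly (q n) x)"
      "\<forall>n<N. \<forall>t\<in>{node T N n..node T N (Suc n)}. \<bar>R t\<bar> \<le> C * h ^ (m + 1)"
      using R[rule_format, OF N] unfolding h_def by blast
    have R_le: "\<bar>R t\<bar> \<le> C * h ^ (m + 1)" if "t \<in> {0..T}" for t
      using bound_of_cells[OF N _ that] qR(6) by blast
    have W_le: "\<bar>k t t * R t - mem R t\<bar> \<le> C' * h ^ (m + 1)" if t: "t \<in> {0..T}" for t
    proof -
      have "\<bar>k t t * R t\<bar> \<le> B * (C * h ^ (m + 1))"
        unfolding abs_mult using diag_upper[OF t] R_le[OF t] B_pos by (intro mult_mono) auto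
      moreover have "\<bar>mem R t - mem R 0\<bar> \<le> B * (T + 1) * (C * h ^ (m + 1)) * \<bar>t - 0\<bar>"
        using t T_pos by (intro mem_lipschitz[of T] qR R_le) auto
      moreover have "B * (T + 1) * (C * h ^ (m + 1)) * \<bar>t - 0\<bar> \<le> B * (T + 1) * (C * h ^ (m + 1)) * T"
        using t B_pos T_pos C h by (intro mult_left_mono) auto
      moreover have "0 \<le> C * h ^ (m + 1)" using C h by simp
      ultimately show ?thesis unfolding C'_def by (simp add: algebra_simps)
    qed
    have cW: "continuous_on {0..T} (\<lambda>t. k t t * R t - mem R t - 0)"
      by (intro continuous_intros diag_continuous mem_continuous qR)
    have "comparison (D 0) m N (C' * h ^ m) 0 (C' * h ^ (m + 1)) q R (\<lambda>_. 0)"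
      unfolding comparison_def
    proof (intro conjI allI impI ballI)
      fix n t assume "n < N" "t \<in> {node T N n..node T N (Suc n)}"
      then have "\<bar>D 0 t - poly (q n) t\<bar> \<le> C * h ^ m" using qR by blast
      also have "\<dots> \<le> C' * h ^ m" using C' h by (intro mult_right_mono) auto
      finally show "\<bar>D 0 t - poly (q n) t\<bar> \<le> C' * h ^ m" .
    next
      show "R t = R (node T N n) + integral {node T N n..t} (\<lambda>x. D 0 x - poly (q n) x)"
        if "n < N" "t \<in> {node T N n..node T N (Suc n)}" for n t using qR(5) that by blast
    next
      fix n and \<phi> :: "real poly" assume n: "n < N"
      show "\<bar>integral {node T N n..node T N (Suc n)} (\<lambda>t. (k t t * R t - mem R t - 0) * poly \<phi> t)\<bar>
        \<le> C' * h ^ (m + 1) * integral {node T N n..node T N (Suc n)} (\<lambda>t. \<bar>poly \<phi> t\<bar>)"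
        by (rule abs_integral_mult_poly_le[OF continuous_on_subset[OF cW cell_subset[OF n]]])
           (use W_le cell_subset[OF n] in auto)
    qed (use qR(1,3,4) in simp_all)
    then show ?thesis unfolding h_def by blast
  qed
  then show ?thesis using C' by blast
qed

text \<open>For odd \<open>m\<close> the Legendre polynomial of degree \<open>m + 1\<close> takes the same value at both end points, so
  that \<open>L - 1\<close> is an admissible profile: it vanishes at the nodes, and \<open>L\<close> is invisible to the test
  functions. What is left of the residual is Lipschitz continuous up to terms of one order higher.\<close>

lemma comparison_exists_odd:
  assumes m: "odd m"
    and deriv: "\<forall>i\<le>m. \<forall>t\<in>{0..T}. (D i has_real_derivative D (Suc i) t) (at t within {0..T})"
    and cont: "\<forall>i\<le>Suc m. continuous_on {0..T} (D i)"
  shows "\<exists>C\<ge>0. \<forall>N>0. \<exists>q R d.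
    comparison (D 0) m N (C * mesh_size T N ^ m) (C * mesh_size T N ^ (m + 1)) (C * mesh_size T N ^ (m + 2)) q R d"
proof -
  have m1: "m \<ge> 1" using m by (cases m) auto
  obtain L :: "real poly" where L: "degree L = Suc m" "poly L 1 = 1" "poly L 0 = 1"
    "\<And>\<phi>. degree \<phi> < Suc m \<Longrightarrow> ((\<lambda>x. poly L x * poly \<phi> x) has_integral 0) {0..1}"
    using legendre_exists[of "Suc m"] m by auto
  \<comment> \<open>Chosen so that the derivative of \<open>\<gamma> * L\<close> has leading
    coefficient \<open>1\<close>, as an admissible profile requires.\<close>
  define \<gamma> where "\<gamma> = 1 / (real (Suc m) * coeff L (Suc m))"
  have lc: "coeff L (Suc m) \<noteq> 0" using L(1) by (metis Zero_not_Suc degree_0 leading_coeff_0_iff)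
  define \<Psi> where "\<Psi> = smult \<gamma> (L - 1)"
  have "coeff (monom 1 m - pderiv \<Psi>) i = 0" if "i > m - 1" for i
  proof (cases "i = m")
    case True
    then show ?thesis using lc by (simp add: \<Psi>_def pderiv_smult pderiv_diff coeff_pderiv \<gamma>_def)
  next
    case False
    then have "i > m" using that by simp
    then show ?thesis using L(1) by (simp add: \<Psi>_def pderiv_smult pderiv_diff coeff_pderiv coeff_eq_0)
  qed
  then have \<Psi>: "poly \<Psi> 0 = 0" "poly \<Psi> 1 = 0" "degree (monom 1 m - pderiv \<Psi>) \<le> m - 1"
    using L by (auto simp: \<Psi>_def intro: degree_le)
  obtain C where C: "C \<ge> 0" and R: "\<forall>N>0. \<exists>q R. (\<forall>n<N. degree (q n) \<le> m - 1) \<and>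
    (\<forall>n<N. \<forall>t\<in>{node T N n..node T N (Suc n)}. \<bar>D 0 t - poly (q n) t\<bar> \<le> C * mesh_size T N ^ m) \<and>
    continuous_on {0..T} R \<and> R 0 = 0 \<and>
    (\<forall>n<N. \<forall>t\<in>{node T N n..node T N (Suc n)}.
       R t = R (node T N n) + integral {node T N n..t} (\<lambda>x. D 0 x - poly (q n) x)) \<and>
    (\<forall>n<N. \<forall>t\<in>{node T N n..node T N (Suc n)}. \<bar>R t\<bar> \<le> C * mesh_size T N ^ (m + 1) \<and>
       \<bar>R t - mesh_size T N ^ (m + 1) * (D m (node T N n) / fact m) * poly \<Psi> ((t - node T N n) / mesh_size T N)\<bar>
         \<le> C * mesh_size T N ^ (m + 2))"
    using defect_antiderivative[where D = D, OF T_pos m1 deriv cont \<Psi>] by (elim exE conjE) (rule that)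
  define A where "A t = D m t / fact m" for t
  have cA: "continuous_on {0..T} A" unfolding A_def using cont[rule_format, of m] by (intro continuous_intros) auto
  obtain MA where MA: "MA \<ge> 0" "\<And>t. t \<in> {0..T} \<Longrightarrow> \<bar>A t\<bar> \<le> MA" using bounded_on_Icc[OF cA] by blast
  obtain LA where LA: "LA \<ge> 0" "\<And>t. t \<in> {0..T} \<Longrightarrow> \<bar>D (Suc m) t\<bar> \<le> LA"
    using bounded_on_Icc[OF cont[rule_format, of "Suc m"]] by blast
  have A_lip: "\<bar>A s - A t\<bar> \<le> LA * \<bar>s - t\<bar>" if "s \<in> {0..T}" "t \<in> {0..T}" for s t
  proof -
    have "norm (D m s - D m t) \<le> LA * norm (s - t)"
      by (rule field_differentiable_bound[of "{0..T}" _ "D (Suc m)"]) (use deriv LA that in auto)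
    also have "\<dots> \<le> LA * norm (s - t) * fact m"
      using mult_left_mono[OF fact_ge_1, of "LA * norm (s - t)" m] LA(1) by simp
    finally show ?thesis by (simp add: A_def divide_le_eq flip: diff_divide_distrib)
  qed
  have "continuous_on {0..1} (poly L)" by (intro continuous_intros)
  then obtain BL where BL: "BL \<ge> 0" "\<And>x. x \<in> {0..1} \<Longrightarrow> \<bar>poly L x\<bar> \<le> BL"
    using bounded_on_Icc by blast
  define g where "g = \<bar>\<gamma>\<bar>"
  define C1 where "C1 = g * (B * MA) + g * (B * LA + B * MA) + B * (T + 1) * C"
  define C2 where "C2 = B * C + g * MA * B * BL + g * B * LA"
  have g: "g \<ge> 0" by (simp add: g_def)
  have C12: "C1 \<ge> 0" "C2 \<ge> 0" using C MA LA BL B_pos T_pos g by (auto simp: C1_def C2_def)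
  define C' where "C' = C + C1 + C2"
  have C': "C' \<ge> 0" "C \<le> C'" "C1 \<le> C'" "C2 \<le> C'" using C C12 by (auto simp: C'_def)
  have "\<exists>q R d. comparison (D 0) m N (C' * mesh_size T N ^ m) (C' * mesh_size T N ^ (m + 1)) (C' * mesh_size T N ^ (m + 2)) q R d"
    if N: "N > 0" for N
  proof -
    define h where "h = mesh_size T N"
    have h: "h > 0" using T_pos N by (simp add: h_def mesh_size_def)
    have node_Suc: "node T N (Suc n) = node T N n + h" for n by (simp add: h_def node_simps)
    obtain q R where qR: "\<forall>n<N. degree (q n) \<le> m - 1"
      "\<forall>n<N. \<forall>t\<in>{node T N n..node T N (Suc n)}. \<bar>D 0 t - poly (q n) t\<bar> \<le> C * h ^ m"
      "continuous_on {0..T} R" "R 0 = 0"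
      "\<forall>n<N. \<forall>t\<in>{node T N n..node T N (Suc n)}.
         R t = R (node T N n) + integral {node T N n..t} (\<lambda>x. D 0 x - poly (q n) x)"
      "\<forall>n<N. \<forall>t\<in>{node T N n..node T N (Suc n)}. \<bar>R t\<bar> \<le> C * h ^ (m + 1)"
      "\<forall>n<N. \<forall>t\<in>{node T N n..node T N (Suc n)}.
         \<bar>R t - h ^ (m + 1) * A (node T N n) * poly \<Psi> ((t - node T N n) / h)\<bar> \<le> C * h ^ (m + 2)"
      using R[rule_format, OF N] unfolding h_def A_def by blast
    have R_le: "\<bar>R t\<bar> \<le> C * h ^ (m + 1)" if "t \<in> {0..T}" for t
      using bound_of_cells[OF N _ that] qR(6) by blast
    define H where "H = h ^ (m + 1)"
    have H: "H > 0" using h by (simp add: H_def)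
    \<comment> \<open>The leading residual is
      \<open>k t t * H * A(node) * \<gamma> * (L - 1) - mem R\<close>. Here the part with
      \<open>L\<close> is dropped, and the nodal value of \<open>A\<close> is replaced by
      \<open>A t\<close>, which removes the jumps at the nodes.\<close>
    define d where "d t = - \<gamma> * H * (k t t * A t) - mem R t" for t
    have KA: "\<bar>k s s * A s - k t t * A t\<bar> \<le> (B * LA + B * MA) * \<bar>s - t\<bar>" if "s \<in> {0..T}" "t \<in> {0..T}" for s t
    proof -
      have "k s s * A s - k t t * A t = k s s * (A s - A t) + (k s s - k t t) * A t" by (simp add: algebra_simps)
      moreover have "\<bar>k s s * (A s - A t)\<bar> \<le> B * (LA * \<bar>s - t\<bar>)"
        unfolding abs_mult using diag_upper[OF that(1)] A_lip[OF that] B_pos by (intro mult_mono) auto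
      moreover have "\<bar>(k s s - k t t) * A t\<bar> \<le> (B * \<bar>s - t\<bar>) * MA"
        unfolding abs_mult using diag_lipschitz[OF that] MA(2)[OF that(2)] B_pos by (intro mult_mono) auto
      ultimately show ?thesis by (simp add: algebra_simps)
    qed
    have d_lip: "\<bar>d s - d t\<bar> \<le> C1 * H * \<bar>s - t\<bar>" if "s \<in> {0..T}" "t \<in> {0..T}" for s t
    proof -
      have "d s - d t = - (\<gamma> * H * (k s s * A s - k t t * A t)) - (mem R s - mem R t)"
        by (simp add: d_def algebra_simps)
      moreover have "\<bar>\<gamma> * H * (k s s * A s - k t t * A t)\<bar> \<le> g * H * ((B * LA + B * MA) * \<bar>s - t\<bar>)"
        using KA[OF that] H by (simp add: abs_mult g_def mult_left_mono)
      moreover have "\<bar>mem R s - mem R t\<bar> \<le> B * (T + 1) * (C * H) * \<bar>s - t\<bar>"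
        unfolding H_def by (rule mem_lipschitz[OF qR(3) R_le order_refl that])
      moreover have "0 \<le> g * (B * MA) * H * \<bar>s - t\<bar>" using g B_pos MA H by simp
      moreover have "C1 * H * \<bar>s - t\<bar> = g * (B * MA) * H * \<bar>s - t\<bar> + g * H * ((B * LA + B * MA) * \<bar>s - t\<bar>)
          + B * (T + 1) * (C * H) * \<bar>s - t\<bar>" by (simp add: C1_def algebra_simps)
      ultimately show ?thesis by linarith
    qed
    have d_0: "\<bar>d 0\<bar> \<le> C1 * H"
    proof -
      have "\<bar>k 0 0 * A 0\<bar> \<le> B * MA"
        unfolding abs_mult using diag_upper[of 0] MA(2)[of 0] B_pos T_pos by (intro mult_mono) auto
      then have "\<bar>d 0\<bar> \<le> g * H * (B * MA)" using H by (simp add: d_def abs_mult g_def mult_left_mono)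
      moreover have "0 \<le> (g * (B * LA + B * MA) + B * (T + 1) * C) * H" using g B_pos MA LA C T_pos H by simp
      ultimately show ?thesis unfolding C1_def by (simp add: algebra_simps)
    qed
    have cW: "continuous_on {0..T} (\<lambda>t. k t t * R t - mem R t - d t)"
      by (intro continuous_intros diag_continuous mem_continuous qR continuous_on_real_lipschitz[of _ d "C1 * H"] d_lip)
    have orth: "\<bar>integral {node T N n..node T N (Suc n)} (\<lambda>t. (k t t * R t - mem R t - d t) * poly \<phi> t)\<bar>
        \<le> C' * h ^ (m + 2) * integral {node T N n..node T N (Suc n)} (\<lambda>t. \<bar>poly \<phi> t\<bar>)"
      if n: "n < N" and \<phi>: "degree \<phi> \<le> m - 1" for n \<phi>
    proof -
      define a where "a = node T N n"
      have sub: "{a..a + h} \<subseteq> {0..T}" using cell_subset[OF n] by (simp add: a_def node_Suc)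
      have a: "a \<in> {0..T}" using sub h by auto
      \<comment> \<open>The coefficient of \<open>L\<close> is frozen at the left node, so that this
        term is exactly orthogonal to the test polynomials.\<close>
      define c where "c = \<gamma> * H * (k a a * A a)"
      define \<epsilon> where "\<epsilon> t = k t t * R t - mem R t - d t - c * poly L ((t - a) / h)" for t
      have \<epsilon>: "\<bar>\<epsilon> t\<bar> \<le> C' * h ^ (m + 2)" if t: "t \<in> {a..a + h}" for t
      proof -
        define x where "x = (t - a) / h"
        have t': "t \<in> {0..T}" and x: "x \<in> {0..1}" using t sub h by (auto simp: x_def)
        have ta: "\<bar>t - a\<bar> \<le> h" using t by auto
        \<comment> \<open>Three errors of order \<open>h ^ (m + 2)\<close>: the higher-order part of
          \<open>R\<close>, and the freezing at \<open>a\<close> of \<open>k\<close> on the diagonal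
          and of \<open>A\<close>.\<close>
        have "\<epsilon> t = k t t * (R t - H * A a * poly \<Psi> x) + \<gamma> * H * A a * (k t t - k a a) * poly L x + \<gamma> * H * k t t * (A t - A a)"
          by (simp add: \<epsilon>_def d_def \<Psi>_def c_def x_def algebra_simps)
        moreover have "\<bar>k t t * (R t - H * A a * poly \<Psi> x)\<bar> \<le> B * (C * h ^ (m + 2))"
          unfolding abs_mult using diag_upper[OF t'] qR(7) n t B_pos
          by (intro mult_mono) (auto simp: H_def x_def a_def node_Suc)
        moreover have "\<bar>\<gamma> * H * A a * (k t t - k a a) * poly L x\<bar> \<le> g * H * MA * (B * h) * BL"
        proof -
          have "\<bar>k t t - k a a\<bar> \<le> B * h"
            using diag_lipschitz[OF t' a] mult_left_mono[OF ta, of B] B_pos by linarith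
          then show ?thesis unfolding abs_mult g_def
            using MA(2)[OF a] MA(1) BL(2)[OF x] B_pos h H by (intro mult_mono) auto
        qed
        moreover have "\<bar>\<gamma> * H * k t t * (A t - A a)\<bar> \<le> g * H * B * (LA * h)"
        proof -
          have "\<bar>A t - A a\<bar> \<le> LA * h" using A_lip[OF t' a] mult_left_mono[OF ta, of LA] LA(1) by linarith
          then show ?thesis unfolding abs_mult g_def
            using diag_upper[OF t'] B_pos h H by (intro mult_mono) auto
        qed
        ultimately have "\<bar>\<epsilon> t\<bar> \<le> B * (C * h ^ (m + 2)) + g * H * MA * (B * h) * BL + g * H * B * (LA * h)"
          by linarith
        also have "\<dots> = C2 * h ^ (m + 2)" by (simp add: C2_def H_def algebra_simps)
        also have "\<dots> \<le> C' * h ^ (m + 2)" using C' h by (intro mult_right_mono) auto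
        finally show ?thesis .
      qed
      have c1: "continuous_on {a..a + h} (\<lambda>t. k t t * R t - mem R t - d t)" by (rule continuous_on_subset[OF cW sub])
      have c\<epsilon>: "continuous_on {a..a + h} \<epsilon>"
        unfolding \<epsilon>_def using h by (intro continuous_on_diff[OF c1] continuous_intros) auto
      have "degree (pcompose \<phi> [:a, h:]) < Suc m"
        using degree_pcompose_linear_le[of \<phi> a h] \<phi> by simp
      from integral_unique[OF L(4)[OF this]]
      have "integral {a..a + h} (\<lambda>t. c * (poly L ((t - a) / h) * poly \<phi> t)) = 0"
        using h by (subst integral_affine) (auto intro!: continuous_intros simp: poly_pcompose mult.commute)
      moreover have "integral {a..a + h} (\<lambda>t. (k t t * R t - mem R t - d t) * poly \<phi> t) =
          integral {a..a + h} (\<lambda>t. \<epsilon> t * poly \<phi> t) + integral {a..a + h} (\<lambda>t. c * (poly L ((t - a) / h) * poly \<phi> t))"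
      proof -
        have "integral {a..a + h} (\<lambda>t. (k t t * R t - mem R t - d t) * poly \<phi> t) =
            integral {a..a + h} (\<lambda>t. \<epsilon> t * poly \<phi> t + c * (poly L ((t - a) / h) * poly \<phi> t))"
          by (rule integral_cong) (simp add: \<epsilon>_def algebra_simps)
        also have "\<dots> = integral {a..a + h} (\<lambda>t. \<epsilon> t * poly \<phi> t) + integral {a..a + h} (\<lambda>t. c * (poly L ((t - a) / h) * poly \<phi> t))"
          using h by (intro Henstock_Kurzweil_Integration.integral_add integrable_continuous_real continuous_intros c\<epsilon>) auto
        finally show ?thesis .
      qed
      ultimately have "integral {a..a + h} (\<lambda>t. (k t t * R t - mem R t - d t) * poly \<phi> t) =
          integral {a..a + h} (\<lambda>t. \<epsilon> t * poly \<phi> t)" by (simp only: add_0_right)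
      then show ?thesis
        using abs_integral_mult_poly_le[OF c\<epsilon> \<epsilon>, of \<phi>] by (simp only: a_def node_Suc)
    qed
    have mono: "C1 * H * x \<le> C' * h ^ (m + 1) * x" if "x \<ge> 0" for x
      using C' H that unfolding H_def by (intro mult_right_mono) auto
    have "comparison (D 0) m N (C' * h ^ m) (C' * h ^ (m + 1)) (C' * h ^ (m + 2)) q R d"
      unfolding comparison_def
    proof (intro conjI allI impI ballI)
      fix n t assume "n < N" "t \<in> {node T N n..node T N (Suc n)}"
      then have "\<bar>D 0 t - poly (q n) t\<bar> \<le> C * h ^ m" using qR by blast
      also have "\<dots> \<le> C' * h ^ m" using C' h by (intro mult_right_mono) auto
      finally show "\<bar>D 0 t - poly (q n) t\<bar> \<le> C' * h ^ m" .
    next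
      show "R t = R (node T N n) + integral {node T N n..t} (\<lambda>x. D 0 x - poly (q n) x)"
        if "n < N" "t \<in> {node T N n..node T N (Suc n)}" for n t using qR(5) that by blast
    next
      show "\<bar>d 0\<bar> \<le> C' * h ^ (m + 1)" using d_0 mono[of 1] by simp
      show "\<bar>d s - d t\<bar> \<le> C' * h ^ (m + 1) * \<bar>s - t\<bar>" if "s \<in> {0..T}" "t \<in> {0..T}" for s t
        using d_lip[OF that] mono[of "\<bar>s - t\<bar>"] by simp
    qed (use qR(1,3,4) orth in simp_all)
    then show ?thesis unfolding h_def by blast
  qed
  then show ?thesis using C' by blast
qed

end

section \<open>Collecting the constants; the final rates\<close>

lemma lipschitz_kernel_mono: "lipschitz_kernel T B \<kappa> \<Longrightarrow> B \<le> B' \<Longrightarrow> lipschitz_kernel T B' \<kappa>"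
  unfolding lipschitz_kernel_def
  by (smt (verit, best) mult_right_mono)

lemma volterra_kernel_exists:
  assumes "0 < T" "0 < k0" "\<And>t. t \<in> {0..T} \<Longrightarrow> k0 \<le> \<bar>k t t\<bar>"
    and "C_diff_on (Suc (Suc n)) (triangle T) (\<lambda>(t, s). k t s)"
  obtains B ks where "volterra_kernel T k0 B k ks"
proof -
  obtain kt ks where d: "\<And>t s. (t, s) \<in> triangle T \<Longrightarrow> (k t has_real_derivative ks t s) (at s within {0..t})"
    "C_diff_on (Suc n) (triangle T) (\<lambda>(t, s). ks t s)"
    using C_diff_on_kernel_partials[OF assms(4)] by metis
  obtain B1 where B1: "lipschitz_kernel T B1 k" using C_diff_on_imp_lipschitz_kernel[OF assms(4)] .
  obtain B2 where B2: "lipschitz_kernel T B2 ks" using C_diff_on_imp_lipschitz_kernel[OF d(2)] .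
  note nonneg = lipschitz_kernel_nonneg[OF B1] lipschitz_kernel_nonneg[OF B2]
  \<comment> \<open>Along the diagonal both arguments move, hence \<open>2 * B1\<close>;
    \<open>B2\<close> serves for \<open>ks\<close>, and the \<open>1\<close> makes \<open>B\<close>
    positive.\<close>
  define B where "B = 2 * B1 + B2 + 1"
  have "volterra_kernel T k0 B k ks"
  proof
    show "\<bar>k t t\<bar> \<le> B" if "t \<in> {0..T}" for t
      using lipschitz_kernel_bound[OF B1, of t t] that nonneg by (auto simp: B_def)
    show "\<bar>k t t - k t' t'\<bar> \<le> B * \<bar>t - t'\<bar>" if "t \<in> {0..T}" "t' \<in> {0..T}" for t t'
    proof -
      have "(t, t) \<in> triangle T" "(t', t') \<in> triangle T" using that by (auto simp: triangle_def)
      then have "\<bar>k t t - k t' t'\<bar> \<le> B1 * (\<bar>t - t'\<bar> + \<bar>t - t'\<bar>)" using B1 unfolding lipschitz_kernel_def by blast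
      also have "\<dots> = 2 * B1 * \<bar>t - t'\<bar>" by simp
      also have "\<dots> \<le> B * \<bar>t - t'\<bar>" using nonneg by (intro mult_right_mono) (auto simp: B_def)
      finally show ?thesis .
    qed
    show "lipschitz_kernel T B ks" by (rule lipschitz_kernel_mono[OF B2]) (use nonneg in \<open>simp add: B_def\<close>)
    show "(k t has_real_derivative ks t s) (at s within {0..t})" if "0 \<le> s" "s \<le> t" "t \<le> T" for s t
      using d(1)[of t s] that by (simp add: triangle_def)
  qed (use assms nonneg in \<open>auto simp: B_def\<close>)
  then show thesis by (rule that)
qed

text \<open>Counting powers of \<open>h\<close>: the Lipschitz part \<open>D\<close> loses one, the
  rough part \<open>e\<close> and the perturbation lose two. For odd \<open>m\<close>, orders
  \<open>m + 1\<close> and \<open>m + 2\<close> both end at \<open>m\<close>; for even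
  \<open>m\<close>, the rough residual of order \<open>m + 1\<close> ends at
  \<open>m - 1\<close>.\<close>

theorem perturbed_dg_convergence:
  fixes T k0 C' m1 :: real and m :: nat and \<delta> :: "nat \<Rightarrow> real \<Rightarrow> real"
  assumes T: "T > 0" and m: "m \<ge> 1" and k0: "k0 > 0" "\<And>t. t \<in> {0..T} \<Longrightarrow> k0 \<le> \<bar>k t t\<bar>"
    and g: "C_diff_on (Suc (Suc m)) {0..T} g" and k: "C_diff_on (Suc (Suc (Suc m))) (triangle T) (\<lambda>(t, s). k t s)"
    and sol: "volterra_solution T k g y"
    and \<delta>: "\<forall>N\<ge>2. \<forall>t\<in>{0..T}. \<bar>\<delta> N t\<bar> \<le> C' * mesh_size T N powr m1"
  defines "p \<equiv> (if odd m then real m else real m - 1)"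
  shows "\<exists>C>0. \<exists>h0>0. \<forall>N\<ge>2. \<forall>yh. mesh_size T N < h0 \<longrightarrow> perturbed_dg_solution T N m k g (\<delta> N) yh \<longrightarrow>
    (\<forall>t\<in>{0..T}. \<bar>y t - yh t\<bar> \<le> C * mesh_size T N powr (min p (m1 - 2)))"
proof -
  obtain B ks where "volterra_kernel T k0 B k ks"
    using volterra_kernel_exists[OF T k0 k] by blast
  then interpret volterra_kernel T k0 B k ks .
  have "k t t \<noteq> 0" if "t \<in> {0..T}" for t using k0 that by fastforce
  then have "C_diff_on (Suc m) {0..T} y" by (rule volterra_solution_C_diff_on[OF T g k _ sol])
  then obtain D where D: "D 0 = y"
    "\<And>i t. i < Suc m \<Longrightarrow> t \<in> {0..T} \<Longrightarrow> (D i has_real_derivative D (Suc i) t) (at t within {0..T})"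
    "\<And>i. i \<le> Suc m \<Longrightarrow> continuous_on {0..T} (D i)" using C_diff_on_derivative_sequence by metis
  have D': "\<forall>i\<le>m. \<forall>t\<in>{0..T}. (D i has_real_derivative D (Suc i) t) (at t within {0..T})"
    "\<forall>i\<le>Suc m. continuous_on {0..T} (D i)" using D(2,3) by auto
  obtain C1 h1 where C1: "C1 > 0" and h1: "h1 > 0"
    and err: "\<forall>N \<delta> yh \<Delta> \<beta> D e q R d. 0 < N \<longrightarrow> mesh_size T N < h1 \<longrightarrow> 0 \<le> D \<longrightarrow> 0 \<le> e \<longrightarrow>
      comparison y m N \<beta> D e q R d \<longrightarrow> perturbed_dg_solution T N m k g \<delta> yh \<longrightarrow>
      (\<forall>t\<in>{0..T}. \<bar>\<delta> t\<bar> \<le> \<Delta>) \<longrightarrow>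
      (\<forall>t\<in>{0..T}. \<bar>y t - yh t\<bar> \<le> \<beta> + C1 * (D + (e + \<Delta>) / mesh_size T N) / mesh_size T N)"
    using dg_error[OF m C_diff_on_imp_continuous_on[OF g] sol] by blast
  have "\<exists>C2\<ge>0. \<forall>N>0. mesh_size T N \<le> 1 \<longrightarrow> (\<exists>\<beta> D e q R d. 0 \<le> D \<and> 0 \<le> e \<and> comparison y m N \<beta> D e q R d \<and>
      \<beta> + C1 * (D + e / mesh_size T N) / mesh_size T N \<le> C2 * mesh_size T N powr p)"
  proof (cases "odd m")
    case True
    obtain C where C: "C \<ge> 0" "\<forall>N>0. \<exists>q R d.
      comparison y m N (C * mesh_size T N ^ m) (C * mesh_size T N ^ (m + 1)) (C * mesh_size T N ^ (m + 2)) q R d"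
      using comparison_exists_odd[where D = D, OF True D'] unfolding D(1) by blast
    show ?thesis
    proof (rule exI[of _ "C + 2 * C1 * C"], intro conjI allI impI)
      fix N :: nat assume N: "N > 0"
      define h where "h = mesh_size T N"
      have h: "h > 0" using T N by (simp add: h_def mesh_size_def)
      obtain q R d where "comparison y m N (C * h ^ m) (C * h ^ (m + 1)) (C * h ^ (m + 2)) q R d"
        using C(2) N unfolding h_def by blast
      moreover have "C * h ^ m + C1 * (C * h ^ (m + 1) + C * h ^ (m + 2) / h) / h \<le> (C + 2 * C1 * C) * h powr p"
        using h True by (simp add: p_def powr_realpow field_simps)
      moreover have "0 \<le> C * h ^ (m + 1)" "0 \<le> C * h ^ (m + 2)" using C h by auto
      ultimately show "\<exists>\<beta> D e q R d. 0 \<le> D \<and> 0 \<le> e \<and> comparison y m N \<beta> D e q R d \<and>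
        \<beta> + C1 * (D + e / mesh_size T N) / mesh_size T N \<le> (C + 2 * C1 * C) * mesh_size T N powr p"
        unfolding h_def by blast
    qed (use C C1 in simp)
  next
    case False
    obtain C where C: "C \<ge> 0" "\<forall>N>0. \<exists>q R d.
      comparison y m N (C * mesh_size T N ^ m) 0 (C * mesh_size T N ^ (m + 1)) q R d"
      using comparison_exists[where D = D, OF m D'] unfolding D(1) by blast
    show ?thesis
    proof (rule exI[of _ "C + C1 * C"], intro conjI allI impI)
      fix N :: nat assume N: "N > 0" and le1: "mesh_size T N \<le> 1"
      define h where "h = mesh_size T N"
      have h: "h > 0" "h \<le> 1" using T N le1 by (auto simp: h_def mesh_size_def)
      obtain q R d where "comparison y m N (C * h ^ m) 0 (C * h ^ (m + 1)) q R d"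
        using C(2) N unfolding h_def by blast
      moreover have "C * h ^ m + C1 * (0 + C * h ^ (m + 1) / h) / h \<le> (C + C1 * C) * h powr p"
      proof -
        obtain i where i: "m = Suc i" using m by (cases m) auto
        have "h powr p = h ^ i" using h False by (simp add: p_def i powr_realpow)
        \<comment> \<open>Here \<open>h \<le> 1\<close> is used: the approximation error of order
          \<open>m\<close> is swallowed by the order \<open>m - 1\<close>.\<close>
        moreover have "C * (h * h ^ i) \<le> C * (1 * h ^ i)" using C h by (intro mult_left_mono mult_right_mono) auto
        ultimately show ?thesis using h by (simp add: i field_simps)
      qed
      moreover have "0 \<le> C * h ^ (m + 1)" using C h by auto
      ultimately show "\<exists>\<beta> D e q R d. 0 \<le> D \<and> 0 \<le> e \<and> comparison y m N \<beta> D e q R d \<and>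
        \<beta> + C1 * (D + e / mesh_size T N) / mesh_size T N \<le> (C + C1 * C) * mesh_size T N powr p"
        unfolding h_def by blast
    qed (use C C1 in simp)
  qed
  then obtain C2 where C2: "C2 \<ge> 0" and cmp: "\<And>N. N > 0 \<Longrightarrow> mesh_size T N \<le> 1 \<Longrightarrow>
     (\<exists>\<beta> D e q R d. 0 \<le> D \<and> 0 \<le> e \<and> comparison y m N \<beta> D e q R d \<and>
      \<beta> + C1 * (D + e / mesh_size T N) / mesh_size T N \<le> C2 * mesh_size T N powr p)" by blast
  \<comment> \<open>For \<open>h \<le> 1\<close> the smaller exponent gives the larger power, so
    both rates are dominated by the one with the minimum. The final \<open>1\<close> only ensures a
    positive constant.\<close>
  have "\<bar>y t - yh t\<bar> \<le> (C2 + C1 * \<bar>C'\<bar> + 1) * mesh_size T N powr (min p (m1 - 2))"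
    if N: "N \<ge> 2" and small: "mesh_size T N < min 1 h1" and dg: "perturbed_dg_solution T N m k g (\<delta> N) yh"
      and t: "t \<in> {0..T}" for N yh t
  proof -
    define h where "h = mesh_size T N"
    have h: "h > 0" "h \<le> 1" using T N small by (auto simp: h_def mesh_size_def)
    obtain \<beta> D e q R d where c: "0 \<le> D" "0 \<le> e" "comparison y m N \<beta> D e q R d"
      "\<beta> + C1 * (D + e / h) / h \<le> C2 * h powr p"
      using cmp[of N] N small unfolding h_def by auto
    have "\<bar>y t - yh t\<bar> \<le> \<beta> + C1 * (D + (e + C' * h powr m1) / h) / h"
      unfolding h_def
      by (rule err[rule_format, of N D e \<beta> q R d "\<delta> N" yh "C' * mesh_size T N powr m1" t])
         (use N small c dg t \<delta> in auto)
    also have "\<dots> = \<beta> + C1 * (D + e / h) / h + C1 * C' * (h powr m1 / h\<^sup>2)"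
      using h by (simp add: field_simps power2_eq_square)
    also have "h powr m1 / h\<^sup>2 = h powr (m1 - 2)" using h by (simp add: powr_diff powr_numeral)
    also have "\<beta> + C1 * (D + e / h) / h + C1 * C' * h powr (m1 - 2) \<le>
        C2 * h powr (min p (m1 - 2)) + C1 * \<bar>C'\<bar> * h powr (min p (m1 - 2))"
    proof (intro add_mono)
      have "C2 * h powr p \<le> C2 * h powr (min p (m1 - 2))" using C2 h by (intro mult_left_mono powr_mono') auto
      then show "\<beta> + C1 * (D + e / h) / h \<le> C2 * h powr (min p (m1 - 2))" using c(4) by linarith
      have "C1 * C' * h powr (m1 - 2) \<le> C1 * \<bar>C'\<bar> * h powr (m1 - 2)"
        using C1 by (intro mult_right_mono mult_left_mono) auto
      also have "\<dots> \<le> C1 * \<bar>C'\<bar> * h powr (min p (m1 - 2))"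
        using C1 h by (intro mult_left_mono powr_mono') auto
      finally show "C1 * C' * h powr (m1 - 2) \<le> C1 * \<bar>C'\<bar> * h powr (min p (m1 - 2))" .
    qed
    also have "\<dots> \<le> (C2 + C1 * \<bar>C'\<bar> + 1) * h powr (min p (m1 - 2))" by (simp add: algebra_simps)
    finally show ?thesis by (simp add: h_def)
  qed
  moreover have "C2 + C1 * \<bar>C'\<bar> + 1 > 0" using C1 C2 by (simp add: add_nonneg_pos)
  moreover have "min 1 h1 > 0" using h1 by simp
  ultimately show ?thesis by blast
qed

theorem theorem3p7:
  fixes T k0 C' m1 :: real and m :: nat
    and k :: "real \<Rightarrow> real \<Rightarrow> real" and g y :: "real \<Rightarrow> real"
    and \<delta> :: "nat \<Rightarrow> real \<Rightarrow> real"
  assumes "T > 0" and "m \<ge> 1"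
    and "g 0 = 0"
    and "k0 > 0" and "\<forall>t\<in>{0..T}. \<bar>k t t\<bar> \<ge> k0"
    and "C_diff_on (m + 3) {0..T} g"
    and "C_diff_on (m + 3) (triangle T) (\<lambda>(t, s). k t s)"
    and "volterra_solution T k g y"
    and "\<forall>N\<ge>2. \<delta> N integrable_on {0..T}"
    and "\<forall>N\<ge>2. \<forall>t\<in>{0..T}. \<bar>\<delta> N t\<bar> \<le> C' * mesh_size T N powr m1"
  shows
    "(\<exists>C. \<exists>h0>0. \<forall>N\<ge>2. \<forall>yh.
        mesh_size T N < h0 \<longrightarrow> perturbed_dg_solution T N m k g (\<delta> N) yh \<longrightarrow>
        (SUP t\<in>{0..T}. \<bar>y t - yh t\<bar>) \<le>
          (if odd m then C * mesh_size T N powr (min (real m) (m1 - 2))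
           else C * mesh_size T N powr (min (real m - 1) (m1 - 2)))) \<and>
     (m1 > 2 \<longrightarrow>
       (\<forall>\<epsilon>>0. \<exists>h0>0. \<forall>N\<ge>2. \<forall>yh.
          mesh_size T N < h0 \<longrightarrow> perturbed_dg_solution T N m k g (\<delta> N) yh \<longrightarrow>
          (\<forall>t\<in>{0..T}. \<bar>y t - yh t\<bar> < \<epsilon>)))"
proof -
  define p where "p = (if odd m then real m else real m - 1)"
  have g: "C_diff_on (Suc (Suc m)) {0..T} g" using assms(6) by (rule C_diff_on_le) simp
  have k: "C_diff_on (Suc (Suc (Suc m))) (triangle T) (\<lambda>(t, s). k t s)" using assms(7) by (rule C_diff_on_le) simp
  obtain C h0 where C: "C > 0" and h0: "h0 > 0" and
    bound: "\<And>N yh t. N \<ge> 2 \<Longrightarrow> mesh_size T N < h0 \<Longrightarrow> perturbed_dg_solution T N m k g (\<delta> N) yh \<Longrightarrow> t \<in> {0..T} \<Longrightarrow>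
      \<bar>y t - yh t\<bar> \<le> C * mesh_size T N powr (min p (m1 - 2))"
    using perturbed_dg_convergence[OF assms(1,2,4) _ g k assms(8,10)] assms(5) unfolding p_def[symmetric] by blast
  show ?thesis
  proof (intro conjI impI allI)
    have "(SUP t\<in>{0..T}. \<bar>y t - yh t\<bar>) \<le>
          (if odd m then C * mesh_size T N powr (min (real m) (m1 - 2))
           else C * mesh_size T N powr (min (real m - 1) (m1 - 2)))"
      if "N \<ge> 2" "mesh_size T N < h0" "perturbed_dg_solution T N m k g (\<delta> N) yh" for N yh
    proof (rule cSUP_least)
      show "\<bar>y t - yh t\<bar> \<le> (if odd m then C * mesh_size T N powr (min (real m) (m1 - 2))
           else C * mesh_size T N powr (min (real m - 1) (m1 - 2)))" if "t \<in> {0..T}" for t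
        using bound[OF \<open>N \<ge> 2\<close> \<open>mesh_size T N < h0\<close> \<open>perturbed_dg_solution T N m k g (\<delta> N) yh\<close> that]
        by (simp add: p_def split: if_splits)
    qed (use assms(1) in simp)
    then show "\<exists>C. \<exists>h0>0. \<forall>N\<ge>2. \<forall>yh.
        mesh_size T N < h0 \<longrightarrow> perturbed_dg_solution T N m k g (\<delta> N) yh \<longrightarrow>
        (SUP t\<in>{0..T}. \<bar>y t - yh t\<bar>) \<le>
          (if odd m then C * mesh_size T N powr (min (real m) (m1 - 2))
           else C * mesh_size T N powr (min (real m - 1) (m1 - 2)))"
      using h0 by (intro exI[of _ C] exI[of _ h0]) blast
  next
    fix \<epsilon> :: real assume m1: "m1 > 2" and \<epsilon>: "\<epsilon> > 0"
    define r where "r = min p (m1 - 2)"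
    \<comment> \<open>An even \<open>m\<close> with \<open>m \<ge> 1\<close> is at least
      \<open>2\<close>, so the rate \<open>m - 1\<close> is positive as well.\<close>
    have "m \<ge> 2" if "even m" using assms(2) that by (cases "m = 1") auto
    then have r: "r > 0" using m1 assms(2) by (auto simp: r_def p_def)
    \<comment> \<open>The solution of \<open>C * h1 powr r = \<epsilon>\<close>.\<close>
    define h1 where "h1 = (\<epsilon> / C) powr (1 / r)"
    have "\<bar>y t - yh t\<bar> < \<epsilon>"
      if N: "N \<ge> 2" and small: "mesh_size T N < min h0 h1" and dg: "perturbed_dg_solution T N m k g (\<delta> N) yh"
        and t: "t \<in> {0..T}" for N yh t
    proof -
      have "mesh_size T N powr r < h1 powr r"
        using small r assms(1) N by (intro powr_less_mono2) (auto simp: mesh_size_def)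
      also have "h1 powr r = \<epsilon> / C" using r \<epsilon> C by (simp add: h1_def powr_powr)
      finally have "C * mesh_size T N powr r < \<epsilon>" using C by (simp add: field_simps)
      then show ?thesis using bound[OF N _ dg t] small by (simp add: r_def)
    qed
    moreover have "min h0 h1 > 0" using h0 \<epsilon> C by (simp add: h1_def)
    ultimately show "\<exists>h0>0. \<forall>N\<ge>2. \<forall>yh.
          mesh_size T N < h0 \<longrightarrow> perturbed_dg_solution T N m k g (\<delta> N) yh \<longrightarrow>
          (\<forall>t\<in>{0..T}. \<bar>y t - yh t\<bar> < \<epsilon>)" by blast
  qed
qed

end
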